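(* Let $k=2^{32}$ and $d=3\cdot 2^{5268390106224805281791998}$. Let $U_1,\ldots,U_k\in \mathrm{U}(d)$ be the explicit permutation unitaries and $F\in M_d(\mathbb{C})$ the explicit hermitian matrix defined in the context. Then the map $\Phi:M_d(\mathbb{C})\to M_k(\mathbb{C})$ defined by $$[\Phi(\rho)]_{ij}:=\frac1k\operatorname{Tr}(U_iF\rho FU_j^* )+\frac{\delta_{ij}}{k}\operatorname{Tr}((I_d-F^2)\rho),\qquad i,j=1,\ldots,k,$$ is a quantum channel and satisfies $$2H_{\min}(\Phi)-H_{\min}(\Phi\otimes\Phi)>\frac{3}{17179869184}.$$
   Context: All logarithms are natural. A density matrix is a positive semidefinite matrix of trace one; a quantum channel is a completely positive trace-preserving linear map. The von Neumann entropy is $H(\rho)=-\operatorname{Tr}(\rho\log\rho)$, and $H_{\min}(\Phi)=\min_\rho H(\Phi(\rho))$, the minimum being over all input density matrices $\rho$. $\|\cdot\|_{\mathrm{HS}}$ is the Hilbert--Schmidt (Frobenius) norm. Parameters: $k=2^{32}$, $r=k(k-1)$, $m=350r$, $\eta=64k$, $L=25/8$, $n=272m$, $M=2^n=(16k^2)^{4m}$. Unitaries: for $j=1,\dots,k$ let $$a_j=\begin{pmatrix}1+4j&-8j^2\\2&1-4j\end{pmatrix}\in \mathrm{SL}_2(\mathbb{Z}),$$ reduced modulo $M$, so that $a_j\in G:=\mathrm{SL}_2(\mathbb{Z}/M\mathbb{Z})$. One has $|G|=3\cdot 2^{3n-2}=d$. Identify $\mathbb{C}^d$ with $\ell^2(G)$,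 with standard orthonormal basis $\{|g\rangle:g\in G\}$. Define $U_j|g\rangle=|a_jg\rangle$ for $g\in G$, $j=1,\dots,k$. Damping matrix: for a $k\times k$ matrix $A$ put $T_A=\sum_{i\ne j}A_{ij}U_i^*U_j$. For $1\le a<b\le k$ let $E^{\mathrm R}_{ab}=\frac1{\sqrt2}(|a\rangle\langle b|+|b\rangle\langle a|)$ and $E^{\mathrm I}_{ab}=\frac{i}{\sqrt2}(|a\rangle\langle b|-|b\rangle\langle a|)$. For $q=(x_{ab},y_{ab})_{a<b}\in\{-\eta,\ldots,\eta\}^r\setminus\{0\}$ (integer vectors) let $$A_q=\frac{\sum_{a<b}(x_{ab}E^{\mathrm R}_{ab}+y_{ab}E^{\mathrm I}_{ab})}{\sqrt{\sum_{a<b}(x_{ab}^2+y_{ab}^2)}}.$$ Define $$R=\sum_{q\in\{-\eta,\ldots,\eta\}^r\setminus\{0\}}\left(\frac{T_{A_q}}{L}\right)^{2m},\qquad F=(I_d+R)^{-1}.$$ *)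

theory Defs
  imports "HOL-Analysis.Analysis"
begin

section \<open>Matrices, channels and entropies\<close>

text \<open>
  The algebra of matrices whose rows and columns are indexed by a finite type \<open>'n\<close> is
  \<open>complex^'n^'n\<close>, with product \<open>**\<close> and unit \<open>mat 1\<close>.  On this type
  the generic operations \<open>*\<close> and \<open>^\<close> act entrywise and \<open>*s\<close> multiplies
  by a vector, so matrix powers and complex multiples are defined here.
\<close>

definition cscale :: "complex \<Rightarrow> complex^'n^'m \<Rightarrow> complex^'n^'m" where
  "cscale c A = (\<chi> i j. c * A $ i $ j)"

definition matpow :: "complex^'n^'n \<Rightarrow> nat \<Rightarrow> complex^'n^'n" where
  "matpow A n = ((**) A ^^ n) (mat 1)"

definition cadj :: "complex^'n^'m \<Rightarrow> complex^'m^'n" where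
  "cadj A = map_matrix cnj (transpose A)"

definition hermitian :: "complex^'n^'n \<Rightarrow> bool" where
  "hermitian A \<longleftrightarrow> cadj A = A"

definition unitary :: "complex^'n^'n \<Rightarrow> bool" where
  "unitary V \<longleftrightarrow> cadj V ** V = mat 1 \<and> V ** cadj V = mat 1"

definition diag_mat :: "('n \<Rightarrow> complex) \<Rightarrow> complex^'n^'n" where
  "diag_mat l = (\<chi> i j. if i = j then l i else 0)"

definition ketbra :: "'m \<Rightarrow> 'n \<Rightarrow> complex^'n^'m" where
  "ketbra a b = (\<chi> i j. if i = a \<and> j = b then 1 else 0)"

text \<open>
  Positive semidefiniteness is formulated for matrices indexed by an arbitrary finite set, so
  that it also covers the block matrices in \<open>M\<^sub>n \<otimes> M\<^sub>d\<close> for variable \<open>n\<close>.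
  Over the complex numbers the condition on the quadratic form forces hermiticity.
\<close>

definition psd_on :: "'i set \<Rightarrow> ('i \<Rightarrow> 'i \<Rightarrow> complex) \<Rightarrow> bool" where
  "psd_on S K \<longleftrightarrow> (\<forall>v. (\<Sum>i\<in>S. \<Sum>j\<in>S. cnj (v i) * K i j * v j) \<in> \<real>\<^sub>\<ge>\<^sub>0)"

definition psd :: "complex^'n^'n \<Rightarrow> bool" where
  "psd A \<longleftrightarrow> psd_on UNIV (\<lambda>i j. A $ i $ j)"

definition density :: "complex^'n^'n \<Rightarrow> bool" where
  "density \<rho> \<longleftrightarrow> psd \<rho> \<and> trace \<rho> = 1"

definition linear_map :: "(complex^'a^'a \<Rightarrow> complex^'b^'b) \<Rightarrow> bool" where
  "linear_map \<Phi> \<longleftrightarrow> (\<forall>X Y. \<Phi> (X + Y) = \<Phi> X + \<Phi> Y) \<and> (\<forall>c X. \<Phi> (cscale c X) = cscale c (\<Phi> X))"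

text \<open>
  An element of \<open>M\<^sub>n \<otimes> M\<^sub>d\<close> is given by its blocks \<open>X p q\<close> with
  \<open>p, q < n\<close>; then \<open>id\<^sub>n \<otimes> \<Phi>\<close> applies \<open>\<Phi>\<close> to every block.
\<close>

definition completely_positive :: "(complex^'a^'a \<Rightarrow> complex^'b^'b) \<Rightarrow> bool" where
  "completely_positive \<Phi> \<longleftrightarrow>
     (\<forall>(n::nat) (X :: nat \<Rightarrow> nat \<Rightarrow> complex^'a^'a).
        psd_on ({..<n} \<times> UNIV) (\<lambda>(p, i) (q, j). X p q $ i $ j) \<longrightarrow>
        psd_on ({..<n} \<times> UNIV) (\<lambda>(p, i) (q, j). \<Phi> (X p q) $ i $ j))"

definition trace_preserving :: "(complex^'a^'a \<Rightarrow> complex^'b^'b) \<Rightarrow> bool" where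
  "trace_preserving \<Phi> \<longleftrightarrow> (\<forall>X. trace (\<Phi> X) = trace X)"

definition quantum_channel :: "(complex^'a^'a \<Rightarrow> complex^'b^'b) \<Rightarrow> bool" where
  "quantum_channel \<Phi> \<longleftrightarrow> linear_map \<Phi> \<and> completely_positive \<Phi> \<and> trace_preserving \<Phi>"

definition kron :: "complex^'a^'b \<Rightarrow> complex^'c^'d \<Rightarrow> complex^('a \<times> 'c)^('b \<times> 'd)" where
  "kron A B = (\<chi> p q. A $ fst p $ fst q * B $ snd p $ snd q)"

definition tensor_map ::
  "(complex^'a^'a \<Rightarrow> complex^'b^'b) \<Rightarrow> (complex^'c^'c \<Rightarrow> complex^'d^'d) \<Rightarrow>
   complex^('a \<times> 'c)^('a \<times> 'c) \<Rightarrow> complex^('b \<times> 'd)^('b \<times> 'd)" where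
  "tensor_map \<Phi> \<Psi> Z =
     (\<Sum>p\<in>UNIV. \<Sum>q\<in>UNIV. cscale (Z $ p $ q)
        (kron (\<Phi> (ketbra (fst p) (fst q))) (\<Psi> (ketbra (snd p) (snd q)))))"

text \<open>
  Logarithm of a hermitian matrix by the functional calculus; the value does not depend on the
  chosen diagonalisation.  A zero eigenvalue is mapped to \<open>ln 0\<close>, a real number that is
  multiplied by \<open>0\<close> in \<open>\<rho> log \<rho>\<close>, which gives the convention \<open>0 log 0 = 0\<close>.
\<close>

definition mat_log :: "complex^'n^'n \<Rightarrow> complex^'n^'n" where
  "mat_log A = (SOME B. \<exists>V (l :: 'n \<Rightarrow> real). unitary V \<and>
      A = V ** diag_mat (\<lambda>i. complex_of_real (l i)) ** cadj V \<and>
      B = V ** diag_mat (\<lambda>i. complex_of_real (ln (l i))) ** cadj V)"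

text \<open>The trace below is real for every density matrix.\<close>

definition entropy :: "complex^'n^'n \<Rightarrow> real" where
  "entropy \<rho> = - Re (trace (\<rho> ** mat_log \<rho>))"

text \<open>
  For a channel, \<open>\<rho> \<mapsto> entropy (\<Phi> \<rho>)\<close> is continuous on the compact set of density
  matrices, so the infimum is the minimum.
\<close>

definition H_min :: "(complex^'a^'a \<Rightarrow> complex^'b^'b) \<Rightarrow> real" where
  "H_min \<Phi> = (INF \<rho>\<in>{\<rho>. density \<rho>}. entropy (\<Phi> \<rho>))"


section \<open>Parameters\<close>

definition par_k :: nat where "par_k = 2 ^ 32"
definition par_r :: nat where "par_r = par_k * (par_k - 1)"
definition par_m :: nat where "par_m = 350 * par_r"
definition par_eta :: nat where "par_eta = 64 * par_k"
definition par_L :: real where "par_L = 25 / 8"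
definition par_n :: nat where "par_n = 272 * par_m"
definition par_M :: int where "par_M = 2 ^ par_n"

lemma par_M_eq: "par_M = (16 * int par_k ^ 2) ^ (4 * par_m)"
proof -
  have "16 * int par_k ^ 2 = 2 ^ 68" by (simp add: par_k_def)
  then have "(16 * int par_k ^ 2) ^ (4 * par_m) = (2 ^ 68) ^ (4 * par_m)" by (rule arg_cong)
  also have "\<dots> = 2 ^ (68 * (4 * par_m))" by (rule power_mult[symmetric])
  also have "68 * (4 * par_m) = par_n" by (simp add: par_n_def)
  finally show ?thesis by (simp add: par_M_def)
qed

lemma par_n_eq: "par_n = Suc (par_n - 1)"
  by (simp add: par_n_def par_m_def par_r_def par_k_def)

lemma par_M_gt_1: "1 < par_M"
  unfolding par_M_def by (subst par_n_eq) (rule one_less_power, auto)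


section \<open>The group and the permutation unitaries\<close>

text \<open>
  The index set \<open>{1..k}\<close> as a type, and \<open>SL\<^sub>2(\<int>/M\<int>)\<close> as a type, with every
  residue represented in \<open>{0..<M}\<close>.
\<close>

lemma par_k_ge_1: "1 \<le> par_k"
  by (simp add: par_k_def)

typedef idx = "{1..par_k}"
  using par_k_ge_1 by (intro exI[of _ 1]) simp

typedef sl2 = "{A :: int^2^2. (\<forall>i j. 0 \<le> A $ i $ j \<and> A $ i $ j < par_M) \<and> det A mod par_M = 1}"
  using par_M_gt_1 by (auto simp: mat_def det_2 intro!: exI[of _ "mat 1"])

setup_lifting type_definition_sl2

instance idx :: finite
proof
  have "UNIV = Abs_idx ` {1..par_k}"
    by (rule type_definition.univ[OF type_definition_idx])
  then show "finite (UNIV :: idx set)" by (metis finite_atLeastAtMost finite_imageI)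
qed

lemma card_idx: "CARD(idx) = 2 ^ 32"
proof -
  have "CARD(idx) = card {1..par_k}"
    by (rule type_definition.card[OF type_definition_idx])
  also have "\<dots> = par_k" by simp
  finally show ?thesis by (simp only: par_k_def)
qed

definition mod_M :: "int^2^2 \<Rightarrow> int^2^2" where
  "mod_M A = map_matrix (\<lambda>x. x mod par_M) A"

lemma mod_M_nth: "mod_M A $ i $ j = A $ i $ j mod par_M"
  by (simp add: mod_M_def map_matrix_def)

lemma det_mod_M: "det (mod_M A) mod par_M = det A mod par_M"
  unfolding det_2 mod_M_nth by (intro mod_diff_cong mod_mult_eq)

definition a_mat :: "nat \<Rightarrow> int^2^2" where
  "a_mat j = vector [vector [1 + 4 * int j, - 8 * int j ^ 2], vector [2, 1 - 4 * int j]]"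

lemma det_a_mat: "det (a_mat j) = 1"
  by (simp add: det_2 a_mat_def algebra_simps power2_eq_square)

lift_definition sl2_mult :: "sl2 \<Rightarrow> sl2 \<Rightarrow> sl2" is "\<lambda>A B. mod_M (A ** B)"
proof -
  fix A B :: "int^2^2"
  assume A: "(\<forall>i j. 0 \<le> A $ i $ j \<and> A $ i $ j < par_M) \<and> det A mod par_M = 1"
    and B: "(\<forall>i j. 0 \<le> B $ i $ j \<and> B $ i $ j < par_M) \<and> det B mod par_M = 1"
  have "det (mod_M (A ** B)) mod par_M = (det A mod par_M) * (det B mod par_M) mod par_M"
    by (simp add: det_mod_M det_mul mod_simps)
  then show "(\<forall>i j. 0 \<le> mod_M (A ** B) $ i $ j \<and> mod_M (A ** B) $ i $ j < par_M) \<and>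
      det (mod_M (A ** B)) mod par_M = 1"
    using A B par_M_gt_1 by (simp add: mod_M_nth)
qed

lift_definition a_elt :: "nat \<Rightarrow> sl2" is "\<lambda>j. mod_M (a_mat j)"
  using par_M_gt_1 by (simp add: mod_M_nth det_mod_M det_a_mat)

text \<open>
  Counting \<open>SL\<^sub>2(\<int>/2\<^sup>n\<int>)\<close>: the first row contains an odd entry, which can be inverted to
  solve for one entry of the second row.
\<close>

lemma odd_inverse_mod:
  fixes a :: int
  assumes "odd a"
  obtains b where "a * b mod 2 ^ n = 1 mod 2 ^ n"
proof -
  have "coprime a (2 ^ n)" using assms by simp
  then obtain u v where "u * a + v * 2 ^ n = 1"
    by (metis bezout_int coprime_imp_gcd_eq_1)
  then have "a * u = 1 + 2 ^ n * (- v)" by (simp add: algebra_simps)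
  then have "a * u mod 2 ^ n = 1 mod 2 ^ n" by (metis mod_mult_self2)
  with that show thesis by blast
qed

lemma card_odd_residues:
  assumes "0 < n"
  shows "card {a \<in> {0..<2 ^ n :: int}. odd a} = 2 ^ (n - 1)"
    and "card {a \<in> {0..<2 ^ n :: int}. even a} = 2 ^ (n - 1)"
proof -
  have p: "(2::int) ^ n = 2 * 2 ^ (n - 1)" using assms by (cases n) auto
  have "{a \<in> {0..<2 ^ n :: int}. odd a} = (\<lambda>t. 2 * t + 1) ` {0..<2 ^ (n - 1)}"
    unfolding p by (auto elim!: oddE)
  then show "card {a \<in> {0..<2 ^ n :: int}. odd a} = 2 ^ (n - 1)"
    by (simp add: card_image inj_on_def nat_power_eq)
  have "{a \<in> {0..<2 ^ n :: int}. even a} = (\<lambda>t. 2 * t) ` {0..<2 ^ (n - 1)}"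
    unfolding p by (auto elim!: evenE)
  then show "card {a \<in> {0..<2 ^ n :: int}. even a} = 2 ^ (n - 1)"
    by (simp add: card_image inj_on_def nat_power_eq)
qed

lemma unique_solution_mod:
  fixes a c N :: int
  assumes "odd a" and N: "N = 2 ^ n"
  shows "\<exists>!x. x \<in> {0..<N} \<and> a * x mod N = c mod N"
proof -
  obtain b where b: "a * b mod N = 1 mod N" using odd_inverse_mod[OF assms(1)] N by metis
  have "a * (b * c mod N) mod N = a * (b * c) mod N" by (rule mod_mult_right_eq)
  also have "\<dots> = (a * b) mod N * c mod N" by (simp add: mod_mult_left_eq mult.assoc)
  also have "\<dots> = c mod N" by (simp add: b mod_mult_left_eq)
  finally have ex: "a * (b * c mod N) mod N = c mod N" .
  have un: "x = y" if "x \<in> {0..<N}" "y \<in> {0..<N}" "a * x mod N = a * y mod N" for x y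
  proof -
    have *: "z = b * (a * z) mod N" if "z \<in> {0..<N}" for z
    proof -
      have "b * (a * z) mod N = (a * b) mod N * z mod N"
        by (simp add: mod_mult_left_eq mult.assoc mult.left_commute)
      also have "\<dots> = z mod N" by (simp add: b mod_mult_left_eq)
      finally show ?thesis using that by simp
    qed
    have "x = b * (a * x mod N) mod N" using *[OF that(1)] by (simp add: mod_mult_right_eq)
    also have "\<dots> = y" unfolding that(3) using *[OF that(2)] by (simp add: mod_mult_right_eq)
    finally show ?thesis .
  qed
  have "b * c mod N \<in> {0..<N}" using N by simp
  with ex un show ?thesis by metis
qed

lemma card_sl2_tuples:
  fixes N :: int
  assumes n: "0 < n" and N: "N = 2 ^ n"
  shows "card {(a, b, c, d). a \<in> {0..<N} \<and> b \<in> {0..<N} \<and> c \<in> {0..<N} \<and> d \<in> {0..<N} \<and>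
           (a * d - b * c) mod N = 1} = 3 * 2 ^ (3 * n - 2)" (is "card ?S = _")
proof -
  let ?I = "{0..<N}"
  let ?O = "{a \<in> ?I. odd a}" and ?E = "{a \<in> ?I. even a}"
  let ?P = "\<lambda>a b c d. (a * d - b * c) mod N = 1"
  let ?S1 = "{(a, b, c, d). a \<in> ?O \<and> b \<in> ?I \<and> c \<in> ?I \<and> d \<in> ?I \<and> ?P a b c d}"
  let ?S2 = "{(a, b, c, d). a \<in> ?E \<and> b \<in> ?O \<and> c \<in> ?I \<and> d \<in> ?I \<and> ?P a b c d}"
  have N2: "even N" "1 < N" using n N by (auto simp: one_less_power)
  have one: "1 mod N = 1" using N2 by simp
  have not_even: "odd a \<or> odd b" if "?P a b c d" for a b c d
  proof (rule ccontr)
    assume "\<not> ?thesis"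
    then have "even ((a * d - b * c) mod N)" using N2 by (simp add: dvd_mod)
    with that show False by simp
  qed
  have S: "?S = ?S1 \<union> ?S2" using not_even by auto
  have eq1: "?P a b c d \<longleftrightarrow> a * d mod N = (1 + b * c) mod N" for a b c d
    using mod_add_cong[of "a * d - b * c" N 1 "b * c" "b * c"]
      mod_diff_cong[of "a * d" N "1 + b * c" "b * c" "b * c"] one by auto
  have eq2: "?P a b c d \<longleftrightarrow> b * c mod N = (a * d - 1) mod N" for a b c d
    using mod_diff_cong[of "a * d" N "a * d" "a * d - b * c" 1]
      mod_diff_cong[of "a * d" N "a * d" "b * c" "a * d - 1"] one by auto
  have "bij_betw (\<lambda>(a, b, c, d). (a, b, c)) ?S1 (?O \<times> ?I \<times> ?I)"
    unfolding bij_betw_def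
  proof
    show "inj_on (\<lambda>(a, b, c, d). (a, b, c)) ?S1"
      using unique_solution_mod[OF _ N] by (auto simp: inj_on_def eq1) 
    show "(\<lambda>(a, b, c, d). (a, b, c)) ` ?S1 = ?O \<times> ?I \<times> ?I"
    proof
      show "?O \<times> ?I \<times> ?I \<subseteq> (\<lambda>(a, b, c, d). (a, b, c)) ` ?S1"
      proof
        fix t assume t: "t \<in> ?O \<times> ?I \<times> ?I"
        obtain a b c where abc: "t = (a, b, c)" by (cases t)
        obtain d where "d \<in> ?I" "a * d mod N = (1 + b * c) mod N"
          using unique_solution_mod[OF _ N, of a "1 + b * c"] t abc by auto
        then show "t \<in> (\<lambda>(a, b, c, d). (a, b, c)) ` ?S1"
          using t abc by (intro image_eqI[of _ _ "(a, b, c, d)"]) (auto simp: eq1)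
      qed
    qed auto
  qed
  then have c1: "card ?S1 = 2 ^ (n - 1) * (2 ^ n * 2 ^ n)"
    using card_odd_residues[OF n] by (simp add: bij_betw_same_card N card_cartesian_product nat_power_eq)
  have "bij_betw (\<lambda>(a, b, c, d). (a, b, d)) ?S2 (?E \<times> ?O \<times> ?I)"
    unfolding bij_betw_def
  proof
    show "inj_on (\<lambda>(a, b, c, d). (a, b, d)) ?S2"
      using unique_solution_mod[OF _ N] by (auto simp: inj_on_def eq2)
    show "(\<lambda>(a, b, c, d). (a, b, d)) ` ?S2 = ?E \<times> ?O \<times> ?I"
    proof
      show "?E \<times> ?O \<times> ?I \<subseteq> (\<lambda>(a, b, c, d). (a, b, d)) ` ?S2"
      proof
        fix t assume t: "t \<in> ?E \<times> ?O \<times> ?I"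
        obtain a b d where abd: "t = (a, b, d)" by (cases t)
        obtain c where "c \<in> ?I" "b * c mod N = (a * d - 1) mod N"
          using unique_solution_mod[OF _ N, of b "a * d - 1"] t abd by auto
        then show "t \<in> (\<lambda>(a, b, c, d). (a, b, d)) ` ?S2"
          using t abd by (intro image_eqI[of _ _ "(a, b, c, d)"]) (auto simp: eq2)
      qed
    qed auto
  qed
  then have c2: "card ?S2 = 2 ^ (n - 1) * (2 ^ (n - 1) * 2 ^ n)"
    using card_odd_residues[OF n] by (simp add: bij_betw_same_card N card_cartesian_product nat_power_eq)
  have fin: "finite ?S1" "finite ?S2"
    by (rule finite_subset[of _ "?I \<times> ?I \<times> ?I \<times> ?I"]; force)+
  have "card ?S = card ?S1 + card ?S2"
    unfolding S using fin by (intro card_Un_disjoint) auto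
  also have "\<dots> = 3 * 2 ^ (3 * n - 2)"
  proof -
    obtain j where "n = Suc j" using n by (cases n) auto
    then show ?thesis unfolding c1 c2 by (simp add: power_add mult.commute[of j] numeral_3_eq_3 mult_Suc)
  qed
  finally show ?thesis .
qed

lemma card_sl2_set:
  "card {A :: int^2^2. (\<forall>i j. 0 \<le> A $ i $ j \<and> A $ i $ j < par_M) \<and> det A mod par_M = 1}
     = 3 * 2 ^ (3 * par_n - 2)" (is "card ?A = _")
proof -
  let ?S = "{(a, b, c, d). a \<in> {0..<par_M} \<and> b \<in> {0..<par_M} \<and> c \<in> {0..<par_M} \<and>
               d \<in> {0..<par_M} \<and> (a * d - b * c) mod par_M = 1}"
  let ?f = "\<lambda>A :: int^2^2. (A $ 1 $ 1, A $ 1 $ 2, A $ 2 $ 1, A $ 2 $ 2)"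
  have "bij_betw ?f ?A ?S"
    unfolding bij_betw_def
  proof
    show "inj_on ?f ?A"
      by (auto simp: inj_on_def vec_eq_iff forall_2)
    show "?f ` ?A = ?S"
    proof
      show "?S \<subseteq> ?f ` ?A"
      proof
        fix t assume t: "t \<in> ?S"
        obtain a b c d where abcd: "t = (a, b, c, d)" by (cases t)
        show "t \<in> ?f ` ?A"
          using t abcd
          by (intro image_eqI[of _ _ "vector [vector [a, b], vector [c, d]]"])
             (auto simp: det_2 forall_2)
      qed
    qed (auto simp: det_2)
  qed
  then have "card ?A = card ?S" by (rule bij_betw_same_card)
  also have "\<dots> = 3 * 2 ^ (3 * par_n - 2)"
  proof (rule card_sl2_tuples)
    show "0 < par_n" by (subst par_n_eq) (rule zero_less_Suc)
    show "par_M = 2 ^ par_n" by (rule par_M_def)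
  qed
  finally show ?thesis .
qed

instance sl2 :: finite
proof
  let ?A = "{A :: int^2^2. (\<forall>i j. 0 \<le> A $ i $ j \<and> A $ i $ j < par_M) \<and> det A mod par_M = 1}"
  have "UNIV = Abs_sl2 ` ?A"
    by (rule type_definition.univ[OF type_definition_sl2])
  moreover have "finite (Abs_sl2 ` ?A)"
    by (intro finite_imageI card_ge_0_finite) (unfold card_sl2_set, simp)
  ultimately show "finite (UNIV :: sl2 set)" by (rule ssubst)
qed

lemma card_sl2: "CARD(sl2) = 3 * 2 ^ 5268390106224805281791998"
proof -
  have "CARD(sl2) = 3 * 2 ^ (3 * par_n - 2)"
    using type_definition.card[OF type_definition_sl2] card_sl2_set by (rule trans)
  also have "3 * par_n - 2 = 5268390106224805281791998"
    by (simp add: par_n_def par_m_def par_r_def par_k_def)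
  finally show ?thesis .
qed

text \<open>\<open>U j |g\<rangle> = |a\<^sub>j g\<rangle>\<close>\<close>

definition U :: "idx \<Rightarrow> complex^sl2^sl2" where
  "U j = (\<chi> h g. if h = sl2_mult (a_elt (Rep_idx j)) g then 1 else 0)"


section \<open>The damping matrix and the channel\<close>

definition T_op :: "complex^idx^idx \<Rightarrow> complex^sl2^sl2" where
  "T_op A = (\<Sum>(i, j)\<in>{(i, j). i \<noteq> j}. cscale (A $ i $ j) (cadj (U i) ** U j))"

definition E_R :: "idx \<Rightarrow> idx \<Rightarrow> complex^idx^idx" where
  "E_R a b = cscale (1 / sqrt 2) (ketbra a b + ketbra b a)"

definition E_I :: "idx \<Rightarrow> idx \<Rightarrow> complex^idx^idx" where
  "E_I a b = cscale (\<i> / sqrt 2) (ketbra a b - ketbra b a)"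

definition pairs :: "(idx \<times> idx) set" where
  "pairs = {(a, b). Rep_idx a < Rep_idx b}"

text \<open>
  The nonzero vectors in \<open>{-\<eta>..\<eta>}\<^sup>r\<close> as pairs of functions \<open>(x, y)\<close> on the \<open>r / 2\<close> index
  pairs \<open>a < b\<close>, extended by \<open>undefined\<close> so that every vector occurs once.
\<close>

definition Q_set :: "((idx \<times> idx \<Rightarrow> int) \<times> (idx \<times> idx \<Rightarrow> int)) set" where
  "Q_set = (let V = pairs \<rightarrow>\<^sub>E {- int par_eta..int par_eta} in
     {(x, y). x \<in> V \<and> y \<in> V \<and> \<not> (\<forall>p\<in>pairs. x p = 0 \<and> y p = 0)})"

definition A_q :: "(idx \<times> idx \<Rightarrow> int) \<times> (idx \<times> idx \<Rightarrow> int) \<Rightarrow> complex^idx^idx" where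
  "A_q = (\<lambda>(x, y). (1 / sqrt (\<Sum>p\<in>pairs. real_of_int (x p ^ 2 + y p ^ 2))) *\<^sub>R
     (\<Sum>(a, b)\<in>pairs. real_of_int (x (a, b)) *\<^sub>R E_R a b + real_of_int (y (a, b)) *\<^sub>R E_I a b))"

definition R_op :: "complex^sl2^sl2" where
  "R_op = (\<Sum>q\<in>Q_set. matpow ((1 / par_L) *\<^sub>R T_op (A_q q)) (2 * par_m))"

definition F_op :: "complex^sl2^sl2" where
  "F_op = matrix_inv (mat 1 + R_op)"

definition Phi :: "complex^sl2^sl2 \<Rightarrow> complex^idx^idx" where
  "Phi \<rho> = (\<chi> i j.
     1 / of_nat par_k * trace (U i ** F_op ** \<rho> ** F_op ** cadj (U j)) +
     (if i = j then 1 else 0) / of_nat par_k * trace ((mat 1 - F_op ** F_op) ** \<rho>))"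


section \<open>Well-definedness\<close>

lemma cadj_nth: "cadj A $ i $ j = cnj (A $ j $ i)"
  by (simp add: cadj_def map_matrix_def transpose_def)

lemma cadj_mult: "cadj (A ** B) = cadj B ** cadj A"
  by (simp add: vec_eq_iff cadj_nth matrix_matrix_mult_def mult.commute)

lemma cadj_cadj [simp]: "cadj (cadj A) = A"
  by (simp add: vec_eq_iff cadj_nth)

lemma cadj_add: "cadj (A + B) = cadj A + cadj B"
  by (simp add: vec_eq_iff cadj_nth)

lemma cadj_diff: "cadj (A - B) = cadj A - cadj B"
  by (simp add: vec_eq_iff cadj_nth)

lemma cadj_0 [simp]: "cadj 0 = 0"
  by (simp add: vec_eq_iff cadj_nth)

lemma cadj_sum: "cadj (sum f S) = (\<Sum>x\<in>S. cadj (f x))"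
  by (induction S rule: infinite_finite_induct) (simp_all add: cadj_add)

lemma cadj_scaleR: "cadj (c *\<^sub>R A) = c *\<^sub>R cadj A"
  by (simp add: vec_eq_iff cadj_nth)

lemma cadj_cscale: "cadj (cscale c A) = cscale (cnj c) (cadj A)"
  by (simp add: vec_eq_iff cadj_nth cscale_def)

lemma cadj_mat_1 [simp]: "cadj (mat 1) = mat 1"
  by (simp add: vec_eq_iff cadj_nth mat_def)

lemma cadj_ketbra: "cadj (ketbra a b) = ketbra b a"
  by (auto simp: vec_eq_iff cadj_nth ketbra_def)

lemma inner_eq_Re: "inner x y = Re (\<Sum>i\<in>UNIV. cnj (x $ i) * y $ i)"
  by (simp add: inner_vec_def inner_complex_def)

lemma inner_cadj: "inner x (A *v y) = inner (cadj A *v x) (y :: complex^'n)"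
proof -
  have "(\<Sum>i\<in>UNIV. cnj (x $ i) * (A *v y) $ i)
      = (\<Sum>i\<in>UNIV. \<Sum>j\<in>UNIV. cnj (x $ i) * (A $ i $ j * y $ j))"
    by (simp add: matrix_vector_mult_def sum_distrib_left)
  also have "\<dots> = (\<Sum>j\<in>UNIV. \<Sum>i\<in>UNIV. cnj (x $ i) * (A $ i $ j * y $ j))"
    by (rule sum.swap)
  also have "\<dots> = (\<Sum>j\<in>UNIV. cnj ((cadj A *v x) $ j) * y $ j)"
    by (simp add: matrix_vector_mult_def cadj_nth sum_distrib_right mult.assoc mult.left_commute)
  finally show ?thesis by (simp only: inner_eq_Re)
qed

lemma mod_M_mult_right: "mod_M (A ** mod_M B) = mod_M (A ** B)"
proof -
  have "(a * (x mod par_M) + b * (y mod par_M)) mod par_M = (a * x + b * y) mod par_M" for a b x y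
    by (intro mod_add_cong mod_mult_right_eq)
  then show ?thesis
    by (simp add: vec_eq_iff mod_M_nth matrix_matrix_mult_def sum_2)
qed

lemma sl2_mult_left_cancel: "sl2_mult x y = sl2_mult x z \<Longrightarrow> y = z"
proof transfer
  fix A X Y :: "int^2^2"
  assume A: "(\<forall>i j. 0 \<le> A $ i $ j \<and> A $ i $ j < par_M) \<and> det A mod par_M = 1"
    and X: "(\<forall>i j. 0 \<le> X $ i $ j \<and> X $ i $ j < par_M) \<and> det X mod par_M = 1"
    and Y: "(\<forall>i j. 0 \<le> Y $ i $ j \<and> Y $ i $ j < par_M) \<and> det Y mod par_M = 1"
    and eq: "mod_M (A ** X) = mod_M (A ** Y)"
  define B :: "int^2^2" where "B = vector [vector [A $ 2 $ 2, - A $ 1 $ 2], vector [- A $ 2 $ 1, A $ 1 $ 1]]"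
  have "\<forall>i. (B ** (A ** Z)) $ i $ j = det A * Z $ i $ j" for Z j
    by (simp add: forall_2 B_def matrix_matrix_mult_def sum_2 det_2 algebra_simps)
  then have BA: "(B ** (A ** Z)) $ i $ j = det A * Z $ i $ j" for Z i j by blast
  have *: "mod_M (B ** mod_M (A ** Z)) = Z"
    if Z: "\<forall>i j. 0 \<le> Z $ i $ j \<and> Z $ i $ j < par_M" for Z
  proof -
    have "det A * Z $ i $ j mod par_M = Z $ i $ j" for i j
    proof -
      have "det A * Z $ i $ j mod par_M = (det A mod par_M) * Z $ i $ j mod par_M"
        by (rule mod_mult_left_eq[symmetric])
      also have "\<dots> = Z $ i $ j" using A Z by simp
      finally show ?thesis .
    qed
    then show ?thesis
      unfolding mod_M_mult_right by (simp add: vec_eq_iff mod_M_nth BA)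
  qed
  have "X = mod_M (B ** mod_M (A ** X))" using * X by metis
  also have "\<dots> = Y" unfolding eq using * Y by blast
  finally show "X = Y" .
qed

lemma unitary_U: "unitary (U j)"
proof -
  have "cadj (U j) ** U j = mat 1"
    by (auto simp: vec_eq_iff cadj_nth matrix_matrix_mult_def U_def mat_def
        if_distrib[of cnj] if_distrib[of "\<lambda>x. x * _"] sum.delta cong: if_cong
        dest: sl2_mult_left_cancel)
  then show ?thesis
    unfolding unitary_def using matrix_left_right_inverse by blast
qed

lemma cadj_T_op: "cadj (T_op A) = T_op (cadj A)"
proof -
  let ?D = "{(i, j). i \<noteq> (j :: idx)}"
  have "cadj (T_op A) = (\<Sum>(i, j)\<in>?D. cscale (cnj (A $ i $ j)) (cadj (U j) ** U i))"
    by (simp add: T_op_def cadj_sum cadj_cscale cadj_mult split_beta)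
  also have "\<dots> = T_op (cadj A)"
    unfolding T_op_def
    by (rule sum.reindex_bij_witness[of _ prod.swap prod.swap]) (auto simp: cadj_nth)
  finally show ?thesis .
qed

lemma hermitian_A_q: "hermitian (A_q q)"
proof -
  have "cadj (E_R a b) = E_R a b" "cadj (E_I a b) = E_I a b" for a b
    by (simp_all add: E_R_def E_I_def cadj_cscale cadj_add cadj_diff cadj_ketbra add.commute)
       (simp add: vec_eq_iff cscale_def algebra_simps)
  then show ?thesis
    by (cases q) (simp add: hermitian_def A_q_def cadj_scaleR cadj_sum cadj_add split_beta)
qed

lemma matpow_add: "matpow A (m + n) = matpow A m ** matpow A n"
  by (induction m) (simp_all add: matpow_def matrix_mul_assoc)

lemma matpow_Suc_right: "matpow A (Suc n) = matpow A n ** A"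
  using matpow_add[of A n 1] by (simp add: matpow_def)

lemma hermitian_matpow:
  assumes "hermitian A"
  shows "cadj (matpow A n) = matpow A n"
proof (induction n)
  case (Suc n)
  have "cadj (matpow A (Suc n)) = cadj (matpow A n) ** cadj A"
    by (simp add: matpow_def cadj_mult)
  with Suc assms show ?case by (simp add: matpow_Suc_right hermitian_def)
qed (simp add: matpow_def)

lemma R_op_summand:
  obtains B where "cadj B = B" "matpow ((1 / par_L) *\<^sub>R T_op (A_q q)) (2 * par_m) = B ** B"
proof
  let ?T = "(1 / par_L) *\<^sub>R T_op (A_q q)"
  have "hermitian ?T"
    using hermitian_A_q[of q] by (simp add: hermitian_def cadj_scaleR cadj_T_op)
  then show "cadj (matpow ?T par_m) = matpow ?T par_m" by (rule hermitian_matpow)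
  show "matpow ?T (2 * par_m) = matpow ?T par_m ** matpow ?T par_m"
    by (simp add: mult_2 matpow_add)
qed

lemma sum_matrix_vector_mult: "sum f S *v v = (\<Sum>x\<in>S. f x *v v)"
  for f :: "'i \<Rightarrow> complex^'n^'m"
  by (induction S rule: infinite_finite_induct) (simp_all add: matrix_vector_mult_add_rdistrib)

lemma hermitian_R_op: "hermitian R_op"
  unfolding hermitian_def R_op_def cadj_sum
  by (rule sum.cong[OF refl]) (metis R_op_summand cadj_mult)

lemma R_op_nonneg: "0 \<le> inner v (R_op *v v)"
proof -
  have "0 \<le> inner v (matpow ((1 / par_L) *\<^sub>R T_op (A_q q)) (2 * par_m) *v v)" for q
  proof -
    obtain B where B: "cadj B = B"
      "matpow ((1 / par_L) *\<^sub>R T_op (A_q q)) (2 * par_m) = B ** B" by (rule R_op_summand)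
    have "inner v (B ** B *v v) = inner v (B *v (B *v v))"
      by (simp add: matrix_vector_mul_assoc)
    also have "\<dots> = inner (B *v v) (B *v v)" by (simp add: inner_cadj B(1))
    finally show ?thesis by (simp add: B(2))
  qed
  then show ?thesis
    by (simp add: R_op_def sum_matrix_vector_mult inner_sum_right sum_nonneg)
qed

lemma invertible_F: "invertible (mat 1 + R_op)"
proof -
  have "v = 0" if "(mat 1 + R_op) *v v = 0" for v
  proof -
    have "inner v v + inner v (R_op *v v) = 0"
      using that by (simp add: matrix_vector_mult_add_rdistrib flip: inner_add_right)
    with R_op_nonneg[of v] inner_ge_zero[of v] have "inner v v = 0" by linarith
    then show ?thesis by simp
  qed
  then show ?thesis
    by (simp add: invertible_left_inverse matrix_left_invertible_ker)
qed

lemma hermitian_F: "hermitian F_op"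
proof -
  let ?S = "mat 1 + R_op"
  have S: "?S ** F_op = mat 1" "F_op ** ?S = mat 1"
    using someI_ex[OF invertible_F[unfolded invertible_def]] unfolding F_op_def matrix_inv_def by blast+
  have "cadj ?S = ?S" using hermitian_R_op by (simp add: hermitian_def cadj_add)
  then have "cadj F_op ** ?S = mat 1" using arg_cong[OF S(1), of cadj] by (simp add: cadj_mult)
  then have "cadj F_op ** (?S ** F_op) = F_op" by (simp add: matrix_mul_assoc)
  then show ?thesis by (simp add: S(1) hermitian_def)
qed

lemma linear_map_sum:
  assumes "linear_map \<Phi>"
  shows "\<Phi> (sum f S) = (\<Sum>x\<in>S. \<Phi> (f x))"
proof -
  have add: "\<Phi> (X + Y) = \<Phi> X + \<Phi> Y" for X Y
    using assms by (simp add: linear_map_def)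
  have "\<Phi> 0 = 0" using add[of 0 0] by simp
  then show ?thesis
    by (induction S rule: infinite_finite_induct) (simp_all add: add)
qed

lemma matrix_unit_expansion: "(\<Sum>i\<in>UNIV. \<Sum>j\<in>UNIV. cscale (X $ i $ j) (ketbra i j)) = X"
proof -
  have "(\<Sum>i\<in>UNIV. \<Sum>j\<in>UNIV. cscale (X $ i $ j) (ketbra i j)) $ a $ b = X $ a $ b" for a b
  proof -
    have "(\<Sum>i\<in>UNIV. \<Sum>j\<in>UNIV. cscale (X $ i $ j) (ketbra i j)) $ a $ b
        = (\<Sum>i\<in>UNIV. \<Sum>j\<in>UNIV. if i = a \<and> j = b then X $ i $ j else 0)"
      unfolding sum_component by (intro sum.cong refl) (auto simp: cscale_def ketbra_def)
    also have "\<dots> = (\<Sum>i\<in>UNIV. if i = a then (\<Sum>j\<in>UNIV. if j = b then X $ i $ j else 0) else 0)"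
      by (intro sum.cong refl) simp
    also have "\<dots> = X $ a $ b" by simp
    finally show ?thesis .
  qed
  then show ?thesis by (simp add: vec_eq_iff)
qed

lemma linear_map_matrix_units:
  assumes "linear_map \<Phi>"
  shows "\<Phi> X = (\<Sum>i\<in>UNIV. \<Sum>j\<in>UNIV. cscale (X $ i $ j) (\<Phi> (ketbra i j)))"
proof -
  have "\<Phi> X = \<Phi> (\<Sum>i\<in>UNIV. \<Sum>j\<in>UNIV. cscale (X $ i $ j) (ketbra i j))"
    by (simp only: matrix_unit_expansion)
  also have "\<dots> = (\<Sum>i\<in>UNIV. \<Sum>j\<in>UNIV. \<Phi> (cscale (X $ i $ j) (ketbra i j)))"
    by (simp only: linear_map_sum[OF assms])
  finally show ?thesis using assms by (simp add: linear_map_def)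
qed

lemma sum_prod_factor:
  fixes f :: "'a::finite \<Rightarrow> 'a \<Rightarrow> complex" and g :: "'b::finite \<Rightarrow> 'b \<Rightarrow> complex"
  shows "(\<Sum>p\<in>UNIV. \<Sum>q\<in>UNIV. f (fst p) (fst q) * g (snd p) (snd q))
       = (\<Sum>i\<in>UNIV. \<Sum>j\<in>UNIV. f i j) * (\<Sum>i\<in>UNIV. \<Sum>j\<in>UNIV. g i j)"
  by (simp add: UNIV_Times_UNIV[symmetric] sum.cartesian_product' sum_product
      del: UNIV_Times_UNIV)

text \<open>\<open>tensor_map \<Phi> \<Psi>\<close> is the linear map sending \<open>X \<otimes> Y\<close> to \<open>\<Phi> X \<otimes> \<Psi> Y\<close>.\<close>

lemma tensor_map_kron:
  assumes "linear_map \<Phi>" "linear_map \<Psi>"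
  shows "tensor_map \<Phi> \<Psi> (kron X Y) = kron (\<Phi> X) (\<Psi> Y)"
proof -
  have "tensor_map \<Phi> \<Psi> (kron X Y) $ a $ b = kron (\<Phi> X) (\<Psi> Y) $ a $ b" for a b
  proof -
    have "tensor_map \<Phi> \<Psi> (kron X Y) $ a $ b = (\<Sum>p\<in>UNIV. \<Sum>q\<in>UNIV.
        (X $ fst p $ fst q * \<Phi> (ketbra (fst p) (fst q)) $ fst a $ fst b) *
        (Y $ snd p $ snd q * \<Psi> (ketbra (snd p) (snd q)) $ snd a $ snd b))"
      by (simp add: tensor_map_def kron_def cscale_def mult.assoc mult.left_commute)
    also have "\<dots> = (\<Sum>i\<in>UNIV. \<Sum>j\<in>UNIV. X $ i $ j * \<Phi> (ketbra i j) $ fst a $ fst b) *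
        (\<Sum>i\<in>UNIV. \<Sum>j\<in>UNIV. Y $ i $ j * \<Psi> (ketbra i j) $ snd a $ snd b)"
      by (rule sum_prod_factor)
    also have "\<dots> = kron (\<Phi> X) (\<Psi> Y) $ a $ b"
      unfolding linear_map_matrix_units[OF assms(1), of X] linear_map_matrix_units[OF assms(2), of Y]
      by (simp add: kron_def cscale_def)
    finally show ?thesis .
  qed
  then show ?thesis by (simp add: vec_eq_iff)
qed

end

theory Submission
  imports Defs
begin

text \<open>
  Every output \<open>\<Phi> \<rho>\<close> has constant diagonal, and its off-diagonal part paired with \<open>A\<^sub>q\<close> is
  \<open>Tr (F T F \<rho>) / k\<close> with \<open>T = T_op A\<^sub>q\<close>.  Since \<open>T / L \<le> 1 + (T / L)\<^sup>2\<^sup>m \<le> 1 + R\<close>, the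
  operator \<open>F T F\<close> is at most \<open>L\<close>.  The directions of the integer vectors \<open>q\<close> are dense enough
  to bound the Hilbert--Schmidt norm of the off-diagonal part by \<open>(129 / 127) L / k\<close>, so every
  output entropy is at least \<open>ln k - (129 / 127)\<^sup>2 L\<^sup>2 / k\<close>.

  For the tensor square, take the maximally entangled input.  Without damping the output would have
  overlap \<open>1 / k\<close> with the maximally entangled output vector, and hence entropy at most
  \<open>2 ln k + 1 / k - (ln k) / k\<close>.  The damping is harmless as soon as \<open>Tr R\<close> is a tiny fraction of
  \<open>d\<close>.  The matrices \<open>a\<^sub>j\<close> play ping-pong on the first column of an integer matrix, which
  gives norm at most \<open>3 < L\<close> for the operators \<open>T\<close> lifted to integer matrices; words of length
  \<open>4 m\<close> have entries below \<open>M\<close>, so the diagonal of \<open>T\<^sup>2\<^sup>m\<close> over \<open>SL\<^sub>2(\<int>/M\<int>)\<close> is the lifted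
  one and is at most \<open>3\<^sup>2\<^sup>m\<close>.  The factor \<open>(3 / L)\<^sup>2\<^sup>m\<close> beats the number of vectors \<open>q\<close>.
\<close>

subsection \<open>Hermitian matrices and entropy\<close>

text \<open>The obstacle is the constant vector on \<open>sl2\<close>: every \<open>U j\<close> is a
  permutation and fixes it, so with the identity in place of \<open>F_op\<close> it would be sent to
  a pure output of entropy 0. On it \<open>T_op\<close> can have an eigenvalue as large as the
  square root of \<open>par_r\<close>, so no operator norm bound near 3 holds on the finite group.
  Only normalised moments are controlled; they say that bad directions are rare, and
  \<open>F_op\<close> suppresses these for all \<open>q\<close> at once. The exponent
  \<open>2 * par_m\<close> is even to make every summand of \<open>R_op\<close> positive and large
  to outweigh the number of summands. The matrix \<open>a_mat j\<close> is the unipotent matrix with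
  rows (1, 0) and (2, 1) conjugated by the shear x + 2 j z. Distinct shears are at least 2 apart,
  which keeps the ping-pong sets disjoint. The budget: k times the entropy gap is at least (1 -
  loss) ln k - 1 - 2 (129/127)^2 L^2. So L has to stay close to 3, and ln k has to exceed about
  21.2.\<close>

lemma inner_matrix_hermitian:
  assumes "hermitian A"
  shows "inner x (A *v y) = inner (A *v x) (y :: complex^'n)"
  using assms inner_cadj[of x A y] by (simp add: hermitian_def)

definition cinner :: "complex^'n \<Rightarrow> complex^'n \<Rightarrow> complex" where
  "cinner x y = (\<Sum>i\<in>UNIV. cnj (x $ i) * y $ i)"

lemma inner_Re_cinner: "inner x y = Re (cinner x y)"
  by (simp add: inner_eq_Re cinner_def)

lemma cinner_add_right: "cinner x (y + z) = cinner x y + cinner x z"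
  by (simp add: cinner_def algebra_simps sum.distrib)

lemma cinner_scaleR_right: "cinner x (r *\<^sub>R y) = r *\<^sub>R cinner x y"
  by (simp add: cinner_def scaleR_right.sum)

lemma cinner_smult_right: "cinner x (c *s y) = c * cinner x y"
  by (simp add: cinner_def sum_distrib_left algebra_simps)

lemma cinner_smult_left: "cinner (c *s x) y = cnj c * cinner x y"
  by (simp add: cinner_def sum_distrib_left algebra_simps)

lemma cinner_commute: "cinner y x = cnj (cinner x y)"
  by (simp add: cinner_def cnj_sum mult.commute)

lemma cinner_self: "cinner x x = complex_of_real ((norm x)\<^sup>2)"
proof -
  have "Im (cinner x x) = 0"
    using cinner_commute[of x x] by (simp add: complex_eq_iff)
  then show ?thesis
    by (simp add: complex_eq_iff flip: inner_Re_cinner) (simp add: power2_norm_eq_inner)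
qed

lemma cinner_adj: "cinner x (A *v y) = cinner (cadj A *v x) y"
proof -
  have "(\<Sum>i\<in>UNIV. cnj (x $ i) * (A *v y) $ i)
      = (\<Sum>i\<in>UNIV. \<Sum>j\<in>UNIV. cnj (x $ i) * (A $ i $ j * y $ j))"
    by (simp add: matrix_vector_mult_def sum_distrib_left)
  also have "\<dots> = (\<Sum>j\<in>UNIV. \<Sum>i\<in>UNIV. cnj (x $ i) * (A $ i $ j * y $ j))"
    by (rule sum.swap)
  also have "\<dots> = (\<Sum>j\<in>UNIV. cnj ((cadj A *v x) $ j) * y $ j)"
    by (simp add: matrix_vector_mult_def cadj_nth sum_distrib_right mult.assoc mult.left_commute)
  finally show ?thesis by (simp only: cinner_def)
qed

lemma inner_i_smult: "inner (\<i> *s x) y = Im (cinner x y)"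
  by (simp add: inner_Re_cinner cinner_smult_left)

lemma matrix_vector_mult_scaleR_complex: "A *v (r *\<^sub>R x) = r *\<^sub>R (A *v x)"
  for A :: "complex^'n^'m"
  by (simp add: vec_eq_iff matrix_vector_mult_def scaleR_right.sum)

text \<open>Maximise the quadratic form on the unit sphere of the orthogonal complement.\<close>

lemma hermitian_eigenvector_orthogonal:
  fixes A :: "complex^'n^'n" and v :: "'n \<Rightarrow> complex^'n"
  assumes A: "hermitian A"
    and eig: "\<And>i. i \<in> S \<Longrightarrow> A *v v i = complex_of_real (l i) *s v i"
    and S: "S \<noteq> UNIV"
  obtains x c where "norm x = 1" "\<And>i. i \<in> S \<Longrightarrow> cinner (v i) x = 0"
    "A *v x = complex_of_real c *s x"
proof -
  define W where "W = {x. \<forall>i\<in>S. cinner (v i) x = 0}"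
  \<comment> \<open>Each complex condition is two real ones, against \<open>v i\<close> and against
    \<open>\<i> *s v i\<close>. Hence \<open>W\<close> is closed, and since twice
    \<open>card S\<close> is below the real dimension, it contains a nonzero vector.\<close>
  have W_eq: "W = (\<Inter>i\<in>S. {x. inner (v i) x = 0} \<inter> {x. inner (\<i> *s v i) x = 0})"
    by (auto simp: W_def inner_i_smult inner_Re_cinner[of "v _"] complex_eq_iff)
  have W_closed: "closed W"
    unfolding W_eq by (intro closed_INT ballI closed_Int closed_hyperplane)
  have W_comb: "x + r *\<^sub>R y \<in> W" if "x \<in> W" "y \<in> W" for x y r
    using that by (simp add: W_def cinner_add_right cinner_scaleR_right)
  have W_inv: "A *v x \<in> W" if "x \<in> W" for x
    using that A by (simp add: W_def cinner_adj hermitian_def eig cinner_smult_left)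
  have "card S < CARD('n)"
    using S by (meson finite psubset_card_mono psubsetI subset_UNIV)
  moreover have "dim (v ` S \<union> (\<lambda>i. \<i> *s v i) ` S) \<le> card S + card S"
    by (meson add_mono card_Un_le card_image_le dim_le_card' finite finite_UnI finite_imageI order_trans)
  ultimately have "dim (v ` S \<union> (\<lambda>i. \<i> *s v i) ` S) < DIM(complex^'n)"
    by simp
  then obtain x0 where x0: "x0 \<noteq> 0"
    "\<And>y. y \<in> span (v ` S \<union> (\<lambda>i. \<i> *s v i) ` S) \<Longrightarrow> orthogonal x0 y"
    using orthogonal_to_subspace_exists by blast
  have "x0 \<in> W"
    using x0(2)[OF span_base] by (auto simp: W_eq orthogonal_def inner_commute[of x0])
  then have "x0 /\<^sub>R norm x0 \<in> W \<inter> sphere 0 1"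
    using x0(1) by (auto simp: W_def cinner_scaleR_right)
  then have ne: "W \<inter> sphere 0 1 \<noteq> {}" by blast
  have cont: "continuous_on (W \<inter> sphere 0 1) (\<lambda>x. inner x (A *v x))"
    by (intro continuous_intros matrix_vector_mult_linear_continuous_on)
  obtain x where x: "x \<in> W" "norm x = 1"
    and max: "\<And>y. y \<in> W \<Longrightarrow> norm y = 1 \<Longrightarrow> inner y (A *v y) \<le> inner x (A *v x)"
    using continuous_attains_sup[OF closed_Int_compact[OF W_closed compact_sphere] ne cont]
    by auto
  define c where "c = inner x (A *v x)"
  have quad: "inner y (A *v y) \<le> c * inner y y" if "y \<in> W" for y
  proof (cases "y = 0")
    case False
    have "inner (y /\<^sub>R norm y) (A *v (y /\<^sub>R norm y)) \<le> c"
      unfolding c_def using that False by (intro max) (auto simp: W_def cinner_scaleR_right)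
    then have "inner y (A *v y) / (norm y)\<^sup>2 \<le> c"
      by (simp add: matrix_vector_mult_scaleR_complex power2_eq_square divide_simps)
    then show ?thesis
      using False by (simp add: divide_simps power2_norm_eq_inner mult.commute)
  qed simp
  define z where "z = A *v x - c *\<^sub>R x"
  have zW: "z \<in> W"
    using W_comb[OF W_inv[OF x(1)] x(1), of "- c"] by (simp add: z_def)
  define b where "b = c * inner z z - inner z (A *v z)"
  \<comment> \<open>First-order optimality of \<open>x\<close> along the residual \<open>z\<close>,
    which lies in \<open>W\<close>: the part linear in \<open>t\<close> cannot exceed the quadratic
    part for any real \<open>t\<close>, and this forces \<open>z = 0\<close>.\<close>
  have *: "2 * t * inner z z \<le> t\<^sup>2 * b" for t :: real
  proof -
    have "inner (x + t *\<^sub>R z) (A *v (x + t *\<^sub>R z)) \<le> c * inner (x + t *\<^sub>R z) (x + t *\<^sub>R z)"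
      by (rule quad[OF W_comb[OF x(1) zW]])
    moreover have "inner x (A *v z) = inner z (A *v x)"
      using inner_matrix_hermitian[OF A, of x z] by (simp add: inner_commute)
    moreover have "inner z (A *v x) = inner z z + c * inner z x"
      by (simp add: z_def inner_diff_left inner_diff_right)
    moreover have "inner x x = 1" using x(2) by (simp add: norm_eq_1)
    ultimately show ?thesis
      by (simp add: matrix_vector_right_distrib matrix_vector_mult_scaleR_complex inner_add_left
          inner_add_right b_def c_def[symmetric] inner_commute algebra_simps power2_eq_square)
  qed
  have "inner z z \<le> 0"
  proof (rule ccontr)
    assume "\<not> ?thesis"
    then have pos: "inner z z > 0" by linarith
    show False
    proof (cases "b \<le> 0")
      case True
      have "2 * inner z z \<le> b" using *[of 1] by simp
      with pos True show False by linarith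
    next
      case False
      have "2 * (inner z z / b) * inner z z \<le> (inner z z / b)\<^sup>2 * b" by (rule *)
      moreover have "(inner z z / b)\<^sup>2 * b = inner z z / b * inner z z"
        using False by (simp add: power2_eq_square)
      moreover have "0 < inner z z / b * inner z z"
        using False pos by (intro mult_pos_pos divide_pos_pos) linarith+
      ultimately show False by linarith
    qed
  qed
  then have "z = 0" by (metis inner_gt_zero_iff not_less)
  then have "A *v x = complex_of_real c *s x"
    by (simp add: z_def vec_eq_iff scaleR_conv_of_real[where 'a = complex])
  then show thesis using that x by (auto simp: W_def)
qed

lemma hermitian_diagonalization:
  fixes A :: "complex^'n^'n"
  assumes A: "hermitian A"
  obtains V l where "unitary V" "A = V ** diag_mat (\<lambda>i. complex_of_real (l i)) ** cadj V"
proof -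
  \<comment> \<open>The eigenvectors are indexed by a growing set of matrix indices, so that at
    \<open>UNIV\<close> they become the columns of a square matrix \<open>V\<close>.\<close>
  have "\<exists>(v :: 'n \<Rightarrow> complex^'n) l. \<forall>i\<in>S. A *v v i = complex_of_real (l i) *s v i \<and>
      (\<forall>j\<in>S. cinner (v i) (v j) = (if i = j then 1 else 0))" for S :: "'n set"
  proof (induction S rule: finite_induct[OF finite])
    case (2 s S)
    then obtain v :: "'n \<Rightarrow> complex^'n" and l where
      "\<forall>i\<in>S. A *v v i = complex_of_real (l i) *s v i \<and>
        (\<forall>j\<in>S. cinner (v i) (v j) = (if i = j then 1 else 0))"
      by blast
    then have vl: "\<And>i. i \<in> S \<Longrightarrow> A *v v i = complex_of_real (l i) *s v i"
        "\<And>i j. i \<in> S \<Longrightarrow> j \<in> S \<Longrightarrow> cinner (v i) (v j) = (if i = j then 1 else 0)"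
      by auto
    have "S \<noteq> UNIV" using 2 by auto
    then obtain x c where x: "norm x = 1" "\<And>i. i \<in> S \<Longrightarrow> cinner (v i) x = 0"
        "A *v x = complex_of_real c *s x"
      using hermitian_eigenvector_orthogonal[OF A, of S v l] vl(1) by blast
    have x': "cinner x (v i) = 0" if "i \<in> S" for i
      using x(2)[OF that] cinner_commute[of x "v i"] by simp
    have xx: "cinner x x = 1" by (simp add: cinner_self x(1))
    have ns: "i \<noteq> s" if "i \<in> S" for i using that 2 by auto
    show ?case
      by (intro exI[of _ "v(s := x)"] exI[of _ "l(s := c)"])
        (use vl x x' xx ns in \<open>auto simp: 2(2)\<close>)
  qed auto
  from this[of UNIV] obtain v :: "'n \<Rightarrow> complex^'n" and l where
    "\<forall>i. A *v v i = complex_of_real (l i) *s v i \<and>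
      (\<forall>j. cinner (v i) (v j) = (if i = j then 1 else 0))"
    by auto
  then have v: "\<And>i. A *v v i = complex_of_real (l i) *s v i"
      "\<And>i j. cinner (v i) (v j) = (if i = j then 1 else 0)"
    by auto
  define V :: "complex^'n^'n" where "V = (\<chi> a i. v i $ a)"
  define D where "D = diag_mat (\<lambda>i. complex_of_real (l i) :: complex)"
  have "cadj V ** V = mat 1"
    using v(2) by (simp add: vec_eq_iff matrix_matrix_mult_def cadj_nth V_def mat_def cinner_def)
  then have V: "unitary V"
    unfolding unitary_def using matrix_left_right_inverse by blast
  have "(A ** V) $ a $ i = (V ** D) $ a $ i" for a i
  proof -
    have "(A ** V) $ a $ i = (A *v v i) $ a"
      by (simp add: V_def matrix_matrix_mult_def matrix_vector_mult_def)
    also have "\<dots> = (V ** D) $ a $ i"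
      by (simp add: v V_def matrix_matrix_mult_def D_def diag_mat_def if_distrib cong: if_cong)
    finally show ?thesis .
  qed
  then have "A ** V = V ** D" by (simp add: vec_eq_iff)
  then have "A ** (V ** cadj V) = V ** D ** cadj V" by (simp add: matrix_mul_assoc)
  then have "A = V ** D ** cadj V" using V by (simp add: unitary_def)
  then show thesis using that V D_def by blast
qed

section \<open>Positive semidefinite matrices and their factorisations\<close>

lemma matrix_vector_mult_axis_nth: "(A *v axis j 1) $ i = A $ i $ j" for A :: "complex^'n^'m"
proof -
  have "(A *v axis j 1) $ i = (\<Sum>k\<in>UNIV. if k = j then A $ i $ k else 0)"
    by (simp add: matrix_vector_mult_def axis_def if_distrib cong: if_cong)
  then show ?thesis by simp
qed

lemma cinner_axis: "cinner (axis i 1) x = x $ i"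
proof -
  have "cinner (axis i 1) x = (\<Sum>j\<in>UNIV. if j = i then x $ j else 0)"
    unfolding cinner_def by (intro sum.cong) (auto simp: axis_def)
  then show ?thesis by simp
qed

lemma psd_cinner: "psd A \<longleftrightarrow> (\<forall>v. cinner v (A *v v) \<in> \<real>\<^sub>\<ge>\<^sub>0)" for A :: "complex^'n^'n"
proof -
  have "(\<Sum>i\<in>UNIV. \<Sum>j\<in>UNIV. cnj (v i) * A $ i $ j * v j) = cinner (vec_lambda v) (A *v vec_lambda v)"
    for v :: "'n \<Rightarrow> complex"
    by (simp add: cinner_def matrix_vector_mult_def sum_distrib_left mult.assoc)
  moreover have "v = vec_lambda (\<lambda>i. v $ i)" for v :: "complex^'n" by simp
  ultimately show ?thesis unfolding psd_def psd_on_def by metis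
qed

text \<open>Polarisation: reality of the form at \<open>x + y\<close> gives the imaginary parts,
  reality at \<open>x + \<i> *s y\<close> the real parts.\<close>

lemma psd_hermitian:
  assumes "psd A"
  shows "hermitian A"
proof -
  have q: "Im (cinner v (A *v v)) = 0" for v
    using assms by (auto simp: psd_cinner complex_nonneg_Reals_iff)
  have "cinner y (A *v x) = cnj (cinner x (A *v y))" for x y
  proof (rule complex_eqI)
    have add: "cinner (u + w) z = cinner u z + cinner w z" for u w z :: "complex^'a"
      by (simp add: cinner_def algebra_simps sum.distrib)
    have "Im (cinner x (A *v y)) + Im (cinner y (A *v x)) = 0"
      using q[of "x + y"] q[of x] q[of y]
      by (simp add: matrix_vector_right_distrib cinner_add_right add)
    then show "Im (cinner y (A *v x)) = Im (cnj (cinner x (A *v y)))" by simp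
    have "Re (cinner x (A *v y)) - Re (cinner y (A *v x)) = 0"
      using q[of "x + \<i> *s y"] q[of x] q[of "\<i> *s y"]
      by (simp add: matrix_vector_right_distrib cinner_add_right add vector_scalar_commute
          cinner_smult_left cinner_smult_right)
    then show "Re (cinner y (A *v x)) = Re (cnj (cinner x (A *v y)))" by simp
  qed
  then have "cinner (axis j 1) (A *v axis i 1) = cnj (cinner (axis i 1) (A *v axis j 1))" for i j
    by blast
  then have "A $ j $ i = cnj (A $ i $ j)" for i j
    unfolding cinner_axis matrix_vector_mult_axis_nth .
  then show ?thesis
    unfolding hermitian_def vec_eq_iff cadj_nth by metis
qed

lemma hermitian_cinner_real:
  assumes "hermitian A"
  shows "cinner v (A *v v) = complex_of_real (inner v (A *v v))"
proof -
  have "cinner v (A *v v) = cnj (cinner v (A *v v))"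
    using cinner_adj[of v A v] cinner_commute[of v "A *v v"] assms by (simp add: hermitian_def)
  then have "Im (cinner v (A *v v)) = 0" by (simp add: complex_eq_iff)
  then show ?thesis by (simp add: complex_eq_iff inner_Re_cinner)
qed

lemma psd_iff_inner:
  "psd A \<longleftrightarrow> hermitian A \<and> (\<forall>v. 0 \<le> inner v (A *v v))"
proof
  assume "psd A"
  then show "hermitian A \<and> (\<forall>v. 0 \<le> inner v (A *v v))"
    using psd_hermitian by (auto simp: psd_cinner inner_Re_cinner complex_nonneg_Reals_iff)
qed (auto simp: psd_cinner hermitian_cinner_real)

lemma diag_mat_mult: "diag_mat a ** diag_mat b = diag_mat (\<lambda>i. a i * b i)"
  by (simp add: vec_eq_iff diag_mat_def matrix_matrix_mult_def if_distrib[of "\<lambda>x. x * _"]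
      sum.delta cong: if_cong)

lemma trace_diag_mat: "trace (diag_mat a) = sum a UNIV"
  by (simp add: trace_def diag_mat_def)

lemma diag_mat_mult_vec: "(diag_mat a *v x) $ i = a i * x $ i"
  by (simp add: diag_mat_def matrix_vector_mult_def if_distrib[of "\<lambda>x. x * _"] sum.delta
      cong: if_cong)

lemma cadj_diag_mat: "cadj (diag_mat a) = diag_mat (\<lambda>i. cnj (a i))"
  by (simp add: vec_eq_iff cadj_nth diag_mat_def)

lemma trace_unitary_conj:
  assumes "unitary V"
  shows "trace (V ** D ** cadj V) = trace D"
proof -
  have "trace (V ** D ** cadj V) = trace (cadj V ** (V ** D))" by (rule trace_mul_sym)
  also have "\<dots> = trace D" using assms by (simp add: matrix_mul_assoc unitary_def)
  finally show ?thesis .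
qed

lemma unitary_conj_mult:
  assumes "unitary V"
  shows "(V ** D ** cadj V) ** (V ** D' ** cadj V) = V ** (D ** D') ** cadj V"
proof -
  have "(V ** D ** cadj V) ** (V ** D' ** cadj V) = V ** D ** (cadj V ** V) ** D' ** cadj V"
    by (simp only: matrix_mul_assoc)
  also have "\<dots> = V ** D ** D' ** cadj V" using assms by (simp add: unitary_def)
  finally show ?thesis by (simp only: matrix_mul_assoc)
qed

lemma inner_unitary_diag:
  "inner x ((V ** diag_mat (\<lambda>i. complex_of_real (l i)) ** cadj V) *v x)
     = (\<Sum>i\<in>UNIV. l i * (norm ((cadj V *v x) $ i))\<^sup>2)"
proof -
  have "inner x ((V ** diag_mat (\<lambda>i. complex_of_real (l i)) ** cadj V) *v x)
      = inner (cadj V *v x) (diag_mat (\<lambda>i. complex_of_real (l i)) *v (cadj V *v x))"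
    by (simp add: inner_cadj flip: matrix_vector_mul_assoc)
  also have "\<dots> = (\<Sum>i\<in>UNIV. l i * (norm ((cadj V *v x) $ i))\<^sup>2)"
    unfolding inner_vec_def
    by (intro sum.cong refl)
       (simp add: diag_mat_mult_vec inner_complex_def cmod_power2 algebra_simps flip: power2_eq_square)
  finally show ?thesis .
qed

lemma unitary_norm:
  assumes "unitary V"
  shows "norm (V *v x) = norm (x :: complex^'n)" "norm (cadj V *v x) = norm x"
proof -
  have "inner (V *v x) (V *v x) = inner x x"
    using inner_cadj[of "V *v x" V x] assms by (simp add: matrix_vector_mul_assoc unitary_def)
  then show "norm (V *v x) = norm x" by (simp add: norm_eq)
  have "inner (cadj V *v x) (cadj V *v x) = inner x x"
    using inner_cadj[of "cadj V *v x" "cadj V" x] assms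
    by (simp add: matrix_vector_mul_assoc unitary_def)
  then show "norm (cadj V *v x) = norm x" by (simp add: norm_eq)
qed

lemma psd_diag_nonneg:
  assumes "psd A" "unitary V" "A = V ** diag_mat (\<lambda>i. complex_of_real (l i)) ** cadj V"
  shows "0 \<le> l i"
proof -
  have "0 \<le> inner (V *v axis i 1) (A *v (V *v axis i 1))"
    using assms(1) by (simp add: psd_iff_inner)
  also have "\<dots> = (\<Sum>j\<in>UNIV. l j * (norm ((axis i 1 :: complex^'a) $ j))\<^sup>2)"
    unfolding assms(3) inner_unitary_diag
    using assms(2) by (simp add: matrix_vector_mul_assoc unitary_def)
  also have "\<dots> = (\<Sum>j\<in>UNIV. if j = i then l j else 0)"
    by (intro sum.cong) (auto simp: axis_def)
  finally show ?thesis by simp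
qed

lemma psd_factor:
  assumes "psd A"
  obtains C :: "complex^'n^'n" where "A = C ** cadj C"
proof -
  obtain V l where V: "unitary V" "A = V ** diag_mat (\<lambda>i. complex_of_real (l i)) ** cadj V"
    by (rule hermitian_diagonalization[OF psd_hermitian[OF assms]])
  have l: "0 \<le> l i" for i by (rule psd_diag_nonneg[OF assms V])
  define D where "D = diag_mat (\<lambda>i. complex_of_real (sqrt (l i)) :: complex)"
  have "D ** cadj D = diag_mat (\<lambda>i. complex_of_real (l i))"
    using l by (simp add: D_def cadj_diag_mat diag_mat_mult flip: of_real_mult)
  then have "A = V ** (D ** cadj D) ** cadj V" using V(2) by simp
  also have "\<dots> = (V ** D) ** cadj (V ** D)" by (simp only: cadj_mult matrix_mul_assoc)
  finally have "A = (V ** D) ** cadj (V ** D)" .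
  then show thesis by (rule that)
qed

text \<open>\<open>V\<close> and \<open>l\<close> are the witnesses behind the choice in
  \<open>mat_log\<close>, so \<open>A\<close> and \<open>mat_log A\<close> are diagonal in the same
  basis and their product has eigenvalues \<open>l i * ln (l i)\<close>.\<close>

lemma entropy_diagonalization:
  assumes "hermitian A"
  obtains V l where "unitary V" "A = V ** diag_mat (\<lambda>i. complex_of_real (l i)) ** cadj V"
    "entropy A = - (\<Sum>i\<in>UNIV. l i * ln (l i))"
proof -
  let ?P = "\<lambda>B V (l :: 'a \<Rightarrow> real). unitary V \<and>
      A = V ** diag_mat (\<lambda>i. complex_of_real (l i)) ** cadj V \<and>
      B = V ** diag_mat (\<lambda>i. complex_of_real (ln (l i))) ** cadj V"
  obtain V0 l0 where "unitary V0" "A = V0 ** diag_mat (\<lambda>i. complex_of_real (l0 i)) ** cadj V0"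
    by (rule hermitian_diagonalization[OF assms])
  then have "\<exists>B V l. ?P B V l" by blast
  then have "\<exists>V l. ?P (mat_log A) V l" unfolding mat_log_def by (rule someI_ex)
  then obtain V l where V: "unitary V" "A = V ** diag_mat (\<lambda>i. complex_of_real (l i)) ** cadj V"
    "mat_log A = V ** diag_mat (\<lambda>i. complex_of_real (ln (l i))) ** cadj V" by blast
  have "A ** mat_log A = V ** diag_mat (\<lambda>i. complex_of_real (l i * ln (l i))) ** cadj V"
    unfolding V(3) by (subst V(2)) (simp only: unitary_conj_mult[OF V(1)] diag_mat_mult of_real_mult)
  then have "trace (A ** mat_log A) = complex_of_real (\<Sum>i\<in>UNIV. l i * ln (l i))"
    by (simp only: trace_unitary_conj[OF V(1)] trace_diag_mat of_real_sum)
  then have "entropy A = - (\<Sum>i\<in>UNIV. l i * ln (l i))" by (simp add: entropy_def)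
  then show thesis using that V(1,2) by blast
qed

lemma entropy_density:
  assumes "density \<rho>"
  obtains V l where "unitary V" "\<rho> = V ** diag_mat (\<lambda>i. complex_of_real (l i)) ** cadj V"
    "entropy \<rho> = - (\<Sum>i\<in>UNIV. l i * ln (l i))" "\<forall>i. 0 \<le> l i" "sum l UNIV = 1"
proof -
  have psd: "psd \<rho>" and tr: "trace \<rho> = 1" using assms by (auto simp: density_def)
  obtain V l where V: "unitary V" "\<rho> = V ** diag_mat (\<lambda>i. complex_of_real (l i)) ** cadj V"
    "entropy \<rho> = - (\<Sum>i\<in>UNIV. l i * ln (l i))"
    by (rule entropy_diagonalization[OF psd_hermitian[OF psd]])
  have "complex_of_real (sum l UNIV) = 1"
    using tr unfolding V(2) trace_unitary_conj[OF V(1)] trace_diag_mat by simp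
  then have "sum l UNIV = 1" by (simp only: of_real_eq_1_iff)
  from that[OF V allI[OF psd_diag_nonneg[OF psd V(1,2)]] this] show thesis .
qed

section \<open>Entropy bounds from eigenvalues\<close>

lemma entropy_nonneg:
  assumes "density \<rho>"
  shows "0 \<le> entropy \<rho>"
proof -
  obtain V l where "unitary V" "\<rho> = V ** diag_mat (\<lambda>i. complex_of_real (l i)) ** cadj V"
    and l: "entropy \<rho> = - (\<Sum>i\<in>UNIV. l i * ln (l i))" "\<forall>i. 0 \<le> l i" "sum l UNIV = 1"
    by (rule entropy_density[OF assms])
  have "l i * ln (l i) \<le> 0" for i
  proof -
    have "l i \<le> 1" using member_le_sum[of i UNIV l] l by simp
    then show ?thesis using l(2)[rule_format, of i] by (cases "l i = 0") (auto simp: mult_le_0_iff)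
  qed
  then show ?thesis by (simp add: l(1) sum_nonpos)
qed

lemma norm_matrix_power2: "(norm A)\<^sup>2 = (\<Sum>i\<in>UNIV. \<Sum>j\<in>UNIV. (norm (A $ i $ j))\<^sup>2)"
  for A :: "complex^'n^'m"
  by (simp add: norm_vec_def L2_set_def sum_nonneg)

lemma trace_cadj_mult: "trace (A ** cadj A) = complex_of_real ((norm A)\<^sup>2)"
  for A :: "complex^'n^'m"
  by (simp add: norm_matrix_power2 trace_def matrix_matrix_mult_def cadj_nth complex_norm_square flip: of_real_power)

text \<open>Apply \<open>ln x \<le> x - 1\<close> to x = n l for each eigenvalue l, where n is the
  dimension. The bound is tight at the maximally mixed state, which the outputs of
  \<open>Phi\<close> almost are.\<close>

lemma entropy_ge_purity:
  fixes \<rho> :: "complex^'n^'n"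
  assumes "density \<rho>"
  shows "ln (real CARD('n)) + 1 - real CARD('n) * (norm \<rho>)\<^sup>2 \<le> entropy \<rho>"
proof -
  let ?k = "real CARD('n)"
  have psd: "psd \<rho>" using assms by (simp add: density_def)
  obtain V l where l: "unitary V" "\<rho> = V ** diag_mat (\<lambda>i. complex_of_real (l i)) ** cadj V"
    "entropy \<rho> = - (\<Sum>i\<in>UNIV. l i * ln (l i))" "\<forall>i. 0 \<le> l i" "sum l UNIV = 1"
    by (rule entropy_density[OF assms])
  have "complex_of_real ((norm \<rho>)\<^sup>2) = trace (\<rho> ** \<rho>)"
    using trace_cadj_mult[of \<rho>] psd_hermitian[OF psd] by (simp add: hermitian_def)
  also have "\<dots> = complex_of_real (\<Sum>i\<in>UNIV. l i * l i)"
    unfolding l(2) by (simp add: unitary_conj_mult l(1) trace_unitary_conj diag_mat_mult trace_diag_mat)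
  finally have n: "(norm \<rho>)\<^sup>2 = (\<Sum>i\<in>UNIV. l i * l i)" by (simp only: of_real_eq_iff)
  have k: "?k > 0" by simp
  have "l i * ln (l i) \<le> l i * (?k * l i - 1 - ln ?k)" for i
  proof (cases "l i = 0")
    case False
    then have "ln (?k * l i) \<le> ?k * l i - 1" using l(4)[rule_format, of i] k by (intro ln_le_minus_one) simp
    moreover have "ln (?k * l i) = ln ?k + ln (l i)"
      using False l(4)[rule_format, of i] k by (intro ln_mult_pos) auto
    ultimately show ?thesis using l(4)[rule_format, of i] by (intro mult_left_mono) auto
  qed simp
  then have "(\<Sum>i\<in>UNIV. l i * ln (l i)) \<le> (\<Sum>i\<in>UNIV. l i * (?k * l i - 1 - ln ?k))"
    by (intro sum_mono)
  also have "\<dots> = ?k * (\<Sum>i\<in>UNIV. l i * l i) - (1 + ln ?k) * sum l UNIV"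
    by (simp add: algebra_simps sum.distrib sum_subtractf sum_distrib_left sum_distrib_right)
  finally show ?thesis using n l(3,5) by simp
qed

lemma ln_weighted_le:
  fixes a b p :: real
  assumes "0 < a" "0 < b" "0 \<le> p" "p \<le> 1"
  shows "p * ln a + (1 - p) * ln b \<le> ln (p * a + (1 - p) * b)"
proof -
  define s where "s = p * a + (1 - p) * b"
  have s: "s > 0"
    using assms unfolding s_def by (cases "p = 0") (auto intro: add_pos_nonneg)
  have *: "ln x \<le> ln s + x / s - 1" if "0 < x" for x
    using ln_le_minus_one[of "x / s"] that s by (simp add: ln_div)
  have "p * ln a + (1 - p) * ln b \<le> p * (ln s + a / s - 1) + (1 - p) * (ln s + b / s - 1)"
    using assms * by (intro add_mono mult_left_mono) auto
  also have "\<dots> = ln s + (p * a + (1 - p) * b) / s - 1"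
    by (simp add: algebra_simps add_divide_distrib diff_divide_distrib)
  finally show ?thesis using s by (simp flip: s_def)
qed

text \<open>Gibbs' inequality against the state with eigenvalue \<open>a\<close> on \<open>\<psi>\<close> and \<open>b\<close> elsewhere.\<close>

lemma entropy_le_fidelity:
  fixes \<rho> :: "complex^'n^'n"
  assumes "density \<rho>" "norm \<psi> = 1" "0 < a" "0 < b"
    and ab: "a + (real CARD('n) - 1) * b = 1"
  defines "p \<equiv> inner \<psi> (\<rho> *v \<psi>)"
  shows "entropy \<rho> \<le> - p * ln a - (1 - p) * ln b"
proof -
  obtain V l where l: "unitary V" "\<rho> = V ** diag_mat (\<lambda>i. complex_of_real (l i)) ** cadj V"
    "entropy \<rho> = - (\<Sum>i\<in>UNIV. l i * ln (l i))" "\<forall>i. 0 \<le> l i" "sum l UNIV = 1"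
    by (rule entropy_density[OF assms(1)])
  define q where "q i = (norm ((cadj V *v \<psi>) $ i))\<^sup>2" for i
  have p: "p = (\<Sum>i\<in>UNIV. l i * q i)"
    unfolding p_def l(2) inner_unitary_diag q_def ..
  have "sum q UNIV = (norm (cadj V *v \<psi>))\<^sup>2"
    by (simp add: q_def norm_vec_def L2_set_def sum_nonneg)
  then have q1: "sum q UNIV = 1" using unitary_norm(2)[OF l(1)] assms(2) by simp
  have q0: "0 \<le> q i" for i by (simp add: q_def)
  have qle: "q i \<le> 1" for i using member_le_sum[of i UNIV q] q0 q1 by simp
  \<comment> \<open>\<open>q i\<close> is the weight of \<open>\<psi>\<close> on the i-th
    eigenvector. The added correction sums to 0 over \<open>i\<close>, because both \<open>l\<close>
    and the mixtures \<open>q i * a + (1 - q i) * b\<close> have total 1.\<close>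
  have "- (l i * ln (l i)) \<le> - l i * (q i * ln a + (1 - q i) * ln b) + (q i * a + (1 - q i) * b - l i)" for i
  proof (cases "l i = 0")
    case True
    then show ?thesis using q0 qle assms by simp
  next
    case False
    then have li: "0 < l i" using l(4)[rule_format, of i] by simp
    define s where "s = q i * a + (1 - q i) * b"
    have s: "s > 0"
      using assms q0[of i] qle[of i] unfolding s_def by (cases "q i = 0") (auto intro: add_pos_nonneg)
    have "q i * ln a + (1 - q i) * ln b - ln (l i) \<le> ln s - ln (l i)"
      using ln_weighted_le[of a b "q i"] assms q0 qle by (simp add: s_def)
    also have "\<dots> = ln (s / l i)" using s li by (simp add: ln_div)
    also have "\<dots> \<le> s / l i - 1" using s li by (intro ln_le_minus_one) simp
    finally have "l i * (q i * ln a + (1 - q i) * ln b - ln (l i)) \<le> l i * (s / l i - 1)"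
      using li by (intro mult_left_mono) auto
    also have "\<dots> = s - l i" using li by (simp add: field_simps)
    finally show ?thesis by (simp add: s_def algebra_simps)
  qed
  then have "entropy \<rho> \<le> (\<Sum>i\<in>UNIV. - l i * (q i * ln a + (1 - q i) * ln b) + (q i * a + (1 - q i) * b - l i))"
    unfolding l(3) sum_negf[symmetric] by (intro sum_mono)
  also have "\<dots> = - (\<Sum>i\<in>UNIV. l i * q i) * ln a - (sum l UNIV - (\<Sum>i\<in>UNIV. l i * q i)) * ln b
      + (sum q UNIV * a + (real CARD('n) - sum q UNIV) * b - sum l UNIV)"
  proof -
    have "- l i * (q i * ln a + (1 - q i) * ln b) + (q i * a + (1 - q i) * b - l i)
        = (ln b - ln a) * (l i * q i) - (ln b + 1) * l i + (a - b) * q i + b" for i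
      by (simp add: algebra_simps)
    then have "(\<Sum>i\<in>UNIV. - l i * (q i * ln a + (1 - q i) * ln b) + (q i * a + (1 - q i) * b - l i))
        = (ln b - ln a) * (\<Sum>i\<in>UNIV. l i * q i) - (ln b + 1) * sum l UNIV + (a - b) * sum q UNIV
          + real CARD('n) * b"
      by (simp add: sum.distrib sum_subtractf flip: sum_distrib_left)
    then show ?thesis by (simp add: algebra_simps)
  qed
  also have "\<dots> = - p * ln a - (1 - p) * ln b"
  proof -
    have "1 * a + (real CARD('n) - 1) * b - 1 = 0" using ab by linarith
    then show ?thesis unfolding l(5) q1 p[symmetric] by linarith
  qed
  finally show ?thesis .
qed

subsection \<open>A norm bound from ping-pong\<close>

lemma sum_mult_le_sqrt:
  fixes f g :: "'a \<Rightarrow> real"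
  shows "(\<Sum>x\<in>S. f x * g x) \<le> sqrt (\<Sum>x\<in>S. (f x)\<^sup>2) * sqrt (\<Sum>x\<in>S. (g x)\<^sup>2)"
proof -
  have "(\<Sum>x\<in>S. f x * g x) \<le> (\<Sum>x\<in>S. \<bar>f x\<bar> * \<bar>g x\<bar>)"
    by (intro sum_mono) (metis abs_ge_self abs_mult)
  also have "\<dots> \<le> L2_set f S * L2_set g S" by (rule L2_set_mult_ineq)
  finally show ?thesis by (simp add: L2_set_def)
qed

lemma sum_at_most_one:
  fixes c :: real
  assumes "finite I" "0 \<le> c" "\<And>i j. i \<in> I \<Longrightarrow> j \<in> I \<Longrightarrow> P i \<Longrightarrow> P j \<Longrightarrow> i = j"
  shows "(\<Sum>i\<in>I. if P i then c else 0) \<le> c"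
proof (cases "\<exists>i\<in>I. P i")
  case True
  then obtain i where "i \<in> I" "P i" by blast
  then have "(\<Sum>j\<in>I. if P j then c else 0) = (\<Sum>j\<in>I. if j = i then c else 0)"
    using assms(3) by (intro sum.cong refl) auto
  then show ?thesis using assms(1,2) by simp
qed (use assms(2) in simp)

text \<open>Cauchy-Schwarz over triples (z, i, j), with the support of \<open>u\<close> charged to
  the second factor: for given z and j at most one i survives, so the sum over i costs nothing
  there. It therefore suffices to bound each \<open>u i\<close> separately.\<close>

lemma bilinear_bound_disjoint:
  fixes al :: "'i::finite \<Rightarrow> 'j::finite \<Rightarrow> real" and u :: "'i \<Rightarrow> 'x \<Rightarrow> real"
  assumes "finite Z" "0 \<le> H" "0 \<le> F"
    and disj: "\<And>i i' z. z \<in> Z \<Longrightarrow> u i z \<noteq> 0 \<Longrightarrow> u i' z \<noteq> 0 \<Longrightarrow> i = i'"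
    and u: "\<And>i. (\<Sum>z\<in>Z. (u i z)\<^sup>2) \<le> H\<^sup>2"
    and w: "(\<Sum>z\<in>Z. \<Sum>j\<in>UNIV. (w j z)\<^sup>2) \<le> F\<^sup>2"
  shows "(\<Sum>z\<in>Z. \<Sum>i\<in>UNIV. \<Sum>j\<in>UNIV. al i j * u i z * w j z)
      \<le> sqrt (\<Sum>i\<in>UNIV. \<Sum>j\<in>UNIV. (al i j)\<^sup>2) * H * F"
proof -
  let ?S = "Z \<times> (UNIV :: ('i \<times> 'j) set)"
  let ?A2 = "\<Sum>i\<in>UNIV. \<Sum>j\<in>UNIV. (al i j)\<^sup>2"
  define p where "p = (\<lambda>(z, i, j). al i j * u i z)"
  define q where "q = (\<lambda>(z, i, j). if u i z \<noteq> 0 then w j z else 0)"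
  have S: "(\<Sum>x\<in>?S. G x) = (\<Sum>z\<in>Z. \<Sum>i\<in>UNIV. \<Sum>j\<in>UNIV. G (z, i, j))" for G :: "_ \<Rightarrow> real"
    by (simp add: sum.cartesian_product' flip: UNIV_Times_UNIV)
  have "(\<Sum>x\<in>?S. (p x)\<^sup>2) = (\<Sum>i\<in>UNIV. \<Sum>z\<in>Z. \<Sum>j\<in>UNIV. (al i j * u i z)\<^sup>2)"
    unfolding S p_def by (subst sum.swap) simp
  also have "\<dots> = (\<Sum>i\<in>UNIV. (\<Sum>j\<in>UNIV. (al i j)\<^sup>2) * (\<Sum>z\<in>Z. (u i z)\<^sup>2))"
    by (simp add: power_mult_distrib sum_product sum.swap[of _ Z])
  also have "\<dots> \<le> (\<Sum>i\<in>UNIV. (\<Sum>j\<in>UNIV. (al i j)\<^sup>2) * H\<^sup>2)"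
    by (intro sum_mono mult_left_mono u sum_nonneg) auto
  finally have P: "(\<Sum>x\<in>?S. (p x)\<^sup>2) \<le> ?A2 * H\<^sup>2" by (simp add: sum_distrib_right)
  have "(\<Sum>x\<in>?S. (q x)\<^sup>2) = (\<Sum>z\<in>Z. \<Sum>j\<in>UNIV. \<Sum>i\<in>UNIV. if u i z \<noteq> 0 then (w j z)\<^sup>2 else 0)"
    unfolding S q_def
    by (intro sum.cong refl, subst sum.swap) (intro sum.cong refl, auto)
  also have "\<dots> \<le> (\<Sum>z\<in>Z. \<Sum>j\<in>UNIV. (w j z)\<^sup>2)"
    using disj by (intro sum_mono sum_at_most_one) auto
  also note w
  finally have Q: "(\<Sum>x\<in>?S. (q x)\<^sup>2) \<le> F\<^sup>2" .
  have "(\<Sum>z\<in>Z. \<Sum>i\<in>UNIV. \<Sum>j\<in>UNIV. al i j * u i z * w j z) = (\<Sum>x\<in>?S. p x * q x)"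
    unfolding S p_def q_def by (intro sum.cong refl) auto
  also have "\<dots> \<le> sqrt (\<Sum>x\<in>?S. (p x)\<^sup>2) * sqrt (\<Sum>x\<in>?S. (q x)\<^sup>2)" by (rule sum_mult_le_sqrt)
  also have "\<dots> \<le> sqrt (?A2 * H\<^sup>2) * sqrt (F\<^sup>2)"
    by (intro mult_mono real_sqrt_le_mono P Q real_sqrt_ge_zero sum_nonneg mult_nonneg_nonneg) auto
  also have "\<dots> = sqrt ?A2 * H * F" using assms(2,3) by (simp add: real_sqrt_mult)
  finally show ?thesis .
qed

text \<open>Cauchy-Schwarz in (i, j) at each z, then in z.\<close>

lemma bilinear_bound_both:
  fixes al :: "'i::finite \<Rightarrow> 'j::finite \<Rightarrow> real" and u :: "'i \<Rightarrow> 'x \<Rightarrow> real"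
  assumes "finite Z" "0 \<le> H" "0 \<le> F"
    and u: "(\<Sum>z\<in>Z. \<Sum>i\<in>UNIV. (u i z)\<^sup>2) \<le> H\<^sup>2"
    and w: "(\<Sum>z\<in>Z. \<Sum>j\<in>UNIV. (w j z)\<^sup>2) \<le> F\<^sup>2"
  shows "(\<Sum>z\<in>Z. \<Sum>i\<in>UNIV. \<Sum>j\<in>UNIV. al i j * u i z * w j z)
      \<le> sqrt (\<Sum>i\<in>UNIV. \<Sum>j\<in>UNIV. (al i j)\<^sup>2) * H * F"
proof -
  let ?A2 = "\<Sum>i\<in>UNIV. \<Sum>j\<in>UNIV. (al i j)\<^sup>2"
  have S: "(\<Sum>x\<in>UNIV. G x) = (\<Sum>i\<in>UNIV. \<Sum>j\<in>UNIV. G (i, j))" for G :: "'i \<times> 'j \<Rightarrow> real"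
    by (simp add: sum.cartesian_product' flip: UNIV_Times_UNIV)
  have "(\<Sum>i\<in>UNIV. \<Sum>j\<in>UNIV. al i j * u i z * w j z)
      \<le> sqrt ?A2 * (sqrt (\<Sum>i\<in>UNIV. (u i z)\<^sup>2) * sqrt (\<Sum>j\<in>UNIV. (w j z)\<^sup>2))" for z
    using sum_mult_le_sqrt[of "\<lambda>(i, j). al i j" "\<lambda>(i, j). u i z * w j z" UNIV]
    by (simp add: S mult.assoc power_mult_distrib flip: real_sqrt_mult sum_product)
  then have "(\<Sum>z\<in>Z. \<Sum>i\<in>UNIV. \<Sum>j\<in>UNIV. al i j * u i z * w j z)
      \<le> (\<Sum>z\<in>Z. sqrt ?A2 * (sqrt (\<Sum>i\<in>UNIV. (u i z)\<^sup>2) * sqrt (\<Sum>j\<in>UNIV. (w j z)\<^sup>2)))"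
    by (intro sum_mono)
  also have "\<dots> = sqrt ?A2 * (\<Sum>z\<in>Z. sqrt (\<Sum>i\<in>UNIV. (u i z)\<^sup>2) * sqrt (\<Sum>j\<in>UNIV. (w j z)\<^sup>2))"
    by (simp add: sum_distrib_left)
  also have "\<dots> \<le> sqrt ?A2 * (sqrt (\<Sum>z\<in>Z. (sqrt (\<Sum>i\<in>UNIV. (u i z)\<^sup>2))\<^sup>2) *
      sqrt (\<Sum>z\<in>Z. (sqrt (\<Sum>j\<in>UNIV. (w j z)\<^sup>2))\<^sup>2))"
    by (intro mult_left_mono sum_mult_le_sqrt real_sqrt_ge_zero sum_nonneg) auto
  also have "\<dots> = sqrt ?A2 * (sqrt (\<Sum>z\<in>Z. \<Sum>i\<in>UNIV. (u i z)\<^sup>2) *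
      sqrt (\<Sum>z\<in>Z. \<Sum>j\<in>UNIV. (w j z)\<^sup>2))"
    by (simp add: sum_nonneg)
  also have "\<dots> \<le> sqrt ?A2 * (sqrt (H\<^sup>2) * sqrt (F\<^sup>2))"
    by (intro mult_left_mono mult_mono real_sqrt_le_mono u w real_sqrt_ge_zero sum_nonneg
        mult_nonneg_nonneg) auto
  also have "\<dots> = sqrt ?A2 * H * F" using assms(2,3) by simp
  finally show ?thesis .
qed

text \<open>An l2 norm bound on a possibly infinite index type, tested on finite sets so that
  summability never has to be discussed.\<close>

definition l2_le :: "('x \<Rightarrow> real) \<Rightarrow> real \<Rightarrow> bool" where
  "l2_le f C \<longleftrightarrow> (\<forall>X. finite X \<longrightarrow> (\<Sum>x\<in>X. (f x)\<^sup>2) \<le> C\<^sup>2)"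

lemma l2_le_inj:
  assumes "l2_le f C" "finite P" "inj_on \<phi> P"
  shows "(\<Sum>x\<in>P. (f (\<phi> x))\<^sup>2) \<le> C\<^sup>2"
proof -
  have "(\<Sum>x\<in>P. (f (\<phi> x))\<^sup>2) = (\<Sum>y\<in>\<phi> ` P. (f y)\<^sup>2)"
    using assms(3) by (simp add: sum.reindex)
  then show ?thesis using assms(1,2) by (simp add: l2_le_def)
qed

text \<open>
  The three summands of the constant \<open>3\<close> come from splitting the two factors according to
  whether the inverse letter \<open>b i\<close> lands in its attracting set \<open>Sm i\<close>.
\<close>

lemma pingpong_bilinear_bound:
  fixes b :: "'i::finite \<Rightarrow> 'x \<Rightarrow> 'x" and al :: "'i \<Rightarrow> 'i \<Rightarrow> real"
  assumes Z: "finite Z"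
    and inj: "\<And>i. inj (b i)"
    and pp: "\<And>i z. z \<in> Z \<Longrightarrow> z \<notin> Sp i \<Longrightarrow> b i z \<in> Sm i"
    and Sm: "\<And>i j. i \<noteq> j \<Longrightarrow> Sm i \<inter> Sm j = {}"
    and Sp: "\<And>i j. i \<noteq> j \<Longrightarrow> Sp i \<inter> Sp j = {}"
    and al: "\<And>i. al i i = 0"
    and H: "l2_le h H" "0 \<le> H" and F: "l2_le f F" "0 \<le> F"
  shows "(\<Sum>z\<in>Z. \<Sum>i\<in>UNIV. \<Sum>j\<in>UNIV. al i j * h (b i z) * f (b j z))
      \<le> 3 * sqrt (\<Sum>i\<in>UNIV. \<Sum>j\<in>UNIV. (al i j)\<^sup>2) * H * F"
proof -
  let ?A2 = "\<Sum>i\<in>UNIV. \<Sum>j\<in>UNIV. (al i j)\<^sup>2"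
  define g1 where "g1 g i z = (if b i z \<in> Sm i then g (b i z) else 0)" for g :: "'x \<Rightarrow> real" and i z
  define g2 where "g2 g i z = (if b i z \<in> Sm i then 0 else g (b i z))" for g :: "'x \<Rightarrow> real" and i z
  have split: "g (b i z) = g1 g i z + g2 g i z" for g i z by (simp add: g1_def g2_def)
  \<comment> \<open>The good part is bounded jointly in z and i: the sets \<open>Sm i\<close> are
    disjoint, so a value \<open>b i z\<close> in \<open>Sm i\<close> determines i and then z, and
    every value of \<open>g\<close> is counted at most once.\<close>
  have g1: "(\<Sum>z\<in>Z. \<Sum>i\<in>UNIV. (g1 g i z)\<^sup>2) \<le> G\<^sup>2" if "l2_le g G" for g G
  proof -
    let ?P = "{(z, i). z \<in> Z \<and> b i z \<in> Sm i}"
    have fin: "finite ?P" by (rule finite_subset[of _ "Z \<times> UNIV"]) (auto simp: Z)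
    have "inj_on (\<lambda>(z, i). b i z) ?P"
    proof (rule inj_onI, clarify)
      fix z i z' i' assume *: "b i z \<in> Sm i" "b i' z' \<in> Sm i'" "b i z = b i' z'"
      then have "i = i'" using Sm by (metis disjoint_iff)
      with * inj show "z = z' \<and> i = i'" by (auto dest: injD)
    qed
    from l2_le_inj[OF that fin this] have "(\<Sum>(z, i)\<in>?P. (g (b i z))\<^sup>2) \<le> G\<^sup>2"
      by (simp add: split_beta)
    moreover have "(\<Sum>z\<in>Z. \<Sum>i\<in>UNIV. (g1 g i z)\<^sup>2) = (\<Sum>(z, i)\<in>Z \<times> UNIV. (g1 g i z)\<^sup>2)"
      by (rule sum.cartesian_product)
    moreover have "\<dots> = (\<Sum>(z, i)\<in>?P. (g (b i z))\<^sup>2)"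
      by (rule sum.mono_neutral_cong_right) (auto simp: Z g1_def split: if_splits)
    ultimately show ?thesis by simp
  qed
  have g2: "(\<Sum>z\<in>Z. (g2 g i z)\<^sup>2) \<le> G\<^sup>2" if "l2_le g G" for g G i
  proof -
    have "(\<Sum>z\<in>Z. (g2 g i z)\<^sup>2) \<le> (\<Sum>z\<in>Z. (g (b i z))\<^sup>2)"
      by (intro sum_mono) (simp add: g2_def)
    also have "\<dots> \<le> G\<^sup>2" using inj by (intro l2_le_inj[OF that Z]) (auto intro: inj_on_subset)
    finally show ?thesis .
  qed
  \<comment> \<open>A nonzero bad part forces z into \<open>Sp i\<close>, which happens for at most
    one i. It holds across two functions \<open>g\<close> and \<open>g'\<close>, as the bad-bad term
    requires.\<close>
  have disj: "i = i'" if "z \<in> Z" "g2 g i z \<noteq> 0" "g2 g' i' z \<noteq> 0" for z g g' i i'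
  proof (rule ccontr)
    assume "i \<noteq> i'"
    moreover have "z \<in> Sp i" "z \<in> Sp i'" using that pp by (auto simp: g2_def split: if_splits)
    ultimately show False using Sp by blast
  qed
  have "(\<Sum>z\<in>Z. \<Sum>i\<in>UNIV. \<Sum>j\<in>UNIV. al i j * h (b i z) * f (b j z))
      = (\<Sum>z\<in>Z. \<Sum>i\<in>UNIV. \<Sum>j\<in>UNIV. al i j * g1 h i z * g1 f j z)
      + (\<Sum>z\<in>Z. \<Sum>i\<in>UNIV. \<Sum>j\<in>UNIV. al i j * g2 h i z * g1 f j z)
      + (\<Sum>z\<in>Z. \<Sum>i\<in>UNIV. \<Sum>j\<in>UNIV. al i j * g1 h i z * g2 f j z)
      + (\<Sum>z\<in>Z. \<Sum>i\<in>UNIV. \<Sum>j\<in>UNIV. al i j * g2 h i z * g2 f j z)"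
    unfolding split sum.distrib[symmetric] by (intro sum.cong refl) (simp add: algebra_simps)
  \<comment> \<open>When both factors are bad, i and j coincide, and \<open>al\<close> vanishes on
    the diagonal. So three of the four products remain, each costing one Hilbert-Schmidt
    norm.\<close>
  moreover have "(\<Sum>z\<in>Z. \<Sum>i\<in>UNIV. \<Sum>j\<in>UNIV. al i j * g2 h i z * g2 f j z) = 0"
    using disj al by (intro sum.neutral ballI) (metis mult_eq_0_iff)
  moreover have "(\<Sum>z\<in>Z. \<Sum>i\<in>UNIV. \<Sum>j\<in>UNIV. al i j * g1 h i z * g1 f j z) \<le> sqrt ?A2 * H * F"
    by (intro bilinear_bound_both Z H F g1)
  moreover have "(\<Sum>z\<in>Z. \<Sum>i\<in>UNIV. \<Sum>j\<in>UNIV. al i j * g2 h i z * g1 f j z) \<le> sqrt ?A2 * H * F"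
    by (rule bilinear_bound_disjoint[OF Z H(2) F(2) disj g2[OF H(1)] g1[OF F(1)]])
  moreover have "(\<Sum>z\<in>Z. \<Sum>i\<in>UNIV. \<Sum>j\<in>UNIV. al i j * g1 h i z * g2 f j z) \<le> sqrt ?A2 * H * F"
  proof -
    have "(\<Sum>z\<in>Z. \<Sum>i\<in>UNIV. \<Sum>j\<in>UNIV. al i j * g1 h i z * g2 f j z)
        = (\<Sum>z\<in>Z. \<Sum>j\<in>UNIV. \<Sum>i\<in>UNIV. al i j * g2 f j z * g1 h i z)"
      by (rule sum.cong[OF refl]) (subst sum.swap, simp add: mult_ac)
    also have "\<dots> \<le> sqrt (\<Sum>j\<in>UNIV. \<Sum>i\<in>UNIV. (al i j)\<^sup>2) * F * H"
      by (rule bilinear_bound_disjoint[OF Z F(2) H(2) disj g2[OF F(1)] g1[OF H(1)]])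
    also have "(\<Sum>j\<in>UNIV. \<Sum>i\<in>UNIV. (al i j)\<^sup>2) = ?A2" by (rule sum.swap)
    finally show ?thesis by (simp add: mult_ac)
  qed
  ultimately show ?thesis by linarith
qed

text \<open>With \<open>b j\<close> inverse to \<open>a j\<close>, this is the sum of
  \<open>U_i^* U_j\<close> with weights \<open>al i j\<close>, acting on functions on an arbitrary
  set of points.\<close>

definition pp_op :: "('i::finite \<Rightarrow> 'i \<Rightarrow> real) \<Rightarrow> ('i \<Rightarrow> 'x \<Rightarrow> 'x) \<Rightarrow> ('i \<Rightarrow> 'x \<Rightarrow> 'x) \<Rightarrow>
    ('x \<Rightarrow> real) \<Rightarrow> 'x \<Rightarrow> real" where
  "pp_op al a b f x = (\<Sum>i\<in>UNIV. \<Sum>j\<in>UNIV. al i j * f (b j (a i x)))"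

text \<open>Duality: \<open>pp_op al a b f\<close> is paired with its own truncation
  \<open>h\<close> to a finite set. After substituting z = a_i x the pairing is the symmetric
  bilinear form already bounded, which gives N^2 \<le> 3 N F for the truncated norm N.\<close>

lemma pingpong_norm_bound:
  fixes a b :: "'i::finite \<Rightarrow> 'x \<Rightarrow> 'x" and al :: "'i \<Rightarrow> 'i \<Rightarrow> real"
  assumes ba: "\<And>i x. b i (a i x) = x" and ab: "\<And>i x. a i (b i x) = x"
    and X: "\<And>i x. a i x \<in> X \<longleftrightarrow> x \<in> X"
    and pp: "\<And>i z. z \<in> X \<Longrightarrow> z \<notin> Sp i \<Longrightarrow> b i z \<in> Sm i"
    and Sm: "\<And>i j. i \<noteq> j \<Longrightarrow> Sm i \<inter> Sm j = {}"
    and Sp: "\<And>i j. i \<noteq> j \<Longrightarrow> Sp i \<inter> Sp j = {}"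
    and al: "\<And>i. al i i = 0" "\<And>i j. 0 \<le> al i j"
    and A: "(\<Sum>i\<in>UNIV. \<Sum>j\<in>UNIV. (al i j)\<^sup>2) \<le> 1"
    and F: "l2_le f F" "0 \<le> F" and f: "\<And>x. 0 \<le> f x" "\<And>x. x \<notin> X \<Longrightarrow> f x = 0"
  shows "l2_le (pp_op al a b f) (3 * F)"
    and "0 \<le> pp_op al a b f x" and "x \<notin> X \<Longrightarrow> pp_op al a b f x = 0"
proof -
  let ?T = "pp_op al a b f"
  let ?A2 = "\<Sum>i\<in>UNIV. \<Sum>j\<in>UNIV. (al i j)\<^sup>2"
  show T0: "0 \<le> ?T x" for x unfolding pp_op_def by (intro sum_nonneg mult_nonneg_nonneg al f)
  have Xb: "b i x \<in> X \<longleftrightarrow> x \<in> X" for i x using X[of i "b i x"] by (simp add: ab)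
  show TX: "?T x = 0" if "x \<notin> X" for x
    unfolding pp_op_def using that by (intro sum.neutral ballI) (simp add: f Xb X)
  show "l2_le ?T (3 * F)" unfolding l2_le_def
  proof (intro allI impI)
    fix W0 :: "'x set" assume "finite W0"
    define W where "W = W0 \<inter> X"
    have W: "finite W" "W \<subseteq> X" using \<open>finite W0\<close> by (auto simp: W_def)
    define h where "h x = (if x \<in> W then ?T x else 0)" for x
    define N where "N = sqrt (\<Sum>x\<in>W. (?T x)\<^sup>2)"
    have N0: "0 \<le> N" by (simp add: N_def sum_nonneg)
    have N2: "(\<Sum>x\<in>W. (?T x)\<^sup>2) = N\<^sup>2" by (simp add: N_def sum_nonneg)
    have h: "l2_le h N" unfolding l2_le_def
    proof (intro allI impI)
      fix Y :: "'x set" assume Y: "finite Y"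
      have "(\<Sum>x\<in>Y. (h x)\<^sup>2) = (\<Sum>x\<in>Y \<inter> W. (?T x)\<^sup>2)"
        by (rule sum.mono_neutral_cong_right) (auto simp: Y h_def)
      also have "\<dots> \<le> (\<Sum>x\<in>W. (?T x)\<^sup>2)" by (rule sum_mono2) (auto simp: W)
      finally show "(\<Sum>x\<in>Y. (h x)\<^sup>2) \<le> N\<^sup>2" by (simp add: N2)
    qed
    define Z where "Z = (\<Union>i. a i ` W)"
    have Z: "finite Z" "Z \<subseteq> X" using W X by (auto simp: Z_def)
    have inj: "inj (b i)" for i by (metis ab injI)
    have h0: "0 \<le> h x" for x by (simp add: h_def T0)
    have "N\<^sup>2 = (\<Sum>x\<in>W. h x * ?T x)"
      unfolding N2[symmetric] by (intro sum.cong refl) (simp add: h_def power2_eq_square)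
    also have "\<dots> = (\<Sum>x\<in>W. \<Sum>i\<in>UNIV. \<Sum>j\<in>UNIV. al i j * h x * f (b j (a i x)))"
      by (simp add: pp_op_def[of al a b f] sum_distrib_left mult_ac)
    also have "\<dots> = (\<Sum>i\<in>UNIV. \<Sum>x\<in>W. \<Sum>j\<in>UNIV. al i j * h x * f (b j (a i x)))"
      by (rule sum.swap)
    \<comment> \<open>The range of z = a_i x depends on i; nonnegativity of all terms allows
      enlarging it to the common finite set \<open>Z\<close>.\<close>
    also have "\<dots> \<le> (\<Sum>i\<in>UNIV. \<Sum>z\<in>Z. \<Sum>j\<in>UNIV. al i j * h (b i z) * f (b j z))"
    proof (rule sum_mono)
      fix i
      have "inj_on (a i) W" by (metis ba inj_onI)
      then have "(\<Sum>x\<in>W. \<Sum>j\<in>UNIV. al i j * h x * f (b j (a i x)))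
          = (\<Sum>z\<in>a i ` W. \<Sum>j\<in>UNIV. al i j * h (b i z) * f (b j z))"
        by (simp add: sum.reindex ba)
      also have "\<dots> \<le> (\<Sum>z\<in>Z. \<Sum>j\<in>UNIV. al i j * h (b i z) * f (b j z))"
        by (intro sum_mono2 Z sum_nonneg mult_nonneg_nonneg al h0 f) (auto simp: Z_def)
      finally show "(\<Sum>x\<in>W. \<Sum>j\<in>UNIV. al i j * h x * f (b j (a i x)))
          \<le> (\<Sum>z\<in>Z. \<Sum>j\<in>UNIV. al i j * h (b i z) * f (b j z))" .
    qed
    also have "\<dots> = (\<Sum>z\<in>Z. \<Sum>i\<in>UNIV. \<Sum>j\<in>UNIV. al i j * h (b i z) * f (b j z))"
      by (rule sum.swap)
    also have "\<dots> \<le> 3 * sqrt ?A2 * N * F"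
      using Z(2) by (intro pingpong_bilinear_bound[OF Z(1) inj pp Sm Sp al(1) h N0 F]) auto
    also have "\<dots> \<le> 3 * 1 * N * F"
      using A by (intro mult_right_mono mult_left_mono N0 F) auto
    finally have "N * N \<le> (3 * F) * N" by (simp add: power2_eq_square mult_ac)
    then have "N \<le> 3 * F" using N0 F(2) by (cases "N = 0") auto
    then have "N\<^sup>2 \<le> (3 * F)\<^sup>2" using N0 by (rule power_mono)
    moreover have "(\<Sum>x\<in>W0. (?T x)\<^sup>2) = (\<Sum>x\<in>W. (?T x)\<^sup>2)"
      by (rule sum.mono_neutral_right) (auto simp: W_def \<open>finite W0\<close> TX)
    ultimately show "(\<Sum>x\<in>W0. (?T x)\<^sup>2) \<le> (3 * F)\<^sup>2" using N2 by simp
  qed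
qed

subsection \<open>Ping-pong for the integer matrices\<close>

abbreviation ip :: "idx \<Rightarrow> nat" where "ip i \<equiv> Rep_idx i"

definition a_inv :: "nat \<Rightarrow> int^2^2" where
  "a_inv j = vector [vector [1 - 4 * int j, 8 * int j ^ 2], vector [- 2, 1 + 4 * int j]]"

lemma a_inv_mult: "a_inv j ** a_mat j = mat 1" "a_mat j ** a_inv j = mat 1"
  by (simp_all add: vec_eq_iff forall_2 a_inv_def a_mat_def matrix_matrix_mult_def sum_2 mat_def
      algebra_simps power2_eq_square)

lemma a_mat_mult_nth:
  "(a_mat j ** w) $ 1 $ c = (1 + 4 * int j) * w $ 1 $ c - 8 * int j ^ 2 * w $ 2 $ c"
  "(a_mat j ** w) $ 2 $ c = 2 * w $ 1 $ c + (1 - 4 * int j) * w $ 2 $ c"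
  by (simp_all add: a_mat_def matrix_matrix_mult_def sum_2)

lemma a_inv_mult_nth:
  "(a_inv j ** w) $ 1 $ c = (1 - 4 * int j) * w $ 1 $ c + 8 * int j ^ 2 * w $ 2 $ c"
  "(a_inv j ** w) $ 2 $ c = - 2 * w $ 1 $ c + (1 + 4 * int j) * w $ 2 $ c"
  by (simp_all add: a_inv_def matrix_matrix_mult_def sum_2)

text \<open>
  With \<open>(x, z)\<close> the first column and \<open>p = x - 2 j z\<close>, the matrix \<open>a\<^sub>j\<close> acts by
  \<open>(p, z) \<mapsto> (p, z + 2 p)\<close>.  The two sets are given by \<open>0 \<le> p / z \<le> 1\<close> and \<open>-1 < p / z < 0\<close>.
\<close>

definition shifted :: "nat \<Rightarrow> int^2^2 \<Rightarrow> int" where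
  "shifted j w = w $ 1 $ 1 - 2 * int j * w $ 2 $ 1"

definition Sp_set :: "nat \<Rightarrow> (int^2^2) set" where
  "Sp_set j = {w. w $ 2 $ 1 \<noteq> 0 \<and> 0 \<le> shifted j w * w $ 2 $ 1 \<and>
     shifted j w * w $ 2 $ 1 \<le> w $ 2 $ 1 * w $ 2 $ 1}"

definition Sm_set :: "nat \<Rightarrow> (int^2^2) set" where
  "Sm_set j = {w. w $ 2 $ 1 \<noteq> 0 \<and> shifted j w * w $ 2 $ 1 < 0 \<and>
     - (w $ 2 $ 1 * w $ 2 $ 1) < shifted j w * w $ 2 $ 1}"

lemma shifted_a_inv:
  "shifted j (a_inv j ** w) = shifted j w"
  "(a_inv j ** w) $ 2 $ 1 = w $ 2 $ 1 - 2 * shifted j w"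
  by (simp_all add: shifted_def a_inv_mult_nth algebra_simps power2_eq_square)

text \<open>With t = p / z, the inverse letter acts by t -> t / (1 - 2 t), which maps everything
  outside [0, 1], including z = 0 as t infinite, into (-1, 0). Multiplying by squares avoids
  fractions.\<close>

lemma pingpong_ineq:
  fixes p z :: int
  assumes "p \<noteq> 0 \<or> z \<noteq> 0" "\<not> (z \<noteq> 0 \<and> 0 \<le> p * z \<and> p * z \<le> z * z)"
  shows "z - 2 * p \<noteq> 0 \<and> p * (z - 2 * p) < 0 \<and> - ((z - 2 * p) * (z - 2 * p)) < p * (z - 2 * p)"
proof -
  have p: "p \<noteq> 0" using assms by (auto simp: mult_less_0_iff)
  have "(p > 0 \<and> z < p) \<or> (p < 0 \<and> p < z)"
  proof (cases "0 \<le> p * z \<and> z \<noteq> 0")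
    case True
    then have "z * z < p * z" using assms(2) by auto
    then show ?thesis using True p by (auto simp: zero_le_mult_iff mult_less_cancel_right)
  next
    case False
    then show ?thesis using p by (auto simp: zero_le_mult_iff linorder_not_le)
  qed
  then have "z - 2 * p \<noteq> 0 \<and> p * (z - 2 * p) < 0 \<and> 0 < (z - p) * (z - 2 * p)"
    by (auto simp: mult_less_0_iff zero_less_mult_iff)
  then show ?thesis by (simp add: algebra_simps)
qed

lemma pingpong_step:
  assumes "w $ 1 $ 1 \<noteq> 0 \<or> w $ 2 $ 1 \<noteq> 0" "w \<notin> Sp_set j"
  shows "a_inv j ** w \<in> Sm_set j"
proof -
  have "shifted j w \<noteq> 0 \<or> w $ 2 $ 1 \<noteq> 0" using assms(1) by (auto simp: shifted_def)
  from pingpong_ineq[OF this] assms(2) show ?thesis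
    by (simp add: Sp_set_def Sm_set_def shifted_a_inv)
qed

text \<open>The ratios p / z belonging to two letters differ by 2 (j - i), hence by at least 2,
  whereas each ping-pong window has length 1. Both disjointness claims follow.\<close>

lemma shifted_gap:
  assumes "i < j"
  shows "shifted j w * w $ 2 $ 1 \<le> shifted i w * w $ 2 $ 1 - 2 * (w $ 2 $ 1 * w $ 2 $ 1)"
proof -
  have "1 * (w $ 2 $ 1 * w $ 2 $ 1) \<le> (int j - int i) * (w $ 2 $ 1 * w $ 2 $ 1)"
    using assms by (intro mult_right_mono) auto
  then show ?thesis by (simp add: shifted_def algebra_simps)
qed

lemma Sm_disjoint: "i \<noteq> j \<Longrightarrow> Sm_set i \<inter> Sm_set j = {}"
proof -
  have "w \<notin> Sm_set j" if "i < j" "w \<in> Sm_set i" for i j w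
    using shifted_gap[OF that(1), of w] that(2) by (auto simp: Sm_set_def)
  then show "i \<noteq> j \<Longrightarrow> Sm_set i \<inter> Sm_set j = {}" by (meson disjoint_iff nat_neq_iff)
qed

lemma Sp_disjoint: "i \<noteq> j \<Longrightarrow> Sp_set i \<inter> Sp_set j = {}"
proof -
  have "w \<notin> Sp_set j" if "i < j" "w \<in> Sp_set i" for i j w
  proof -
    have "0 < w $ 2 $ 1 * w $ 2 $ 1" using that(2) by (auto simp: Sp_set_def zero_less_mult_iff)
    then show ?thesis using shifted_gap[OF that(1), of w] that(2) by (auto simp: Sp_set_def)
  qed
  then show "i \<noteq> j \<Longrightarrow> Sp_set i \<inter> Sp_set j = {}" by (meson disjoint_iff nat_neq_iff)
qed

abbreviation lift_op :: "(idx \<Rightarrow> idx \<Rightarrow> real) \<Rightarrow> (int^2^2 \<Rightarrow> real) \<Rightarrow> int^2^2 \<Rightarrow> real" where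
  "lift_op al \<equiv> pp_op al (\<lambda>i w. a_mat (ip i) ** w) (\<lambda>i w. a_inv (ip i) ** w)"

text \<open>\<open>f s w\<close> is the total weight of the ways to write \<open>w\<close> as a
  product of s factors a_i^{-1} a_j. The nonnegativity and support claims are carried along because
  the norm bound for the next step assumes them.\<close>

lemma lift_op_iterate:
  assumes al: "\<And>i. al i i = 0" "\<And>i j. 0 \<le> al i j"
    and A: "(\<Sum>i\<in>UNIV. \<Sum>j\<in>UNIV. (al i j)\<^sup>2) \<le> 1"
  defines "f s \<equiv> (lift_op al ^^ s) (\<lambda>w. if w = mat 1 then 1 else 0)"
  shows "l2_le (f s) (3 ^ s) \<and> (\<forall>w. 0 \<le> f s w) \<and> (\<forall>w. w $ 1 $ 1 = 0 \<and> w $ 2 $ 1 = 0 \<longrightarrow> f s w = 0)"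
proof (induction s)
  case 0
  have "(\<Sum>x\<in>X. (f 0 x)\<^sup>2) \<le> 1" if "finite X" for X
  proof -
    have "(\<Sum>x\<in>X. (f 0 x)\<^sup>2) = (\<Sum>x\<in>X. if x = mat 1 then 1 else 0)"
      by (intro sum.cong) (auto simp: f_def)
    then show ?thesis using that by simp
  qed
  then show ?case by (auto simp: l2_le_def f_def mat_def)
next
  case (Suc s)
  \<comment> \<open>Ping-pong takes place on the first column, which must not vanish. The letters
    preserve this set, and the starting point mass at the identity is supported in it.\<close>
  let ?X = "{w :: int^2^2. w $ 1 $ 1 \<noteq> 0 \<or> w $ 2 $ 1 \<noteq> 0}"
  have X: "a_mat j ** w \<in> ?X \<longleftrightarrow> w \<in> ?X" for j w
  proof -
    have 1: "a_mat j ** v \<notin> ?X" if "v \<notin> ?X" for v using that by (simp add: a_mat_mult_nth)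
    have 2: "a_inv j ** v \<notin> ?X" if "v \<notin> ?X" for v using that by (simp add: a_inv_mult_nth)
    have 3: "a_inv j ** (a_mat j ** w) = w"
      by (simp add: matrix_mul_assoc a_inv_mult)
    show ?thesis using 1[of w] 2[of "a_mat j ** w"] unfolding 3 by blast
  qed
  have ne: "ip i \<noteq> ip j" if "i \<noteq> j" for i j using that by (meson Rep_idx_inject)
  have Suc': "f (Suc s) = lift_op al (f s)" by (simp add: f_def)
  have IH: "l2_le (f s) (3 ^ s)" "\<And>w. 0 \<le> f s w" "\<And>w. w \<notin> ?X \<Longrightarrow> f s w = 0"
    using Suc by auto
  have ba: "a_inv j ** (a_mat j ** w) = w" and ab: "a_mat j ** (a_inv j ** w) = w" for j w
    by (simp_all add: matrix_mul_assoc a_inv_mult)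
  have pp: "a_inv j ** w \<in> Sm_set j" if "w \<in> ?X" "w \<notin> Sp_set j" for j w
    using that by (intro pingpong_step) auto
  have "0 \<le> (3 :: real) ^ s" by simp
  note bound = pingpong_norm_bound[of "\<lambda>i w. a_inv (ip i) ** w" "\<lambda>i w. a_mat (ip i) ** w" ?X
      "\<lambda>i. Sp_set (ip i)" "\<lambda>i. Sm_set (ip i)" al "f s" "3 ^ s",
      OF ba ab X pp Sm_disjoint[OF ne] Sp_disjoint[OF ne] al A IH(1) this IH(2,3)]
  have "l2_le (f (Suc s)) (3 ^ Suc s)"
    unfolding Suc' power_Suc by (rule bound(1))
  moreover have "0 \<le> f (Suc s) w" for w
    unfolding Suc' by (rule bound(2))
  moreover have "f (Suc s) w = 0" if "w $ 1 $ 1 = 0 \<and> w $ 2 $ 1 = 0" for w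
  proof -
    have "w \<notin> ?X" using that by simp
    show ?thesis unfolding Suc' by (rule bound(3)) (assumption | fact)+
  qed
  ultimately show ?case by blast
qed

subsection \<open>Comparison with the finite group\<close>

lemma mod_M_mult_left: "mod_M (mod_M A ** B) = mod_M (A ** B)"
proof -
  have "((x mod par_M) * a + (y mod par_M) * b) mod par_M = (x * a + y * b) mod par_M" for a b x y
    by (intro mod_add_cong mod_mult_left_eq)
  then show ?thesis
    by (simp add: vec_eq_iff mod_M_nth matrix_matrix_mult_def sum_2)
qed

lemma mod_M_Rep: "mod_M (Rep_sl2 g) = Rep_sl2 g"
  using Rep_sl2[of g] by (simp add: vec_eq_iff mod_M_nth)

text \<open>The integer matrices whose left multiplication carries \<open>g\<close> to
  \<open>h\<close> modulo \<open>par_M\<close>; the entry of a word operator at (h, g) is a sum over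
  this fibre.\<close>

definition lifts :: "sl2 \<Rightarrow> sl2 \<Rightarrow> (int^2^2) set" where
  "lifts g h = {w. mod_M (w ** Rep_sl2 g) = Rep_sl2 h}"

lemma lifts_a_mat:
  assumes "w \<in> lifts g l"
  shows "a_mat j ** w \<in> lifts g (sl2_mult (a_elt j) l)"
proof -
  have "Rep_sl2 (sl2_mult (a_elt j) l) = mod_M (mod_M (a_mat j) ** mod_M (w ** Rep_sl2 g))"
    using assms by (simp add: lifts_def sl2_mult.rep_eq a_elt.rep_eq)
  also have "\<dots> = mod_M (a_mat j ** w ** Rep_sl2 g)"
    unfolding mod_M_mult_left mod_M_mult_right by (simp only: matrix_mul_assoc)
  finally show ?thesis by (simp add: lifts_def)
qed

lemma lifts_a_inv:
  assumes "w \<in> lifts g (sl2_mult (a_elt j) h)"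
  shows "a_inv j ** w \<in> lifts g h"
proof -
  have "mod_M (a_inv j ** w ** Rep_sl2 g) = mod_M (a_inv j ** mod_M (w ** Rep_sl2 g))"
    by (simp only: mod_M_mult_right matrix_mul_assoc)
  also have "mod_M (w ** Rep_sl2 g) = mod_M (mod_M (a_mat j) ** Rep_sl2 h)"
    using assms by (simp add: lifts_def sl2_mult.rep_eq a_elt.rep_eq)
  also have "mod_M (a_inv j ** mod_M (mod_M (a_mat j) ** Rep_sl2 h)) = mod_M (a_inv j ** a_mat j ** Rep_sl2 h)"
    unfolding mod_M_mult_left mod_M_mult_right by (simp only: matrix_mul_assoc)
  also have "\<dots> = Rep_sl2 h" by (simp add: a_inv_mult mod_M_Rep)
  finally show ?thesis by (simp add: lifts_def)
qed

text \<open>The largest absolute row sum among the letters and their inverses, attained by the first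
  row of \<open>a_mat par_k\<close>: one letter enlarges the entries by at most this factor.\<close>

definition growth :: int where "growth = 8 * int par_k ^ 2 + 4 * int par_k + 1"

definition entry_box :: "int \<Rightarrow> (int^2^2) set" where
  "entry_box B = {w. \<forall>i j. \<bar>w $ i $ j\<bar> \<le> B}"

lemma finite_entry_box: "finite (entry_box B)"
proof (rule finite_subset)
  let ?f = "\<lambda>(a, b, c, d). vector [vector [a, b], vector [c, d]] :: int^2^2"
  show "entry_box B \<subseteq> ?f ` ({-B..B} \<times> {-B..B} \<times> {-B..B} \<times> {-B..B})"
  proof
    fix w assume "w \<in> entry_box B"
    moreover have "w = ?f (w $ 1 $ 1, w $ 1 $ 2, w $ 2 $ 1, w $ 2 $ 2)"
      by (simp add: vec_eq_iff forall_2)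
    ultimately show "w \<in> ?f ` ({-B..B} \<times> {-B..B} \<times> {-B..B} \<times> {-B..B})"
      by (intro image_eqI[of w ?f "(w $ 1 $ 1, w $ 1 $ 2, w $ 2 $ 1, w $ 2 $ 2)"])
        (auto simp: entry_box_def abs_le_iff minus_le_iff)
  qed
qed auto

lemma abs_comb_le:
  fixes x y :: int
  assumes "\<bar>x\<bar> \<le> B" "\<bar>y\<bar> \<le> B" "\<bar>a\<bar> + \<bar>b\<bar> \<le> C"
  shows "\<bar>a * x + b * y\<bar> \<le> C * B"
proof -
  have "\<bar>a * x + b * y\<bar> \<le> \<bar>a\<bar> * \<bar>x\<bar> + \<bar>b\<bar> * \<bar>y\<bar>" by (simp add: abs_triangle_ineq flip: abs_mult)
  also have "\<dots> \<le> \<bar>a\<bar> * B + \<bar>b\<bar> * B" using assms by (intro add_mono mult_left_mono) auto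
  also have "\<dots> = (\<bar>a\<bar> + \<bar>b\<bar>) * B" by (simp add: algebra_simps)
  also have "\<dots> \<le> C * B" using assms by (intro mult_right_mono) auto
  finally show ?thesis .
qed

lemma entry_box_mult:
  assumes "w \<in> entry_box B"
  shows "a_mat (ip i) ** w \<in> entry_box (growth * B)" "a_inv (ip i) ** w \<in> entry_box (growth * B)"
proof -
  define j where "j = int (ip i)"
  have "ip i \<in> {1..par_k}" by (rule Rep_idx)
  then have j: "1 \<le> j" "j \<le> int par_k" by (auto simp: j_def)
  then have "j ^ 2 \<le> int par_k ^ 2" by (intro power_mono) auto
  with j have g: "8 * j ^ 2 + 4 * j + 1 \<le> growth" unfolding growth_def by linarith
  have w: "\<bar>w $ r $ c\<bar> \<le> B" for r c using assms by (simp add: entry_box_def)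
  have "\<bar>(1 + 4 * j) * w $ 1 $ c + (- 8 * j ^ 2) * w $ 2 $ c\<bar> \<le> growth * B"
    "\<bar>2 * w $ 1 $ c + (1 - 4 * j) * w $ 2 $ c\<bar> \<le> growth * B"
    "\<bar>(1 - 4 * j) * w $ 1 $ c + (8 * j ^ 2) * w $ 2 $ c\<bar> \<le> growth * B"
    "\<bar>- 2 * w $ 1 $ c + (1 + 4 * j) * w $ 2 $ c\<bar> \<le> growth * B" for c
    by (intro abs_comb_le w; use g j self_le_power[of j 2] in \<open>simp add: abs_if abs_mult\<close>)+
  then show "a_mat (ip i) ** w \<in> entry_box (growth * B)" "a_inv (ip i) ** w \<in> entry_box (growth * B)"
    by (simp_all add: entry_box_def forall_2 a_mat_mult_nth a_inv_mult_nth flip: j_def)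
qed

section \<open>Entries of powers of \<open>T_op\<close> dominated by weights of integer
  words\<close>

lemma U_mult_nth: "(U j ** V) $ h $ g = (\<Sum>l\<in>UNIV. if h = sl2_mult (a_elt (ip j)) l then V $ l $ g else 0)"
  by (simp add: matrix_matrix_mult_def U_def if_distrib[of "\<lambda>x. x * _"] cong: if_cong)

lemma cadj_U_mult_nth: "(cadj (U i) ** V) $ h $ g = V $ sl2_mult (a_elt (ip i)) h $ g"
  by (simp add: matrix_matrix_mult_def cadj_nth U_def if_distrib[of "\<lambda>x. x * _"]
      if_distrib[of cnj] cong: if_cong)

lemma matrix_add_rdistrib_complex: "(A + B) ** C = A ** C + B ** (C :: complex^'a^'b)"
  by (simp add: vec_eq_iff matrix_matrix_mult_def algebra_simps sum.distrib)

lemma sum_matrix_mult: "sum F S ** V = (\<Sum>x\<in>S. F x ** V)" for V :: "complex^'a^'b"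
  by (induction S rule: infinite_finite_induct) (simp_all add: matrix_add_rdistrib_complex)

lemma cscale_matrix_mult: "cscale c X ** V = cscale c (X ** V)"
  by (simp add: vec_eq_iff cscale_def matrix_matrix_mult_def sum_distrib_left mult.assoc)

lemma T_op_mult_nth:
  "(T_op A ** V) $ h $ g = (\<Sum>i\<in>UNIV. \<Sum>j\<in>UNIV. if i = j then 0 else
     A $ i $ j * (\<Sum>l\<in>UNIV. if sl2_mult (a_elt (ip i)) h = sl2_mult (a_elt (ip j)) l then V $ l $ g else 0))"
proof -
  let ?t = "\<lambda>i j. A $ i $ j *
    (\<Sum>l\<in>UNIV. if sl2_mult (a_elt (ip i)) h = sl2_mult (a_elt (ip j)) l then V $ l $ g else 0)"
  have "(T_op A ** V) $ h $ g = (\<Sum>(i, j)\<in>{(i, j). i \<noteq> j}. ?t i j)"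
    unfolding T_op_def sum_matrix_mult sum_component split_beta cscale_matrix_mult matrix_mul_assoc[symmetric]
    by (simp add: cscale_def cadj_U_mult_nth U_mult_nth)
  also have "\<dots> = (\<Sum>(i, j)\<in>UNIV \<times> UNIV. if i = j then 0 else ?t i j)"
    by (rule sum.mono_neutral_cong_left) auto
  finally show ?thesis by (simp add: sum.cartesian_product)
qed

text \<open>Only l = a_j^{-1} a_i h contributes, by cancellation in the group. The map
  \<open>\<phi>\<close> by a_i^{-1} a_j sends the fibre over l injectively into the fibre over h;
  two letters enlarge the box by \<open>growth\<close> twice.\<close>

lemma lift_step:
  assumes f0: "\<And>w. 0 \<le> f w"
    and V: "\<And>l. norm (V $ l $ g) \<le> (\<Sum>w\<in>entry_box B \<inter> lifts g l. f w)"
  shows "norm (\<Sum>l\<in>UNIV. if sl2_mult (a_elt (ip i)) h = sl2_mult (a_elt (ip j)) l then V $ l $ g else 0)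
      \<le> (\<Sum>w\<in>entry_box (growth * (growth * B)) \<inter> lifts g h. f (a_inv (ip j) ** (a_mat (ip i) ** w)))"
    (is "norm ?S \<le> ?R")
proof (cases "\<exists>l. sl2_mult (a_elt (ip i)) h = sl2_mult (a_elt (ip j)) l")
  case True
  then obtain l where l: "sl2_mult (a_elt (ip i)) h = sl2_mult (a_elt (ip j)) l" by blast
  have "?S = (\<Sum>l'\<in>UNIV. if l' = l then V $ l' $ g else 0)"
    by (intro sum.cong refl) (use l sl2_mult_left_cancel in auto)
  then have "norm ?S \<le> (\<Sum>w\<in>entry_box B \<inter> lifts g l. f w)" using V[of l] by simp
  also have "\<dots> \<le> ?R"
  proof -
    define \<phi> :: "int^2^2 \<Rightarrow> int^2^2" where "\<phi> w = a_inv (ip i) ** (a_mat (ip j) ** w)" for w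
    have bk: "a_inv (ip j) ** (a_mat (ip i) ** \<phi> w) = w" for w
      by (simp add: \<phi>_def) (simp add: matrix_mul_assoc a_inv_mult)
    have inj: "inj_on \<phi> (entry_box B \<inter> lifts g l)" by (metis bk inj_onI)
    have "\<phi> w \<in> entry_box (growth * (growth * B)) \<inter> lifts g h" if "w \<in> entry_box B \<inter> lifts g l" for w
      using that entry_box_mult lifts_a_mat[of w g l "ip j"] lifts_a_inv[of _ g "ip i" h]
      by (auto simp: \<phi>_def l)
    then have "\<phi> ` (entry_box B \<inter> lifts g l) \<subseteq> entry_box (growth * (growth * B)) \<inter> lifts g h" by blast
    then have "(\<Sum>w\<in>\<phi> ` (entry_box B \<inter> lifts g l). f (a_inv (ip j) ** (a_mat (ip i) ** w))) \<le> ?R"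
      by (intro sum_mono2) (auto simp: finite_entry_box f0)
    then show ?thesis by (simp add: sum.reindex[OF inj] bk)
  qed
  finally show ?thesis .
qed (simp add: sum_nonneg f0)

lemma matpow_Suc_left: "matpow A (Suc n) = A ** matpow A n"
  by (simp add: matpow_def)

text \<open>Passing to the absolute values \<open>al\<close> costs nothing, since the ping-pong
  bound sees only the Hilbert-Schmidt norm. The box records that s factors of two letters each can
  reach entries of size \<open>growth ^ (2 * s)\<close> only.\<close>

lemma T_op_matpow_le:
  assumes A: "(\<Sum>i\<in>UNIV. \<Sum>j\<in>UNIV. (norm (A $ i $ j))\<^sup>2) \<le> 1"
  defines "al \<equiv> \<lambda>i j. if i = j then 0 else norm (A $ i $ j)"
  defines "f s \<equiv> (lift_op al ^^ s) (\<lambda>w. if w = mat 1 then 1 else 0)"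
  shows "norm (matpow (T_op A) s $ h $ g) \<le> (\<Sum>w\<in>entry_box (growth ^ (2 * s)) \<inter> lifts g h. f s w)"
    and "f s (mat 1) \<le> 3 ^ s" and "0 \<le> f s w"
proof -
  have al: "al i i = 0" "0 \<le> al i j" for i j by (auto simp: al_def)
  have "(\<Sum>i\<in>UNIV. \<Sum>j\<in>UNIV. (al i j)\<^sup>2) \<le> (\<Sum>i\<in>UNIV. \<Sum>j\<in>UNIV. (norm (A $ i $ j))\<^sup>2)"
    by (intro sum_mono) (simp add: al_def)
  then have al2: "(\<Sum>i\<in>UNIV. \<Sum>j\<in>UNIV. (al i j)\<^sup>2) \<le> 1" using A by linarith
  note it = lift_op_iterate[of al, OF al al2, folded f_def]
  show f0: "0 \<le> f s w" for s w using it by blast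
  have "(f s (mat 1))\<^sup>2 \<le> (3 ^ s)\<^sup>2"
    using it[of s] unfolding l2_le_def by (auto dest: spec[of _ "{mat 1}"])
  then show "f s (mat 1) \<le> 3 ^ s" by (rule power2_le_imp_le) simp
  show "norm (matpow (T_op A) s $ h $ g) \<le> (\<Sum>w\<in>entry_box (growth ^ (2 * s)) \<inter> lifts g h. f s w)"
  proof (induction s arbitrary: h)
    case 0
    show ?case
    proof (cases "h = g")
      case True
      have "mat 1 \<in> entry_box 1 \<inter> lifts g g"
        by (simp add: entry_box_def lifts_def mod_M_Rep) (simp add: mat_def)
      then have "f 0 (mat 1) \<le> (\<Sum>w\<in>entry_box 1 \<inter> lifts g g. f 0 w)"
        by (intro member_le_sum) (auto simp: f0 finite_entry_box)
      then show ?thesis using True by (simp add: matpow_def mat_def f_def)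
    qed (simp add: matpow_def mat_def sum_nonneg f0)
  next
    case (Suc s)
    let ?B = "growth ^ (2 * s)"
    let ?W = "entry_box (growth * (growth * ?B)) \<inter> lifts g h"
    let ?S = "\<lambda>i j. \<Sum>l\<in>UNIV. if sl2_mult (a_elt (ip i)) h = sl2_mult (a_elt (ip j)) l
      then matpow (T_op A) s $ l $ g else 0"
    have "norm (matpow (T_op A) (Suc s) $ h $ g)
        = norm (\<Sum>i\<in>UNIV. \<Sum>j\<in>UNIV. if i = j then 0 else A $ i $ j * ?S i j)"
      unfolding matpow_Suc_left T_op_mult_nth ..
    also have "\<dots> \<le> (\<Sum>i\<in>UNIV. \<Sum>j\<in>UNIV. norm (if i = j then 0 else A $ i $ j * ?S i j))"
      by (intro order_trans[OF norm_sum] sum_mono norm_sum)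
    also have "\<dots> \<le> (\<Sum>i\<in>UNIV. \<Sum>j\<in>UNIV. al i j *
        (\<Sum>w\<in>?W. f s (a_inv (ip j) ** (a_mat (ip i) ** w))))"
    proof (intro sum_mono)
      fix i j
      have "norm (?S i j) \<le> (\<Sum>w\<in>?W. f s (a_inv (ip j) ** (a_mat (ip i) ** w)))"
        by (rule lift_step[OF f0 Suc.IH])
      then show "norm (if i = j then 0 else A $ i $ j * ?S i j) \<le> al i j *
          (\<Sum>w\<in>?W. f s (a_inv (ip j) ** (a_mat (ip i) ** w)))"
        by (simp add: al_def norm_mult mult_left_mono)
    qed
    also have "\<dots> = (\<Sum>w\<in>?W. \<Sum>i\<in>UNIV. \<Sum>j\<in>UNIV. al i j * f s (a_inv (ip j) ** (a_mat (ip i) ** w)))"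
      by (simp add: sum_distrib_left sum.swap[of _ _ ?W])
    also have "\<dots> = (\<Sum>w\<in>?W. f (Suc s) w)"
      by (simp add: f_def pp_op_def)
    finally show ?case by simp
  qed
qed

text \<open>The extra 1 on the left pays for subtracting the identity matrix when a word is compared
  with it modulo \<open>par_M\<close>.\<close>

lemma growth_power_less:
  assumes "0 < n"
  shows "growth ^ n + 1 < (16 * int par_k ^ 2) ^ n"
proof -
  have g: "0 \<le> growth" by (simp add: growth_def)
  have "growth ^ n + 1 \<le> (growth + 1) ^ n" using assms
  proof (induction n rule: nat_induct_non_zero)
    case (Suc n)
    have "growth ^ Suc n + 1 \<le> (growth ^ n + 1) * (growth + 1)"
      using g by (simp add: algebra_simps)
    also have "\<dots> \<le> (growth + 1) ^ n * (growth + 1)" using Suc g by (intro mult_right_mono) auto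
    finally show ?case by (simp add: mult.commute)
  qed simp
  also have "\<dots> < (16 * int par_k ^ 2) ^ n"
  proof (rule power_strict_mono)
    have "1 < int par_k" by (simp add: par_k_def)
    moreover have "int par_k * 4294967296 = int par_k ^ 2" by (simp add: par_k_def)
    ultimately show "growth + 1 < 16 * int par_k ^ 2" unfolding growth_def by linarith
  qed (use g assms in auto)
  finally show ?thesis .
qed

lemma lifts_entry_box_trivial:
  assumes w: "w \<in> lifts g g" "w \<in> entry_box B" and B: "B + 1 < par_M"
  shows "w = mat 1"
proof -
  define G where "G = Rep_sl2 g"
  define D where "D = w - mat 1"
  have dG: "det G mod par_M = 1" using Rep_sl2[of g] by (simp add: G_def)
  have "(w ** G) $ i $ j mod par_M = G $ i $ j mod par_M" for i j
    using w(1) mod_M_Rep[of g] unfolding lifts_def by (simp add: G_def vec_eq_iff mod_M_nth)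
  then have dvd: "par_M dvd (w ** G) $ i $ j - G $ i $ j" for i j
    by (simp add: mod_eq_dvd_iff)
  have D: "(w ** G) $ i $ j - G $ i $ j = D $ i $ 1 * G $ 1 $ j + D $ i $ 2 * G $ 2 $ j" for i j
    using exhaust_2[of i]
    by (auto simp: D_def matrix_matrix_mult_def sum_2 mat_def algebra_simps)
  \<comment> \<open>Multiplying D G by the adjugate of G turns divisibility of D G into divisibility
    of \<open>D\<close> times \<open>det G\<close>, and \<open>det G\<close> is 1 modulo
    \<open>par_M\<close>. Entries of \<open>D\<close> below \<open>par_M\<close> must then
    vanish.\<close>
  have "par_M dvd (D $ i $ 1 * G $ 1 $ 1 + D $ i $ 2 * G $ 2 $ 1) * G $ 2 $ 2
      - (D $ i $ 1 * G $ 1 $ 2 + D $ i $ 2 * G $ 2 $ 2) * G $ 2 $ 1" for i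
    using dvd D by (metis dvd_diff dvd_mult2)
  moreover have "par_M dvd (D $ i $ 1 * G $ 1 $ 2 + D $ i $ 2 * G $ 2 $ 2) * G $ 1 $ 1
      - (D $ i $ 1 * G $ 1 $ 1 + D $ i $ 2 * G $ 2 $ 1) * G $ 1 $ 2" for i
    using dvd D by (metis dvd_diff dvd_mult2)
  ultimately have "par_M dvd D $ i $ 1 * det G" "par_M dvd D $ i $ 2 * det G" for i
    by (simp_all add: det_2 algebra_simps)
  then have Dd: "par_M dvd D $ i $ j * det G" for i j
    using exhaust_2[of j] by auto
  have "par_M dvd D $ i $ j" for i j
  proof -
    have "D $ i $ j mod par_M = D $ i $ j * (det G mod par_M) mod par_M" by (simp add: dG)
    also have "\<dots> = D $ i $ j * det G mod par_M" by (rule mod_mult_right_eq)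
    also have "\<dots> = 0" using Dd[of i j] by (simp add: dvd_eq_mod_eq_0)
    finally show ?thesis by (simp add: dvd_eq_mod_eq_0)
  qed
  moreover have "\<bar>D $ i $ j\<bar> < par_M" for i j
  proof -
    have "\<bar>w $ i $ j\<bar> \<le> B" using w(2) by (simp add: entry_box_def)
    moreover have "\<bar>(mat 1 :: int^2^2) $ i $ j\<bar> \<le> 1" by (simp add: mat_def)
    ultimately show ?thesis using B by (simp add: D_def)
  qed
  ultimately have "D $ i $ j = 0" for i j
    by (metis abs_ge_self dvd_imp_le_int not_less order_trans)
  then show ?thesis by (simp add: D_def vec_eq_iff)
qed

text \<open>Each power of \<open>T_op\<close> contributes two letters, so the words have length
  \<open>4 * par_m\<close> and their entries stay below \<open>par_M - 1\<close>. Hence a word that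
  fixes \<open>g\<close> modulo \<open>par_M\<close> is the identity already over the integers, and
  the fibre sum reduces to one term.\<close>

lemma T_op_moment:
  assumes A: "(\<Sum>i\<in>UNIV. \<Sum>j\<in>UNIV. (norm (A $ i $ j))\<^sup>2) \<le> 1"
  shows "norm (matpow (T_op A) (2 * par_m) $ g $ g) \<le> 3 ^ (2 * par_m)"
proof -
  define al where "al = (\<lambda>i j. if i = j then 0 else norm (A $ i $ j))"
  define f where "f = (lift_op al ^^ (2 * par_m)) (\<lambda>w. if w = mat 1 then 1 else 0)"
  note bound = T_op_matpow_le[OF A, where s = "2 * par_m", folded al_def, folded f_def]
  let ?S = "entry_box (growth ^ (2 * (2 * par_m))) \<inter> lifts g g"
  have m: "0 < 4 * par_m" by (simp add: par_m_def par_r_def par_k_def)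
  have "growth ^ (2 * (2 * par_m)) + 1 < par_M"
    using growth_power_less[OF m] unfolding par_M_eq[symmetric] by simp
  then have S: "?S \<subseteq> {mat 1}" using lifts_entry_box_trivial by blast
  have "norm (matpow (T_op A) (2 * par_m) $ g $ g) \<le> (\<Sum>w\<in>?S. f w)"
    by (rule bound(1))
  also have "\<dots> \<le> (\<Sum>w\<in>{mat 1}. f w)"
    by (rule sum_mono2) (use S bound(3) in auto)
  also have "\<dots> \<le> 3 ^ (2 * par_m)" using bound(2) by simp
  finally show ?thesis .
qed

subsection \<open>Channels in Kraus form\<close>

text \<open>Kraus form gives complete positivity and also positivity of \<open>tensor_map\<close> on
  a matrix pair of spaces, which is not literally an instance of
  \<open>completely_positive\<close>.\<close>

definition kraus :: "('c::finite \<Rightarrow> complex^'a^'b) \<Rightarrow> (complex^'a^'a \<Rightarrow> complex^'b^'b) \<Rightarrow> bool" where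
  "kraus K \<Phi> \<longleftrightarrow> (\<forall>X. \<Phi> X = (\<Sum>a\<in>UNIV. K a ** X ** cadj (K a)))"

lemma conj_nth:
  "(K ** X ** cadj K) $ i $ j = (\<Sum>g\<in>UNIV. \<Sum>h\<in>UNIV. K $ i $ g * X $ g $ h * cnj (K $ j $ h))"
proof -
  have "(K ** X ** cadj K) $ i $ j = (\<Sum>h\<in>UNIV. \<Sum>g\<in>UNIV. K $ i $ g * X $ g $ h * cnj (K $ j $ h))"
    by (simp add: matrix_matrix_mult_def cadj_nth sum_distrib_right)
  also have "\<dots> = (\<Sum>g\<in>UNIV. \<Sum>h\<in>UNIV. K $ i $ g * X $ g $ h * cnj (K $ j $ h))"
    by (rule sum.swap)
  finally show ?thesis .
qed

lemma kraus_nth: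
  assumes "kraus K \<Phi>"
  shows "\<Phi> X $ i $ j = (\<Sum>a\<in>UNIV. \<Sum>g\<in>UNIV. \<Sum>h\<in>UNIV. K a $ i $ g * X $ g $ h * cnj (K a $ j $ h))"
  using assms by (simp add: kraus_def conj_nth)

lemma psd_on_cong:
  assumes "\<And>s t. s \<in> S \<Longrightarrow> t \<in> S \<Longrightarrow> A s t = B s t"
  shows "psd_on S A \<longleftrightarrow> psd_on S B"
proof -
  have "(\<Sum>i\<in>S. \<Sum>j\<in>S. cnj (v i) * A i j * v j) = (\<Sum>i\<in>S. \<Sum>j\<in>S. cnj (v i) * B i j * v j)" for v
    using assms by (intro sum.cong refl) auto
  then show ?thesis by (simp add: psd_on_def)
qed

lemma nonneg_Reals_sum: "(\<And>x. x \<in> S \<Longrightarrow> f x \<in> \<real>\<^sub>\<ge>\<^sub>0) \<Longrightarrow> sum f S \<in> \<real>\<^sub>\<ge>\<^sub>0"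
  for f :: "'x \<Rightarrow> complex"
  by (induction S rule: infinite_finite_induct) (auto intro: nonneg_Reals_add_I)

lemma psd_on_sum:
  assumes "\<And>a. a \<in> C \<Longrightarrow> psd_on S (A a)"
  shows "psd_on S (\<lambda>s t. \<Sum>a\<in>C. A a s t)"
  unfolding psd_on_def
proof
  fix v
  have "(\<Sum>i\<in>S. \<Sum>j\<in>S. cnj (v i) * (\<Sum>a\<in>C. A a i j) * v j)
      = (\<Sum>a\<in>C. \<Sum>i\<in>S. \<Sum>j\<in>S. cnj (v i) * A a i j * v j)"
    by (simp add: sum_distrib_left sum_distrib_right sum.swap[of _ C])
  also have "\<dots> \<in> \<real>\<^sub>\<ge>\<^sub>0"
  proof (rule nonneg_Reals_sum)
    fix a assume "a \<in> C"
    then show "(\<Sum>i\<in>S. \<Sum>j\<in>S. cnj (v i) * A a i j * v j) \<in> \<real>\<^sub>\<ge>\<^sub>0"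
      using assms unfolding psd_on_def by blast
  qed
  finally show "(\<Sum>i\<in>S. \<Sum>j\<in>S. cnj (v i) * (\<Sum>a\<in>C. A a i j) * v j) \<in> \<real>\<^sub>\<ge>\<^sub>0" .
qed

lemma psd_on_conj:
  assumes "psd_on T M"
  shows "psd_on S (\<lambda>s s'. \<Sum>t\<in>T. \<Sum>t'\<in>T. L s t * M t t' * cnj (L s' t'))"
  unfolding psd_on_def
proof
  fix v
  define w where "w t = (\<Sum>s\<in>S. cnj (L s t) * v s)" for t
  have "(\<Sum>i\<in>S. \<Sum>j\<in>S. cnj (v i) * (\<Sum>t\<in>T. \<Sum>t'\<in>T. L i t * M t t' * cnj (L j t')) * v j)
      = (\<Sum>i\<in>S. \<Sum>j\<in>S. \<Sum>t\<in>T. \<Sum>t'\<in>T. cnj (cnj (L i t) * v i) * M t t' * (cnj (L j t') * v j))"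
    by (simp add: sum_distrib_left sum_distrib_right mult_ac)
  also have "\<dots> = (\<Sum>i\<in>S. \<Sum>t\<in>T. \<Sum>t'\<in>T. \<Sum>j\<in>S. cnj (cnj (L i t) * v i) * M t t' * (cnj (L j t') * v j))"
    by (rule sum.cong[OF refl]) (subst sum.swap, rule sum.cong[OF refl], rule sum.swap)
  also have "\<dots> = (\<Sum>t\<in>T. \<Sum>t'\<in>T. \<Sum>i\<in>S. \<Sum>j\<in>S. cnj (cnj (L i t) * v i) * M t t' * (cnj (L j t') * v j))"
    by (subst sum.swap, rule sum.cong[OF refl], rule sum.swap)
  also have "\<dots> = (\<Sum>t\<in>T. \<Sum>t'\<in>T. cnj (w t) * M t t' * w t')"
    by (simp only: w_def cnj_sum sum_distrib_right) (simp only: sum_distrib_left)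
  also have "\<dots> \<in> \<real>\<^sub>\<ge>\<^sub>0" using assms by (simp add: psd_on_def)
  finally show "(\<Sum>i\<in>S. \<Sum>j\<in>S. cnj (v i) * (\<Sum>t\<in>T. \<Sum>t'\<in>T. L i t * M t t' * cnj (L j t')) * v j) \<in> \<real>\<^sub>\<ge>\<^sub>0" .
qed

lemma kraus_completely_positive:
  assumes "kraus K \<Phi>"
  shows "completely_positive \<Phi>"
  unfolding completely_positive_def
proof (intro allI impI)
  fix n :: nat and X :: "nat \<Rightarrow> nat \<Rightarrow> complex^'b^'b"
  let ?T = "{..<n} \<times> (UNIV :: 'b set)" and ?S = "{..<n} \<times> (UNIV :: 'c set)"
  assume X: "psd_on ?T (\<lambda>(p, i) (q, j). X p q $ i $ j)"
  \<comment> \<open>\<open>L a\<close> is the identity on the block index tensored with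
    \<open>K a\<close>.\<close>
  define L where "L a = (\<lambda>(p :: nat, i) (p', g). if p = p' then K a $ i $ g else 0)" for a
  have row: "(\<Sum>t\<in>?T. (if p = fst t then G t else 0)) = (\<Sum>g\<in>UNIV. G (p, g))"
    if "p < n" for p and G :: "nat \<times> 'b \<Rightarrow> complex"
  proof -
    have "(\<Sum>t\<in>?T. (if p = fst t then G t else 0))
        = (\<Sum>p'\<in>{..<n}. \<Sum>g\<in>UNIV. if p = p' then G (p', g) else 0)"
      by (simp add: sum.cartesian_product')
    also have "\<dots> = (\<Sum>p'\<in>{..<n}. if p' = p then (\<Sum>g\<in>UNIV. G (p', g)) else 0)"
      by (intro sum.cong) auto
    finally show ?thesis using that by simp
  qed
  have "psd_on ?S (\<lambda>s s'. \<Sum>a\<in>UNIV. \<Sum>t\<in>?T. \<Sum>t'\<in>?T.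
      L a s t * (case t of (p, i) \<Rightarrow> \<lambda>(q, j). X p q $ i $ j) t' * cnj (L a s' t'))"
    by (intro psd_on_sum psd_on_conj X)
  also have "?this \<longleftrightarrow> psd_on ?S (\<lambda>(p, i) (q, j). \<Phi> (X p q) $ i $ j)"
  proof (rule psd_on_cong)
    fix s s' assume "s \<in> ?S" "s' \<in> ?S"
    then obtain p i q j where s: "s = (p, i)" "s' = (q, j)" "p < n" "q < n" by auto
    have "(\<Sum>t\<in>?T. \<Sum>t'\<in>?T. L a s t * (case t of (p, i) \<Rightarrow> \<lambda>(q, j). X p q $ i $ j) t' * cnj (L a s' t'))
        = (\<Sum>t\<in>?T. if p = fst t then (\<Sum>t'\<in>?T. if q = fst t' then
            K a $ i $ snd t * X (fst t) (fst t') $ snd t $ snd t' * cnj (K a $ j $ snd t') else 0) else 0)" for a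
      by (intro sum.cong refl) (auto simp: L_def s split_beta intro!: sum.cong)
    also have "\<dots> a = (\<Sum>g\<in>UNIV. \<Sum>h\<in>UNIV. K a $ i $ g * X p q $ g $ h * cnj (K a $ j $ h))" for a
      by (simp add: row s(3,4))
    finally show "(\<Sum>a\<in>UNIV. \<Sum>t\<in>?T. \<Sum>t'\<in>?T.
        L a s t * (case t of (p, i) \<Rightarrow> \<lambda>(q, j). X p q $ i $ j) t' * cnj (L a s' t'))
      = (case s of (p, i) \<Rightarrow> \<lambda>(q, j). \<Phi> (X p q) $ i $ j) s'"
      by (simp add: s kraus_nth[OF assms])
  qed
  finally show "psd_on ?S (\<lambda>(p, i) (q, j). \<Phi> (X p q) $ i $ j)" .
qed

lemma kraus_psd:
  assumes "kraus K \<Phi>" "psd X"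
  shows "psd (\<Phi> X)"
proof -
  have "psd_on UNIV (\<lambda>s s'. \<Sum>t\<in>UNIV. \<Sum>t'\<in>UNIV. K a $ s $ t * X $ t $ t' * cnj (K a $ s' $ t'))" for a
    by (rule psd_on_conj[OF assms(2)[unfolded psd_def], where L = "\<lambda>s t. K a $ s $ t"])
  from psd_on_sum[of UNIV UNIV, OF this] show ?thesis
    unfolding psd_def kraus_nth[OF assms(1)] .
qed

lemma kraus_ketbra:
  assumes "kraus K \<Phi>"
  shows "\<Phi> (ketbra g h) $ i $ j = (\<Sum>a\<in>UNIV. K a $ i $ g * cnj (K a $ j $ h))"
proof -
  have "(\<Sum>g'\<in>UNIV. \<Sum>h'\<in>UNIV. K a $ i $ g' * ketbra g h $ g' $ h' * cnj (K a $ j $ h'))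
      = K a $ i $ g * cnj (K a $ j $ h)" for a
  proof -
    have "(\<Sum>g'\<in>UNIV. \<Sum>h'\<in>UNIV. K a $ i $ g' * ketbra g h $ g' $ h' * cnj (K a $ j $ h'))
        = (\<Sum>g'\<in>UNIV. if g' = g then (\<Sum>h'\<in>UNIV. if h' = h then K a $ i $ g' * cnj (K a $ j $ h') else 0) else 0)"
      by (rule sum.cong[OF refl]) (simp add: ketbra_def if_distrib[of "\<lambda>x. _ * x * _"] cong: if_cong)
    then show ?thesis by simp
  qed
  then show ?thesis by (simp add: kraus_nth[OF assms])
qed

text \<open>The products of a Kraus operator of each factor are Kraus operators of the tensor
  map.\<close>

lemma tensor_map_psd:
  assumes K: "kraus K \<Phi>" "kraus K' \<Psi>" and Z: "psd Z"
  shows "psd (tensor_map \<Phi> \<Psi> Z)"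
proof -
  define L where "L = (\<lambda>(a, b) s p. K a $ fst s $ fst p * K' b $ snd s $ snd p)"
  have "psd_on UNIV (\<lambda>s s'. \<Sum>ab\<in>UNIV. \<Sum>t\<in>UNIV. \<Sum>t'\<in>UNIV. L ab s t * Z $ t $ t' * cnj (L ab s' t'))"
    by (intro psd_on_sum psd_on_conj Z[unfolded psd_def])
  moreover have "(\<Sum>ab\<in>UNIV. \<Sum>t\<in>UNIV. \<Sum>t'\<in>UNIV. L ab s t * Z $ t $ t' * cnj (L ab s' t'))
      = tensor_map \<Phi> \<Psi> Z $ s $ s'" for s s'
  proof -
    have "tensor_map \<Phi> \<Psi> Z $ s $ s' = (\<Sum>t\<in>UNIV. \<Sum>t'\<in>UNIV. Z $ t $ t' *
        ((\<Sum>a\<in>UNIV. K a $ fst s $ fst t * cnj (K a $ fst s' $ fst t')) *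
         (\<Sum>b\<in>UNIV. K' b $ snd s $ snd t * cnj (K' b $ snd s' $ snd t'))))"
      by (simp add: tensor_map_def cscale_def kron_def kraus_ketbra[OF K(1)] kraus_ketbra[OF K(2)])
    also have "\<dots> = (\<Sum>t\<in>UNIV. \<Sum>t'\<in>UNIV. \<Sum>ab\<in>UNIV. L ab s t * Z $ t $ t' * cnj (L ab s' t'))"
      by (intro sum.cong refl, simp only: sum_product sum_distrib_left L_def
          UNIV_Times_UNIV[symmetric] sum.cartesian_product' prod.case complex_cnj_mult mult_ac)
        (rule sum.swap)
    also have "\<dots> = (\<Sum>t\<in>UNIV. \<Sum>ab\<in>UNIV. \<Sum>t'\<in>UNIV. L ab s t * Z $ t $ t' * cnj (L ab s' t'))"
      by (rule sum.cong[OF refl]) (rule sum.swap)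
    also have "\<dots> = (\<Sum>ab\<in>UNIV. \<Sum>t\<in>UNIV. \<Sum>t'\<in>UNIV. L ab s t * Z $ t $ t' * cnj (L ab s' t'))"
      by (rule sum.swap)
    finally show ?thesis by simp
  qed
  ultimately show ?thesis by (simp add: psd_def)
qed

lemma trace_kron: "trace (kron A B) = trace A * trace B"
  by (simp add: trace_def kron_def sum_product UNIV_Times_UNIV[symmetric] sum.cartesian_product'
      del: UNIV_Times_UNIV)

lemma trace_cscale: "trace (cscale c A) = c * trace A"
  by (simp add: trace_def cscale_def sum_distrib_left)

lemma trace_sum: "trace (sum f S) = (\<Sum>x\<in>S. trace (f x))" for f :: "'x \<Rightarrow> complex^'n^'n"
  unfolding trace_def sum_component by (rule sum.swap)

lemma trace_ketbra: "trace (ketbra a b :: complex^'n^'n) = (if a = b then 1 else 0)"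
proof -
  have "trace (ketbra a b :: complex^'n^'n) = (\<Sum>i\<in>UNIV. if i = a then (if a = b then 1 else 0) else 0)"
    unfolding trace_def by (intro sum.cong) (auto simp: ketbra_def)
  then show ?thesis by simp
qed

lemma tensor_map_trace:
  assumes "trace_preserving \<Phi>" "trace_preserving \<Psi>"
  shows "trace (tensor_map \<Phi> \<Psi> Z) = trace Z"
proof -
  have "trace (tensor_map \<Phi> \<Psi> Z) = (\<Sum>p\<in>UNIV. \<Sum>q\<in>UNIV. if q = p then Z $ p $ q else 0)"
    unfolding tensor_map_def trace_sum trace_cscale trace_kron
    using assms by (intro sum.cong refl) (auto simp: trace_preserving_def trace_ketbra prod_eq_iff)
  then show ?thesis by (simp add: trace_def)
qed

lemma kraus_linear:
  assumes "kraus K \<Phi>"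
  shows "linear_map \<Phi>"
  unfolding linear_map_def vec_eq_iff
  by (simp add: kraus_nth[OF assms] cscale_def sum.distrib sum_distrib_left algebra_simps)

lemma kraus_density:
  assumes "kraus K \<Phi>" "trace_preserving \<Phi>" "density \<rho>"
  shows "density (\<Phi> \<rho>)"
  using assms kraus_psd[OF assms(1)] by (simp add: density_def trace_preserving_def)

subsection \<open>The damping matrix\<close>

lemma F_inverse: "(mat 1 + R_op) ** F_op = mat 1"
  using someI_ex[OF invertible_F[unfolded invertible_def]] unfolding F_op_def matrix_inv_def by blast

lemma F_vec_add: "F_op *v v + R_op *v (F_op *v v) = v"
  using arg_cong[OF F_inverse, of "\<lambda>A. A *v v"]
  by (simp add: matrix_vector_mult_add_rdistrib flip: matrix_vector_mul_assoc)

lemma cadj_F [simp]: "cadj F_op = F_op"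
  using hermitian_F by (simp add: hermitian_def)

lemma norm_F_le: "norm (F_op *v v) \<le> norm v"
proof -
  let ?f = "F_op *v v"
  have "inner ?f ?f \<le> inner (?f + R_op *v ?f) (?f + R_op *v ?f)"
    using R_op_nonneg[of ?f] by (simp add: inner_add_left inner_add_right inner_commute)
  then show ?thesis by (simp add: F_vec_add norm_le)
qed

lemma matrix_vector_mult_diff_rdistrib_complex: "(A - B) *v x = A *v x - B *v x"
  for A :: "complex^'n^'m"
  by (simp add: vec_eq_iff matrix_vector_mult_def sum_subtractf algebra_simps)

lemma psd_one_minus_F2: "psd (mat 1 - F_op ** F_op)"
proof -
  have "inner v ((mat 1 - F_op ** F_op) *v v) = (norm v)\<^sup>2 - (norm (F_op *v v))\<^sup>2" for v
    using inner_matrix_hermitian[OF hermitian_F, of v "F_op *v v"]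
    by (simp add: matrix_vector_mult_diff_rdistrib_complex inner_diff_right power2_norm_eq_inner
        flip: matrix_vector_mul_assoc)
  then show ?thesis
    using norm_F_le by (simp add: psd_iff_inner hermitian_def cadj_diff cadj_mult power_mono)
qed

lemma trace_conj_expand:
  "trace (A ** X ** cadj B) = (\<Sum>g\<in>UNIV. \<Sum>h\<in>UNIV. \<Sum>h'\<in>UNIV. A $ g $ h * X $ h $ h' * cnj (B $ g $ h'))"
proof -
  have "(A ** X ** cadj B) $ g $ g = (\<Sum>h'\<in>UNIV. \<Sum>h\<in>UNIV. A $ g $ h * X $ h $ h' * cnj (B $ g $ h'))" for g
    by (simp add: matrix_matrix_mult_def cadj_nth sum_distrib_right)
  moreover have "(\<Sum>h'\<in>UNIV. \<Sum>h\<in>UNIV. A $ g $ h * X $ h $ h' * cnj (B $ g $ h'))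
      = (\<Sum>h\<in>UNIV. \<Sum>h'\<in>UNIV. A $ g $ h * X $ h $ h' * cnj (B $ g $ h'))" for g
    by (rule sum.swap)
  ultimately show ?thesis by (simp only: trace_def)
qed

text \<open>The first family reads the row \<open>g\<close> of \<open>U i ** F_op\<close>, so that
  summing over \<open>g\<close> forms the trace. The second family writes 1 - F^2 as C C^* and sends
  the mass lost by damping to the maximally mixed output, one operator per output index and column
  of C.\<close>

lemma Phi_kraus: "\<exists>K :: sl2 + idx \<times> sl2 \<Rightarrow> complex^sl2^idx. kraus K Phi"
proof -
  obtain C :: "complex^sl2^sl2" where C: "mat 1 - F_op ** F_op = C ** cadj C" using psd_factor[OF psd_one_minus_F2] by blast
  define q where "q = complex_of_real (sqrt (real par_k))"
  have qq: "q * q = of_nat par_k" "cnj q = q"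
    unfolding q_def by (simp_all flip: of_real_mult)
  define K1 :: "sl2 \<Rightarrow> complex^sl2^idx" where "K1 g = (\<chi> i h. (U i ** F_op) $ g $ h / q)" for g
  define K2 :: "idx \<times> sl2 \<Rightarrow> complex^sl2^idx"
    where "K2 lt = (\<chi> i h. if i = fst lt then cnj (C $ h $ snd lt) / q else 0)" for lt
  define K where "K = case_sum K1 K2"
  have "kraus K Phi" unfolding kraus_def vec_eq_iff
  proof (intro allI)
    fix X i j
    have one: "(\<Sum>g\<in>UNIV. (K1 g ** X ** cadj (K1 g)) $ i $ j)
        = 1 / of_nat par_k * trace (U i ** F_op ** X ** F_op ** cadj (U j))"
    proof -
      have "(\<Sum>g\<in>UNIV. (K1 g ** X ** cadj (K1 g)) $ i $ j)
          = 1 / (q * q) * trace ((U i ** F_op) ** X ** cadj (U j ** F_op))"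
        unfolding trace_conj_expand conj_nth K1_def sum_distrib_left
        by (intro sum.cong refl) (simp add: qq(2))
      then show ?thesis by (simp only: qq cadj_mult cadj_F matrix_mul_assoc)
    qed
    have two: "(\<Sum>lt\<in>UNIV. (K2 lt ** X ** cadj (K2 lt)) $ i $ j)
        = (if i = j then 1 else 0) / of_nat par_k * trace ((mat 1 - F_op ** F_op) ** X)"
    proof -
      have "(K2 (l, t) ** X ** cadj (K2 (l, t))) $ i $ j = (if l = i then (if i = j then
          1 / (q * q) * (\<Sum>g\<in>UNIV. \<Sum>h\<in>UNIV. cnj (C $ g $ t) * X $ g $ h * C $ h $ t) else 0) else 0)" for l t
        unfolding conj_nth K2_def by (auto simp: qq(2) sum_distrib_left)
      then have "(\<Sum>l\<in>UNIV. \<Sum>t\<in>UNIV. (K2 (l, t) ** X ** cadj (K2 (l, t))) $ i $ j)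
          = (\<Sum>l\<in>UNIV. if l = i then (\<Sum>t\<in>UNIV. if i = j then
          1 / (q * q) * (\<Sum>g\<in>UNIV. \<Sum>h\<in>UNIV. cnj (C $ g $ t) * X $ g $ h * C $ h $ t) else 0) else 0)"
        by (intro sum.cong refl) simp
      also have "\<dots> = (if i = j then 1 else 0) / (q * q) *
          (\<Sum>t\<in>UNIV. \<Sum>g\<in>UNIV. \<Sum>h\<in>UNIV. cnj (C $ g $ t) * X $ g $ h * C $ h $ t)"
        by (simp add: sum_distrib_left)
      also have "(\<Sum>t\<in>UNIV. \<Sum>g\<in>UNIV. \<Sum>h\<in>UNIV. cnj (C $ g $ t) * X $ g $ h * C $ h $ t)
          = trace (cadj C ** X ** cadj (cadj C))"
        unfolding trace_conj_expand by (simp add: cadj_nth)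
      also have "trace (cadj C ** X ** cadj (cadj C)) = trace (C ** (cadj C ** X))"
        unfolding cadj_cadj by (rule trace_mul_sym)
      also have "\<dots> = trace ((mat 1 - F_op ** F_op) ** X)" by (simp only: C matrix_mul_assoc)
      finally have "(\<Sum>l\<in>UNIV. \<Sum>t\<in>UNIV. (K2 (l, t) ** X ** cadj (K2 (l, t))) $ i $ j)
          = (if i = j then 1 else 0) / of_nat par_k * trace ((mat 1 - F_op ** F_op) ** X)"
        by (simp only: qq)
      then show ?thesis
        by (simp only: UNIV_Times_UNIV[symmetric] sum.cartesian_product')
    qed
    have "(\<Sum>a\<in>UNIV. K a ** X ** cadj (K a)) $ i $ j
        = (\<Sum>g\<in>UNIV. (K1 g ** X ** cadj (K1 g)) $ i $ j) + (\<Sum>lt\<in>UNIV. (K2 lt ** X ** cadj (K2 lt)) $ i $ j)"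
      unfolding UNIV_Plus_UNIV[symmetric] sum.Plus[OF finite finite] by (simp add: K_def)
    then show "Phi X $ i $ j = (\<Sum>a\<in>UNIV. K a ** X ** cadj (K a)) $ i $ j"
      unfolding one two by (simp add: Phi_def)
  qed
  then show ?thesis by blast
qed

text \<open>Unitarity of \<open>U i\<close> makes the damped part contribute Tr (F^2 X) to every
  diagonal entry, and the second term of \<open>Phi\<close> restores the missing Tr ((1 - F^2)
  X).\<close>

lemma Phi_diag: "Phi X $ i $ i = trace X / of_nat par_k"
proof -
  have "trace (U i ** F_op ** X ** F_op ** cadj (U i)) = trace (F_op ** X ** F_op)"
    using trace_unitary_conj[OF unitary_U, of i "F_op ** X ** F_op"] by (simp only: matrix_mul_assoc)
  also have "\<dots> = trace (F_op ** (F_op ** X))" by (rule trace_mul_sym)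
  finally have 1: "trace (U i ** F_op ** X ** F_op ** cadj (U i)) = trace (F_op ** F_op ** X)"
    by (simp only: matrix_mul_assoc)
  have "(mat 1 - F_op ** F_op) ** X = X - F_op ** F_op ** X"
    using matrix_add_rdistrib_complex[of "mat 1 - F_op ** F_op" "F_op ** F_op" X] by (simp add: algebra_simps)
  then have "trace ((mat 1 - F_op ** F_op) ** X) = trace X - trace (F_op ** F_op ** X)"
    by (simp add: trace_sub)
  with 1 show ?thesis by (simp add: Phi_def diff_divide_distrib)
qed

lemma CARD_idx: "CARD(idx) = par_k"
  by (simp only: card_idx par_k_def)

lemma Phi_trace_preserving: "trace_preserving Phi"
proof -
  have "trace (Phi X) = trace X" for X
  proof -
    have "trace (Phi X) = of_nat CARD(idx) * (trace X / of_nat par_k)"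
      by (simp add: trace_def[of "Phi X"] Phi_diag)
    then show ?thesis unfolding CARD_idx using par_k_ge_1 by simp
  qed
  then show ?thesis by (simp add: trace_preserving_def)
qed

lemma Phi_quantum_channel: "quantum_channel Phi"
  using Phi_kraus Phi_trace_preserving kraus_linear kraus_completely_positive
  unfolding quantum_channel_def by blast

lemma tensor_Phi_density:
  assumes "density Z"
  shows "density (tensor_map Phi Phi Z)"
  using assms Phi_kraus tensor_map_psd tensor_map_trace[OF Phi_trace_preserving Phi_trace_preserving]
  unfolding density_def by metis

subsection \<open>The damped operators\<close>

lemma matpow_Suc_vec: "matpow B (Suc n) *v v = B *v (matpow B n *v v)"
  by (simp add: matpow_Suc_left matrix_vector_mul_assoc)

text \<open>The norms \<open>\<parallel>B\<^sup>s v\<parallel>\<close> are log-convex in \<open>s\<close>, so \<open>\<parallel>B v\<parallel> \<le> max \<parallel>v\<parallel> \<parallel>B\<^sup>m v\<parallel>\<close>.\<close>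

lemma hermitian_le_one_plus_power:
  fixes B :: "complex^'n^'n"
  assumes B: "hermitian B" and m: "0 < m"
  shows "inner v (B *v v) \<le> inner v v + inner v (matpow B (2 * m) *v v)"
proof -
  define n where "n s = norm (matpow B s *v v)" for s
  have sym: "inner x (matpow B s *v y) = inner (matpow B s *v x) y" for x y s
    using inner_cadj[of x "matpow B s" y] by (simp add: hermitian_matpow[OF B])
  have n0: "n 0 = norm v" by (simp add: n_def matpow_def)
  have conv: "(n (Suc s))\<^sup>2 \<le> n s * n (Suc (Suc s))" for s
  proof -
    have "(n (Suc s))\<^sup>2 = inner (B *v (matpow B s *v v)) (matpow B (Suc s) *v v)"
      by (simp only: n_def power2_norm_eq_inner matpow_Suc_vec)
    also have "\<dots> = inner (matpow B s *v v) (matpow B (Suc (Suc s)) *v v)"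
      by (simp only: matpow_Suc_vec inner_matrix_hermitian[OF B])
    also have "\<dots> \<le> n s * n (Suc (Suc s))" unfolding n_def by (rule norm_cauchy_schwarz)
    finally show ?thesis .
  qed
  have last: "inner v (matpow B (2 * m) *v v) = (n m)\<^sup>2"
    by (simp add: mult_2 matpow_add sym n_def power2_norm_eq_inner flip: matrix_vector_mul_assoc)
  have "inner v (B *v v) \<le> norm v * norm (B *v v)" by (rule norm_cauchy_schwarz)
  also have "\<dots> = n 0 * n 1" by (simp add: n0) (simp add: n_def matpow_def)
  also have "\<dots> \<le> (n 0)\<^sup>2 + (n m)\<^sup>2"
  proof (cases "n 1 \<le> n 0")
    case True
    then have "n 0 * n 1 \<le> n 0 * n 0" by (intro mult_left_mono) (auto simp: n_def)
    then show ?thesis by (simp add: power2_eq_square add_increasing2)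
  next
    case False
    \<comment> \<open>Once the first step increases the norm, log-convexity keeps the whole sequence
      increasing, so \<open>n 0\<close> and \<open>n 1\<close> are both at most
      \<open>n m\<close>.\<close>
    have inc: "0 < n (Suc s) \<and> n s \<le> n (Suc s)" for s
    proof (induction s)
      case 0
      show ?case using False norm_ge_zero[of v] by (simp flip: n0)
    next
      case (Suc s)
      have "n (Suc s) * n (Suc s) \<le> n s * n (Suc (Suc s))" using conv[of s] by (simp add: power2_eq_square)
      also have "\<dots> \<le> n (Suc s) * n (Suc (Suc s))"
        using Suc by (intro mult_right_mono) (auto simp: n_def)
      finally have "n (Suc s) \<le> n (Suc (Suc s))" using Suc by simp
      then show ?case using Suc by simp
    qed
    have "mono n" using inc by (simp add: mono_iff_le_Suc)
    then have "n 1 \<le> n m" using m by (simp add: mono_def)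
    then have "n 0 * n 1 \<le> n m * n m" using False by (intro mult_mono) (auto simp: n_def)
    then show ?thesis by (simp add: power2_eq_square add_increasing)
  qed
  finally show ?thesis by (simp add: last n0 power2_norm_eq_inner)
qed

lemma finite_Q_set: "finite Q_set"
proof -
  let ?V = "pairs \<rightarrow>\<^sub>E {- int par_eta..int par_eta}"
  have "finite (?V \<times> ?V)" by (intro finite_cartesian_product finite_PiE) auto
  then show ?thesis by (rule finite_subset[rotated]) (auto simp: Q_set_def Let_def)
qed

lemma hermitian_scaled_T: "hermitian ((1 / par_L) *\<^sub>R T_op (A_q q))"
  using hermitian_A_q[of q] by (simp add: hermitian_def cadj_scaleR cadj_T_op)

lemma R_op_summand_le:
  assumes "q \<in> Q_set"
  shows "inner v (matpow ((1 / par_L) *\<^sub>R T_op (A_q q)) (2 * par_m) *v v) \<le> inner v (R_op *v v)"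
proof -
  let ?X = "\<lambda>q. matpow ((1 / par_L) *\<^sub>R T_op (A_q q)) (2 * par_m)"
  have nonneg: "0 \<le> inner v (?X q *v v)" for q
  proof -
    obtain B where B: "cadj B = B" "?X q = B ** B" by (rule R_op_summand)
    have "inner v (?X q *v v) = inner (B *v v) (B *v v)"
      by (simp add: B inner_cadj flip: matrix_vector_mul_assoc)
    then show ?thesis by simp
  qed
  have "inner v (R_op *v v) = (\<Sum>q\<in>Q_set. inner v (?X q *v v))"
    by (simp add: R_op_def sum_matrix_vector_mult inner_sum_right)
  then show ?thesis using member_le_sum[OF assms, of "\<lambda>q. inner v (?X q *v v)"] nonneg finite_Q_set
    by simp
qed

text \<open>With f = F v, the form of T at f is at most L times the form of 1 + R at f. But (1 + R)
  f = v, so this is L times \<open>inner f v\<close>, and F is a contraction.\<close>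

lemma damped_T_le:
  assumes "q \<in> Q_set"
  shows "inner v ((F_op ** T_op (A_q q) ** F_op) *v v) \<le> par_L * inner v v"
proof -
  let ?T = "T_op (A_q q)" and ?f = "F_op *v v"
  have m: "0 < par_m" by (simp add: par_m_def par_r_def par_k_def)
  have scale: "((1 / par_L) *\<^sub>R ?T) *v ?f = (1 / par_L) *\<^sub>R (?T *v ?f)"
    by (simp add: vec_eq_iff matrix_vector_mult_def scaleR_right.sum)
  have L: "par_L > 0" by (simp add: par_L_def)
  have "inner v ((F_op ** ?T ** F_op) *v v) = inner ?f (?T *v ?f)"
    using inner_matrix_hermitian[OF hermitian_F, of v "?T *v ?f"]
    by (simp flip: matrix_vector_mul_assoc)
  also have "\<dots> = par_L * inner ?f (((1 / par_L) *\<^sub>R ?T) *v ?f)"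
    unfolding scale using L by simp
  also have "\<dots> \<le> par_L * (inner ?f ?f + inner ?f (R_op *v ?f))"
    using hermitian_le_one_plus_power[OF hermitian_scaled_T m, of ?f q] R_op_summand_le[OF assms, of ?f] L
    by (intro mult_left_mono) auto
  also have "inner ?f ?f + inner ?f (R_op *v ?f) = inner ?f v"
    using F_vec_add[of v] by (metis inner_add_right)
  also have "inner ?f v \<le> norm ?f * norm v" by (rule norm_cauchy_schwarz)
  also have "norm ?f * norm v \<le> norm v * norm v" by (intro mult_right_mono norm_F_le) simp
  also have "norm v * norm v = inner v v" by (simp add: dot_square_norm power2_eq_square)
  finally show ?thesis using L by (simp add: mult_left_mono)
qed

lemma trace_density_le:
  fixes B :: "complex^'n^'n"
  assumes "density \<rho>" and B: "\<And>v. inner v (B *v v) \<le> c * inner v v"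
  shows "Re (trace (B ** \<rho>)) \<le> c"
proof -
  obtain C :: "complex^'n^'n" where C: "\<rho> = C ** cadj C"
    using psd_factor assms(1) unfolding density_def by blast
  have tr: "Re (trace (X ** \<rho>)) = (\<Sum>i\<in>UNIV. inner (C *v axis i 1) (X *v (C *v axis i 1)))" for X
  proof -
    have "trace (X ** \<rho>) = trace ((X ** C) ** cadj C)" unfolding C by (simp only: matrix_mul_assoc)
    also have "\<dots> = trace (cadj C ** (X ** C))" by (rule trace_mul_sym)
    also have "\<dots> = (\<Sum>i\<in>UNIV. cinner (axis i 1) ((cadj C ** (X ** C)) *v axis i 1))"
      by (simp add: trace_def cinner_axis matrix_vector_mult_axis_nth)
    also have "\<dots> = (\<Sum>i\<in>UNIV. cinner (C *v axis i 1) (X *v (C *v axis i 1)))"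
      by (simp only: matrix_vector_mul_assoc[symmetric] cinner_adj cadj_cadj)
    finally show ?thesis by (simp add: inner_Re_cinner)
  qed
  have "Re (trace (B ** \<rho>)) \<le> (\<Sum>i\<in>UNIV. c * inner (C *v axis i 1) (C *v axis i 1))"
    unfolding tr by (intro sum_mono B)
  also have "\<dots> = c * Re (trace (mat 1 ** \<rho>))" unfolding tr by (simp add: sum_distrib_left)
  also have "\<dots> = c" using assms(1) by (simp add: density_def)
  finally show ?thesis .
qed

subsection \<open>Rounding to the integer vectors\<close>

text \<open>Round the unit vector w / N scaled by \<eta> = 64 k. Each coordinate errs by at most
  1/2, so the total error E is at most k / 2 = \<eta> / 128. The pairing with the unit vector is at
  least \<eta> - E and the length at most \<eta> + E, whence the ratio 127 / 129.\<close>

lemma rounding_direction: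
  fixes w :: "'a \<Rightarrow> real" and k :: nat
  assumes I: "finite I" "card I \<le> k\<^sup>2" and k: "0 < k" and N: "N = sqrt (\<Sum>i\<in>I. (w i)\<^sup>2)" "0 < N"
  obtains z :: "'a \<Rightarrow> int" where "\<And>i. i \<in> I \<Longrightarrow> \<bar>z i\<bar> \<le> int (64 * k)" "\<exists>i\<in>I. z i \<noteq> 0"
    "127 / 129 * N * sqrt (\<Sum>i\<in>I. (real_of_int (z i))\<^sup>2) \<le> (\<Sum>i\<in>I. real_of_int (z i) * w i)"
proof
  define \<eta> where "\<eta> = real (64 * k)"
  define v where "v i = w i / N" for i
  define z where "z i = round (\<eta> * v i)" for i
  define e where "e i = real_of_int (z i) - \<eta> * v i" for i
  define E where "E = L2_set e I"
  have \<eta>: "\<eta> > 0" using k by (simp add: \<eta>_def)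
  have w2: "(\<Sum>i\<in>I. (w i)\<^sup>2) = N\<^sup>2" by (simp add: N(1) sum_nonneg)
  have v2: "(\<Sum>i\<in>I. (v i)\<^sup>2) = 1"
    using N(2) w2 by (simp add: v_def power_divide flip: sum_divide_distrib)
  have vL: "L2_set v I = 1" by (simp add: L2_set_def v2)
  show "\<bar>z i\<bar> \<le> int (64 * k)" if "i \<in> I" for i
  proof -
    have "(v i)\<^sup>2 \<le> 1" using member_le_sum[OF that, of "\<lambda>i. (v i)\<^sup>2"] I v2 by simp
    then have "\<bar>v i\<bar> \<le> 1" by (simp add: abs_square_le_1)
    then have "\<bar>\<eta> * v i\<bar> \<le> \<eta>" using \<eta> by (simp add: abs_mult mult_left_le)
    then have "- \<eta> \<le> \<eta> * v i" "\<eta> * v i \<le> \<eta>" by linarith+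
    then have "round (- \<eta>) \<le> z i" "z i \<le> round \<eta>" unfolding z_def by (auto intro: round_mono)
    moreover have "round \<eta> = int (64 * k)" "round (- \<eta>) = - int (64 * k)"
      unfolding \<eta>_def by (metis round_of_nat, metis of_int_minus of_int_of_nat_eq round_of_int)
    ultimately show ?thesis by simp
  qed
  have "(e i)\<^sup>2 \<le> (1 / 2)\<^sup>2" for i
  proof -
    have "\<bar>e i\<bar> \<le> 1 / 2" unfolding e_def z_def by (rule of_int_round_abs_le)
    then show ?thesis by (metis abs_ge_zero power2_abs power_mono)
  qed
  then have "(\<Sum>i\<in>I. (e i)\<^sup>2) \<le> (\<Sum>i\<in>I. (1 / 2)\<^sup>2)" by (intro sum_mono)
  also have "\<dots> = real (card I) * (1 / 2)\<^sup>2" by simp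
  also have "\<dots> \<le> real (k\<^sup>2) * (1 / 2)\<^sup>2" using I by (intro mult_right_mono of_nat_mono) auto
  also have "\<dots> = (real k / 2)\<^sup>2" by (simp add: power_divide)
  finally have "E \<le> sqrt ((real k / 2)\<^sup>2)" unfolding E_def L2_set_def by (rule real_sqrt_le_mono)
  then have "E \<le> real k / 2" by simp
  then have E: "E \<le> \<eta> / 128" by (simp add: \<eta>_def)
  have E0: "0 \<le> E" by (simp add: E_def)
  have zz: "real_of_int (z i) = \<eta> * v i + e i" for i by (simp add: e_def)
  have "\<bar>\<Sum>i\<in>I. e i * v i\<bar> \<le> (\<Sum>i\<in>I. \<bar>e i\<bar> * \<bar>v i\<bar>)"
    by (rule order_trans[OF sum_abs]) (simp add: abs_mult)
  also have "\<dots> \<le> E * 1" unfolding E_def vL[symmetric] by (rule L2_set_mult_ineq)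
  finally have ev: "- E \<le> (\<Sum>i\<in>I. e i * v i)" by linarith
  have "(\<Sum>i\<in>I. real_of_int (z i) * v i) = \<eta> * (\<Sum>i\<in>I. (v i)\<^sup>2) + (\<Sum>i\<in>I. e i * v i)"
    by (simp add: zz algebra_simps sum.distrib sum_distrib_left power2_eq_square)
  then have lower: "\<eta> - E \<le> (\<Sum>i\<in>I. real_of_int (z i) * v i)" using ev v2 by simp
  have "L2_set (\<lambda>i. real_of_int (z i)) I \<le> L2_set (\<lambda>i. \<eta> * v i) I + E"
    unfolding zz E_def by (rule L2_set_triangle_ineq)
  also have "L2_set (\<lambda>i. \<eta> * v i) I = \<eta>"
    using \<eta> L2_set_right_distrib[of \<eta> v I] by (simp add: vL)
  finally have upper: "sqrt (\<Sum>i\<in>I. (real_of_int (z i))\<^sup>2) \<le> \<eta> + E" by (simp add: L2_set_def)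
  show "\<exists>i\<in>I. z i \<noteq> 0"
  proof (rule ccontr)
    assume "\<not> ?thesis"
    then have "(\<Sum>i\<in>I. real_of_int (z i) * v i) = 0" by (intro sum.neutral) auto
    with lower E \<eta> show False by linarith
  qed
  have "127 / 129 * sqrt (\<Sum>i\<in>I. (real_of_int (z i))\<^sup>2) \<le> (\<Sum>i\<in>I. real_of_int (z i) * v i)"
    using upper lower E by linarith
  then have "N * (127 / 129 * sqrt (\<Sum>i\<in>I. (real_of_int (z i))\<^sup>2)) \<le> N * (\<Sum>i\<in>I. real_of_int (z i) * v i)"
    using N(2) by (intro mult_left_mono) auto
  also have "\<dots> = (\<Sum>i\<in>I. real_of_int (z i) * w i)"
    using N(2) by (simp add: v_def sum_distrib_left)
  finally show "127 / 129 * N * sqrt (\<Sum>i\<in>I. (real_of_int (z i))\<^sup>2) \<le> (\<Sum>i\<in>I. real_of_int (z i) * w i)"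
    by (simp add: mult_ac)
qed

section \<open>Coordinates of the off-diagonal part of a hermitian matrix\<close>

lemma sum_offdiag_pairs:
  fixes G :: "idx \<Rightarrow> idx \<Rightarrow> 'a::comm_monoid_add"
  shows "(\<Sum>i\<in>UNIV. \<Sum>j\<in>UNIV. if i = j then 0 else G i j) = (\<Sum>(a, b)\<in>pairs. G a b + G b a)"
proof -
  let ?P' = "prod.swap ` pairs"
  have fin: "finite pairs" "finite ?P'" by (rule finite_subset[OF subset_UNIV], simp)+
  have disj: "pairs \<inter> ?P' = {}" by (auto simp: pairs_def)
  have un: "pairs \<union> ?P' = {(i, j). i \<noteq> j}"
  proof -
    have "(i, j) \<in> pairs \<union> ?P' \<longleftrightarrow> i \<noteq> j" for i j
      by (auto simp: pairs_def image_iff) (metis Rep_idx_inject linorder_neqE_nat)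
    then show ?thesis by (simp only: set_eq_iff split_paired_All mem_Collect_eq prod.case simp_thms)
  qed
  have "(\<Sum>i\<in>UNIV. \<Sum>j\<in>UNIV. if i = j then 0 else G i j) = (\<Sum>(i, j)\<in>UNIV \<times> UNIV. if i = j then 0 else G i j)"
    by (rule sum.cartesian_product)
  also have "\<dots> = (\<Sum>(i, j)\<in>pairs \<union> ?P'. G i j)"
    unfolding un by (rule sum.mono_neutral_cong_right) auto
  also have "\<dots> = (\<Sum>(i, j)\<in>pairs. G i j) + (\<Sum>(i, j)\<in>?P'. G i j)"
    by (rule sum.union_disjoint[OF fin disj])
  also have "(\<Sum>(i, j)\<in>?P'. G i j) = (\<Sum>(a, b)\<in>pairs. G b a)"
    by (subst sum.reindex) (auto simp: inj_on_def split_beta)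
  finally show ?thesis by (simp add: sum.distrib split_beta)
qed

lemma card_pairs: "2 * card pairs = par_r"
proof -
  have "(\<Sum>i\<in>(UNIV :: idx set). \<Sum>j\<in>(UNIV :: idx set). if i = j then 0 else 1 :: nat) = (\<Sum>(a, b)\<in>pairs. 1 + 1)"
    by (rule sum_offdiag_pairs)
  moreover have "(\<Sum>j\<in>(UNIV :: idx set). if i = j then 0 else 1 :: nat) = par_k - 1" for i
  proof -
    have "(\<Sum>j\<in>(UNIV :: idx set). if i = j then 0 else 1 :: nat) = (\<Sum>j\<in>UNIV - {i}. 1)"
      by (rule sum.mono_neutral_cong_right) auto
    also have "\<dots> = CARD(idx) - 1" by simp
    finally show ?thesis by (simp only: CARD_idx)
  qed
  ultimately have "CARD(idx) * (par_k - 1) = (\<Sum>(a, b)\<in>pairs. 1 + 1)" by simp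
  then show ?thesis unfolding CARD_idx by (simp add: par_r_def)
qed

definition q_norm :: "(idx \<times> idx \<Rightarrow> int) \<times> (idx \<times> idx \<Rightarrow> int) \<Rightarrow> real" where
  "q_norm q = sqrt (\<Sum>p\<in>pairs. (real_of_int (fst q p))\<^sup>2 + (real_of_int (snd q p))\<^sup>2)"

lemma A_q_sum_nth:
  "A_q (x, y) $ i $ j = complex_of_real (1 / q_norm (x, y)) * (\<Sum>(a, b)\<in>pairs.
     complex_of_real (real_of_int (x (a, b))) * E_R a b $ i $ j +
     complex_of_real (real_of_int (y (a, b))) * E_I a b $ i $ j)"
  by (simp add: A_q_def q_norm_def sum_component split_beta scaleR_conv_of_real[where 'a = complex])

lemma E_nth:
  "E_R a b $ i $ j = complex_of_real (1 / sqrt 2) * ((if i = a \<and> j = b then 1 else 0) + (if i = b \<and> j = a then 1 else 0))"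
  "E_I a b $ i $ j = \<i> * complex_of_real (1 / sqrt 2) * ((if i = a \<and> j = b then 1 else 0) - (if i = b \<and> j = a then 1 else 0))"
  by (simp_all add: E_R_def E_I_def cscale_def ketbra_def)

lemma A_q_pair_nth:
  assumes "(a, b) \<in> pairs"
  shows "A_q q $ a $ b = complex_of_real (1 / (sqrt 2 * q_norm q)) *
    Complex (real_of_int (fst q (a, b))) (real_of_int (snd q (a, b)))"
proof -
  obtain x y where q: "q = (x, y)" by (cases q)
  have "(\<Sum>(c, d)\<in>pairs. complex_of_real (real_of_int (x (c, d))) * E_R c d $ a $ b +
     complex_of_real (real_of_int (y (c, d))) * E_I c d $ a $ b)
    = (\<Sum>p\<in>pairs. if p = (a, b) then complex_of_real (1 / sqrt 2) *
        Complex (real_of_int (x (a, b))) (real_of_int (y (a, b))) else 0)"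
  proof (rule sum.cong[OF refl])
    fix p assume p: "p \<in> pairs"
    obtain c d where cd: "p = (c, d)" by (cases p)
    have "Rep_idx a < Rep_idx b" "Rep_idx c < Rep_idx d" using assms p unfolding cd pairs_def by blast+
    then have nd: "(a = d \<and> b = c) = False" by (metis order_less_asym)
    have eq: "(a = c \<and> b = d) = ((c, d) = (a, b))" by auto
    have E: "E_R c d $ a $ b = (if (c, d) = (a, b) then complex_of_real (1 / sqrt 2) else 0)"
      "E_I c d $ a $ b = (if (c, d) = (a, b) then \<i> * complex_of_real (1 / sqrt 2) else 0)"
      unfolding E_nth nd eq by simp_all
    show "(case p of (c, d) \<Rightarrow> complex_of_real (real_of_int (x (c, d))) * E_R c d $ a $ b +
        complex_of_real (real_of_int (y (c, d))) * E_I c d $ a $ b)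
      = (if p = (a, b) then complex_of_real (1 / sqrt 2) *
        Complex (real_of_int (x (a, b))) (real_of_int (y (a, b))) else 0)"
      unfolding cd prod.case E by (simp add: Complex_eq algebra_simps)
  qed
  also have "\<dots> = complex_of_real (1 / sqrt 2) * Complex (real_of_int (x (a, b))) (real_of_int (y (a, b)))"
    using assms by simp
  finally show ?thesis by (simp add: q A_q_sum_nth)
qed

text \<open>The matrices \<open>E_R a b\<close> and \<open>E_I a b\<close> are orthonormal for the
  real trace form; the coordinates of X in them are sqrt 2 times the real and imaginary parts of its
  entries above the diagonal.\<close>

lemma A_q_pairing:
  assumes X: "hermitian X"
  shows "Re (\<Sum>i\<in>UNIV. \<Sum>j\<in>UNIV. if i = j then 0 else A_q q $ i $ j * X $ j $ i)
    = (\<Sum>p\<in>pairs. real_of_int (fst q p) * (sqrt 2 * Re (X $ fst p $ snd p)) +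
        real_of_int (snd q p) * (sqrt 2 * Im (X $ fst p $ snd p))) / q_norm q"
proof -
  have herm: "M $ b $ a = cnj (M $ a $ b)" if "hermitian M" for M :: "complex^idx^idx" and a b
    using that unfolding hermitian_def by (metis cadj_nth)
  have "Re (\<Sum>i\<in>UNIV. \<Sum>j\<in>UNIV. if i = j then 0 else A_q q $ i $ j * X $ j $ i)
      = (\<Sum>(a, b)\<in>pairs. Re (A_q q $ a $ b * X $ b $ a + A_q q $ b $ a * X $ a $ b))"
    by (simp add: sum_offdiag_pairs split_beta)
  also have "\<dots> = (\<Sum>p\<in>pairs. (real_of_int (fst q p) * (sqrt 2 * Re (X $ fst p $ snd p)) +
        real_of_int (snd q p) * (sqrt 2 * Im (X $ fst p $ snd p))) / q_norm q)"
  proof (rule sum.cong[OF refl], clarify)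
    fix a b assume ab: "(a, b) \<in> pairs"
    let ?s = "1 / (sqrt 2 * q_norm q)" and ?x = "real_of_int (fst q (a, b))" and ?y = "real_of_int (snd q (a, b))"
    have "Re (A_q q $ a $ b * X $ b $ a + A_q q $ b $ a * X $ a $ b) = 2 * Re (A_q q $ a $ b * cnj (X $ a $ b))"
      unfolding herm[OF X, of b a] herm[OF hermitian_A_q[of q], of b a] by simp
    also have "A_q q $ a $ b * cnj (X $ a $ b) = complex_of_real ?s * (Complex ?x ?y * cnj (X $ a $ b))"
      unfolding A_q_pair_nth[OF ab] by (rule mult.assoc)
    also have "Re \<dots> = ?s * (?x * Re (X $ a $ b) + ?y * Im (X $ a $ b))"
      by (simp only: Re_complex_of_real Im_complex_of_real times_complex.sel complex.sel complex_cnj) simp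
    also have "2 * \<dots> = (2 * ?s) * (?x * Re (X $ a $ b) + ?y * Im (X $ a $ b))"
      by (rule mult.assoc[symmetric])
    also have "2 * ?s = sqrt 2 / q_norm q" by (simp add: real_div_sqrt flip: divide_divide_eq_left)
    finally show "Re (A_q q $ a $ b * X $ b $ a + A_q q $ b $ a * X $ a $ b)
        = (real_of_int (fst q (a, b)) * (sqrt 2 * Re (X $ fst (a, b) $ snd (a, b))) +
        real_of_int (snd q (a, b)) * (sqrt 2 * Im (X $ fst (a, b) $ snd (a, b)))) / q_norm q"
      by (simp add: algebra_simps add_divide_distrib)
  qed
  finally show ?thesis by (simp only: sum_divide_distrib)
qed

lemma offdiag_norm_pairs:
  assumes X: "hermitian X"
  shows "(\<Sum>i\<in>UNIV. \<Sum>j\<in>UNIV. if i = j then 0 else (norm (X $ i $ j))\<^sup>2)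
    = (\<Sum>p\<in>pairs. (sqrt 2 * Re (X $ fst p $ snd p))\<^sup>2 + (sqrt 2 * Im (X $ fst p $ snd p))\<^sup>2)"
proof -
  have "norm (X $ b $ a) = norm (X $ a $ b)" for a b
    using X unfolding hermitian_def by (metis cadj_nth complex_mod_cnj)
  then show ?thesis
    unfolding sum_offdiag_pairs split_beta
    by (intro sum.cong refl) (simp add: cmod_power2 power_mult_distrib)
qed

lemma A_q_diag: "A_q q $ i $ i = 0"
proof -
  obtain x y where q: "q = (x, y)" by (cases q)
  have "(\<Sum>(a, b)\<in>pairs. complex_of_real (real_of_int (x (a, b))) * E_R a b $ i $ i +
     complex_of_real (real_of_int (y (a, b))) * E_I a b $ i $ i) = 0"
    by (rule sum.neutral) (auto simp: E_nth pairs_def)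
  then show ?thesis by (simp add: q A_q_sum_nth)
qed

lemma A_q_norm_le: "(\<Sum>i\<in>UNIV. \<Sum>j\<in>UNIV. (norm (A_q q $ i $ j))\<^sup>2) \<le> 1"
proof -
  have n: "(q_norm q)\<^sup>2 = (\<Sum>p\<in>pairs. (real_of_int (fst q p))\<^sup>2 + (real_of_int (snd q p))\<^sup>2)"
    by (simp add: q_norm_def sum_nonneg)
  have "(\<Sum>i\<in>UNIV. \<Sum>j\<in>UNIV. (norm (A_q q $ i $ j))\<^sup>2)
      = (\<Sum>i\<in>UNIV. \<Sum>j\<in>UNIV. if i = j then 0 else (norm (A_q q $ i $ j))\<^sup>2)"
    by (intro sum.cong refl) (auto simp: A_q_diag)
  also have "\<dots> = (\<Sum>p\<in>pairs. (sqrt 2 * Re (A_q q $ fst p $ snd p))\<^sup>2 + (sqrt 2 * Im (A_q q $ fst p $ snd p))\<^sup>2)"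
    by (rule offdiag_norm_pairs[OF hermitian_A_q])
  also have "\<dots> = (\<Sum>p\<in>pairs. ((real_of_int (fst q p))\<^sup>2 + (real_of_int (snd q p))\<^sup>2) / (q_norm q)\<^sup>2)"
  proof (rule sum.cong[OF refl], clarify)
    fix a b assume ab: "(a, b) \<in> pairs"
    show "(sqrt 2 * Re (A_q q $ fst (a, b) $ snd (a, b)))\<^sup>2 + (sqrt 2 * Im (A_q q $ fst (a, b) $ snd (a, b)))\<^sup>2
        = ((real_of_int (fst q (a, b)))\<^sup>2 + (real_of_int (snd q (a, b)))\<^sup>2) / (q_norm q)\<^sup>2"
      by (simp add: A_q_pair_nth[OF ab] power_mult_distrib power_divide add_divide_distrib)
  qed
  also have "\<dots> = (q_norm q)\<^sup>2 / (q_norm q)\<^sup>2" by (simp only: sum_divide_distrib[symmetric] n[symmetric])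
  \<comment> \<open>Equality fails when \<open>q_norm q = 0\<close>: division by 0 then yields
    0.\<close>
  also have "\<dots> \<le> 1" by simp
  finally show ?thesis .
qed

section \<open>The off-diagonal part of a channel output\<close>

lemma Phi_offdiag:
  assumes "i \<noteq> j"
  shows "Phi \<rho> $ j $ i = trace (cadj (U i) ** U j ** (F_op ** \<rho> ** F_op)) / of_nat par_k"
proof -
  have "trace (U j ** F_op ** \<rho> ** F_op ** cadj (U i)) = trace (cadj (U i) ** (U j ** F_op ** \<rho> ** F_op))"
    by (rule trace_mul_sym)
  also have "\<dots> = trace (cadj (U i) ** U j ** (F_op ** \<rho> ** F_op))" by (simp only: matrix_mul_assoc)
  finally show ?thesis using assms by (simp add: Phi_def)
qed

lemma trace_T_op:
  "trace (T_op A ** M) = (\<Sum>i\<in>UNIV. \<Sum>j\<in>UNIV. if i = j then 0 else A $ i $ j * trace (cadj (U i) ** U j ** M))"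
proof -
  have "trace (T_op A ** M) = (\<Sum>(i, j)\<in>{(i, j). i \<noteq> j}. A $ i $ j * trace (cadj (U i) ** U j ** M))"
    unfolding T_op_def sum_matrix_mult trace_sum
    by (simp add: split_beta cscale_matrix_mult trace_cscale)
  also have "\<dots> = (\<Sum>(i, j)\<in>UNIV \<times> UNIV. if i = j then 0 else A $ i $ j * trace (cadj (U i) ** U j ** M))"
    by (rule sum.mono_neutral_cong_left) auto
  finally show ?thesis by (simp only: sum.cartesian_product)
qed

lemma Phi_pairing_le:
  assumes "density \<rho>" "q \<in> Q_set"
  shows "Re (\<Sum>i\<in>UNIV. \<Sum>j\<in>UNIV. if i = j then 0 else A_q q $ i $ j * Phi \<rho> $ j $ i) \<le> par_L / real par_k"
proof -
  let ?T = "T_op (A_q q)"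
  have "(\<Sum>i\<in>UNIV. \<Sum>j\<in>UNIV. if i = j then 0 else A_q q $ i $ j * Phi \<rho> $ j $ i)
      = trace (?T ** (F_op ** \<rho> ** F_op)) / of_nat par_k"
    unfolding trace_T_op sum_divide_distrib
    by (intro sum.cong refl) (simp add: Phi_offdiag)
  also have "trace (?T ** (F_op ** \<rho> ** F_op)) = trace (F_op ** ?T ** F_op ** \<rho>)"
    using trace_mul_sym[of "?T ** F_op ** \<rho>" F_op] by (simp only: matrix_mul_assoc)
  finally have "Re (\<Sum>i\<in>UNIV. \<Sum>j\<in>UNIV. if i = j then 0 else A_q q $ i $ j * Phi \<rho> $ j $ i)
      = Re (trace (F_op ** ?T ** F_op ** \<rho>)) / real par_k"
    by (metis Re_divide_of_real of_real_of_nat_eq)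
  also have "\<dots> \<le> par_L / real par_k"
    by (intro divide_right_mono trace_density_le[OF assms(1)] damped_T_le[OF assms(2)]) auto
  finally show ?thesis .
qed

lemma Phi_density:
  assumes "density \<rho>"
  shows "density (Phi \<rho>)"
  using Phi_kraus kraus_density[OF _ Phi_trace_preserving assms] by blast

text \<open>The direction \<open>q\<close> is chosen after the output, by rounding the output's own
  coordinate vector \<open>w\<close>. Its pairing with the output then captures at least 127 / 129
  of the norm and is at most L / k.\<close>

lemma Phi_offdiag_norm_le:
  assumes "density \<rho>"
  shows "(\<Sum>i\<in>UNIV. \<Sum>j\<in>UNIV. if i = j then 0 else (norm (Phi \<rho> $ i $ j))\<^sup>2)
    \<le> (129 / 127 * par_L / real par_k)\<^sup>2"
proof -
  let ?X = "Phi \<rho>" and ?I = "pairs \<times> (UNIV :: bool set)"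
  have herm: "hermitian ?X" using Phi_density[OF assms] by (simp add: density_def psd_hermitian)
  \<comment> \<open>The boolean selects the imaginary or the real coordinate, which merges both
    halves of the integer vector into one family with \<open>par_r\<close> members.\<close>
  define w where "w = (\<lambda>(p, c). sqrt 2 * (if c then Im (?X $ fst p $ snd p) else Re (?X $ fst p $ snd p)))"
  have sumI: "(\<Sum>i\<in>?I. G i) = (\<Sum>p\<in>pairs. G (p, False) + G (p, True))" for G :: "_ \<Rightarrow> real"
    by (simp add: sum.cartesian_product' UNIV_bool)
  define N where "N = sqrt (\<Sum>i\<in>?I. (w i)\<^sup>2)"
  have N2: "N\<^sup>2 = (\<Sum>i\<in>UNIV. \<Sum>j\<in>UNIV. if i = j then 0 else (norm (?X $ i $ j))\<^sup>2)"
    unfolding offdiag_norm_pairs[OF herm] by (simp add: N_def sum_nonneg sumI w_def)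
  have N0: "0 \<le> N" by (simp add: N_def sum_nonneg)
  have "N \<le> 129 / 127 * par_L / real par_k"
  proof (cases "N = 0")
    case True
    then show ?thesis by (simp add: par_L_def)
  next
    case False
    with N0 have Npos: "0 < N" by simp
    have fin: "finite ?I" by (rule finite_subset[OF subset_UNIV]) simp
    have "card ?I = par_r" using card_pairs by (simp add: card_cartesian_product)
    then have card: "card ?I \<le> par_k\<^sup>2" by (simp add: par_r_def power2_eq_square)
    have k: "0 < par_k" using par_k_ge_1 by simp
    obtain z where z: "\<And>i. i \<in> ?I \<Longrightarrow> \<bar>z i\<bar> \<le> int (64 * par_k)" "\<exists>i\<in>?I. z i \<noteq> 0"
      "127 / 129 * N * sqrt (\<Sum>i\<in>?I. (real_of_int (z i))\<^sup>2) \<le> (\<Sum>i\<in>?I. real_of_int (z i) * w i)"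
      using rounding_direction[OF fin card k N_def Npos] by blast
    define x where "x = restrict (\<lambda>p. z (p, False)) pairs"
    define y where "y = restrict (\<lambda>p. z (p, True)) pairs"
    let ?q = "(x, y)"
    have "\<bar>z (p, c)\<bar> \<le> int par_eta" if "p \<in> pairs" for p c
      using z(1)[of "(p, c)"] that by (simp add: par_eta_def)
    then have "x \<in> pairs \<rightarrow>\<^sub>E {- int par_eta..int par_eta}" "y \<in> pairs \<rightarrow>\<^sub>E {- int par_eta..int par_eta}"
      unfolding x_def y_def by (auto simp: abs_le_iff minus_le_iff)
    moreover have "\<not> (\<forall>p\<in>pairs. x p = 0 \<and> y p = 0)"
    proof -
      obtain p c where "p \<in> pairs" "z (p, c) \<noteq> 0" using z(2) by auto
      then show ?thesis by (cases c) (auto simp: x_def y_def)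
    qed
    ultimately have q: "?q \<in> Q_set" by (simp add: Q_set_def Let_def)
    have qn: "sqrt (\<Sum>i\<in>?I. (real_of_int (z i))\<^sup>2) = q_norm ?q"
      by (simp add: q_norm_def sumI x_def y_def)
    have "0 < (\<Sum>i\<in>?I. (real_of_int (z i))\<^sup>2)"
      using z(2) fin by (auto intro!: sum_pos2)
    then have qpos: "0 < q_norm ?q" by (simp flip: qn)
    have "(\<Sum>i\<in>?I. real_of_int (z i) * w i) = (\<Sum>p\<in>pairs. real_of_int (fst ?q p) * (sqrt 2 * Re (?X $ fst p $ snd p)) +
        real_of_int (snd ?q p) * (sqrt 2 * Im (?X $ fst p $ snd p)))"
      by (simp add: sumI x_def y_def w_def)
    also have "\<dots> = q_norm ?q * Re (\<Sum>i\<in>UNIV. \<Sum>j\<in>UNIV. if i = j then 0 else A_q ?q $ i $ j * ?X $ j $ i)"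
      unfolding A_q_pairing[OF herm] using qpos by simp
    also have "\<dots> \<le> q_norm ?q * (par_L / real par_k)"
      using qpos by (intro mult_left_mono Phi_pairing_le[OF assms q]) auto
    finally have upper: "(\<Sum>i\<in>?I. real_of_int (z i) * w i) \<le> q_norm ?q * (par_L / real par_k)" .
    have "q_norm ?q * (127 / 129 * N) = 127 / 129 * N * q_norm ?q" by simp
    also note z(3)[unfolded qn]
    also note upper
    finally have "q_norm ?q * (127 / 129 * N) \<le> q_norm ?q * (par_L / real par_k)" .
    then have "127 / 129 * N \<le> par_L / real par_k" by (rule mult_left_le_imp_le[OF _ qpos])
    then have "N \<le> 129 / 127 * (par_L / real par_k)" by linarith
    then show ?thesis by simp
  qed
  then have "N\<^sup>2 \<le> (129 / 127 * par_L / real par_k)\<^sup>2" using N0 by (rule power_mono)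
  then show ?thesis by (simp only: N2)
qed

text \<open>The constant diagonal contributes exactly 1 / k to the purity; after multiplication by k
  this cancels the + 1 in the purity bound, leaving only the off-diagonal loss.\<close>

lemma entropy_Phi_ge:
  assumes "density \<rho>"
  shows "ln (real par_k) - (129 / 127 * par_L)\<^sup>2 / real par_k \<le> entropy (Phi \<rho>)"
proof -
  let ?k = "real par_k"
  have k: "0 < ?k" using par_k_ge_1 by simp
  have tr: "trace \<rho> = 1" using assms by (simp add: density_def)
  have "(norm (Phi \<rho>))\<^sup>2 = (\<Sum>i\<in>UNIV. \<Sum>j\<in>UNIV. (if j = i then (norm (Phi \<rho> $ i $ i))\<^sup>2 else 0) +
      (if i = j then 0 else (norm (Phi \<rho> $ i $ j))\<^sup>2))"
    unfolding norm_matrix_power2 by (intro sum.cong refl) auto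
  also have "\<dots> = (\<Sum>i\<in>(UNIV :: idx set). (1 / ?k)\<^sup>2)
      + (\<Sum>i\<in>UNIV. \<Sum>j\<in>UNIV. if i = j then 0 else (norm (Phi \<rho> $ i $ j))\<^sup>2)"
    by (simp add: sum.distrib Phi_diag tr norm_divide)
  also have "(\<Sum>i\<in>(UNIV :: idx set). (1 / ?k)\<^sup>2) = real CARD(idx) * (1 / ?k)\<^sup>2" by simp
  also have "\<dots> = 1 / ?k" unfolding CARD_idx using k by (simp add: power2_eq_square)
  finally have "(norm (Phi \<rho>))\<^sup>2 \<le> 1 / ?k + (129 / 127 * par_L / ?k)\<^sup>2"
    using Phi_offdiag_norm_le[OF assms] by simp
  then have "?k * (norm (Phi \<rho>))\<^sup>2 \<le> ?k * (1 / ?k + (129 / 127 * par_L / ?k)\<^sup>2)"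
    using k by (intro mult_left_mono) auto
  also have "\<dots> = 1 + (129 / 127 * par_L)\<^sup>2 / ?k"
    using k by (simp add: field_simps power2_eq_square)
  finally show ?thesis
    using entropy_ge_purity[OF Phi_density[OF assms]] unfolding CARD_idx by linarith
qed

subsection \<open>The trace of the damping term\<close>

lemma matpow_scaleR: "matpow (c *\<^sub>R A) n = c ^ n *\<^sub>R matpow A n" for A :: "complex^'n^'n"
proof (induction n)
  case (Suc n)
  have "(c *\<^sub>R A) ** (e *\<^sub>R B) = (c * e) *\<^sub>R (A ** B)" for e and B :: "complex^'n^'n"
    by (simp add: vec_eq_iff matrix_matrix_mult_def scaleR_right.sum mult.commute[of e c])
  with Suc show ?case by (simp add: matpow_Suc_left)
qed (simp add: matpow_def)

text \<open>An upper bound for the normalised trace of \<open>R_op\<close>; 24 / 25 is 3 /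
  L.\<close>

definition trace_bound :: real where
  "trace_bound = real (card Q_set) * (24 / 25) ^ (2 * par_m)"

lemma trace_R_le: "Re (trace R_op) \<le> real CARD(sl2) * trace_bound"
proof -
  have "norm (matpow ((1 / par_L) *\<^sub>R T_op (A_q q)) (2 * par_m) $ g $ g) \<le> (24 / 25) ^ (2 * par_m)" for q g
  proof -
    have "norm (matpow ((1 / par_L) *\<^sub>R T_op (A_q q)) (2 * par_m) $ g $ g)
        = (1 / par_L) ^ (2 * par_m) * norm (matpow (T_op (A_q q)) (2 * par_m) $ g $ g)"
      by (simp add: matpow_scaleR par_L_def)
    also have "\<dots> \<le> (1 / par_L) ^ (2 * par_m) * 3 ^ (2 * par_m)"
      by (intro mult_left_mono T_op_moment A_q_norm_le zero_le_power) (simp add: par_L_def)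
    also have "\<dots> = (1 / par_L * 3) ^ (2 * par_m)" by (rule power_mult_distrib[symmetric])
    also have "1 / par_L * 3 = 24 / 25" by (simp add: par_L_def)
    finally show ?thesis .
  qed
  then have 1: "Re (matpow ((1 / par_L) *\<^sub>R T_op (A_q q)) (2 * par_m) $ g $ g) \<le> (24 / 25) ^ (2 * par_m)" for q g
    using complex_Re_le_cmod order_trans by blast
  have "Re (trace R_op) = (\<Sum>q\<in>Q_set. \<Sum>g\<in>UNIV. Re (matpow ((1 / par_L) *\<^sub>R T_op (A_q q)) (2 * par_m) $ g $ g))"
    unfolding R_op_def trace_sum Re_sum by (simp only: trace_def Re_sum)
  also have "\<dots> \<le> (\<Sum>q\<in>Q_set. \<Sum>g\<in>(UNIV :: sl2 set). (24 / 25) ^ (2 * par_m))"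
    by (intro sum_mono 1)
  also have "\<dots> = real CARD(sl2) * trace_bound"
    unfolding trace_bound_def by (simp only: sum_constant mult.assoc mult.left_commute of_nat_mult)
  finally show ?thesis .
qed

lemma card_Q_set_le: "card Q_set \<le> (2 * par_eta + 1) ^ par_r"
proof -
  let ?V = "pairs \<rightarrow>\<^sub>E {- int par_eta..int par_eta}"
  have fin: "finite pairs" by (rule finite_subset[OF subset_UNIV]) simp
  have "card {- int par_eta..int par_eta} = 2 * par_eta + 1"
    by (simp only: card_atLeastAtMost_int)
  then have V: "card ?V = (2 * par_eta + 1) ^ card pairs"
    unfolding card_PiE[OF fin] by (simp only: prod_constant)
  have "card Q_set \<le> card (?V \<times> ?V)"
    by (rule card_mono) (auto simp: Q_set_def Let_def intro!: finite_PiE fin)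
  also have "\<dots> = (2 * par_eta + 1) ^ par_r"
    by (simp only: card_cartesian_product V power_add[symmetric] mult_2[symmetric] card_pairs)
  finally show ?thesis .
qed

lemma trace_bound_small: "0 \<le> trace_bound" "trace_bound \<le> (1 / 4096)\<^sup>2"
proof -
  show "0 \<le> trace_bound" by (simp add: trace_bound_def)
  \<comment> \<open>Per coordinate of \<open>q\<close>: there are 2 \<eta> + 1 = 2^39 + 1 values,
    against the factor (24 / 25)^700 coming from \<open>2 * par_m = 700 * par_r\<close>. The
    multiplier 350 in \<open>par_m\<close> makes the product less than 1.\<close>
  have base: "(2 ^ 39 + 1) * (24 / 25) ^ 700 \<le> (1 / 4 :: real)"
  proof -
    have "(24 / 25 :: real) ^ 35 \<le> 23963 / 100000" by (simp add: power_divide)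
    then have "((24 / 25 :: real) ^ 35) ^ 20 \<le> (23963 / 100000) ^ 20" by (intro power_mono) auto
    also have "((24 / 25 :: real) ^ 35) ^ 20 = (24 / 25) ^ 700" by (simp flip: power_mult)
    finally have "(2 ^ 39 + 1) * (24 / 25 :: real) ^ 700 \<le> (2 ^ 39 + 1) * (23963 / 100000) ^ 20" by simp
    also have "\<dots> \<le> 1 / 4" by (simp add: power_divide)
    finally show ?thesis .
  qed
  have eta: "real (2 * par_eta + 1) = 2 ^ 39 + 1" by (simp add: par_eta_def par_k_def)
  have m: "2 * par_m = 700 * par_r" by (simp add: par_m_def)
  have r: "12 \<le> par_r" by (simp add: par_r_def par_k_def)
  have "trace_bound \<le> real ((2 * par_eta + 1) ^ par_r) * (24 / 25) ^ (2 * par_m)"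
    unfolding trace_bound_def by (intro mult_right_mono of_nat_mono card_Q_set_le) auto
  also have "\<dots> = (2 ^ 39 + 1) ^ par_r * ((24 / 25) ^ 700) ^ par_r"
    by (simp only: of_nat_power eta m power_mult)
  also have "\<dots> = ((2 ^ 39 + 1) * (24 / 25) ^ 700) ^ par_r" by (rule power_mult_distrib[symmetric])
  also have "\<dots> \<le> (1 / 4) ^ par_r" using base by (intro power_mono) auto
  also have "\<dots> \<le> (1 / 4) ^ 12" by (intro power_decreasing r) auto
  also have "\<dots> = (1 / 4096 :: real)\<^sup>2" by (simp add: power_divide)
  finally show "trace_bound \<le> (1 / 4096)\<^sup>2" .
qed

subsection \<open>The damping is close to the identity\<close>

lemma norm_cadj: "norm (cadj A) = norm A" for A :: "complex^'n^'m"
proof -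
  have "(norm (cadj A))\<^sup>2 = (norm A)\<^sup>2"
    unfolding norm_matrix_power2 by (subst sum.swap) (simp add: cadj_nth)
  then show ?thesis by simp
qed

lemma norm_matrix_columns: "(norm A)\<^sup>2 = (\<Sum>j\<in>UNIV. (norm (A *v axis j 1))\<^sup>2)" for A :: "complex^'n^'m"
proof -
  have "(norm A)\<^sup>2 = (\<Sum>j\<in>UNIV. \<Sum>i\<in>UNIV. (norm (A $ i $ j))\<^sup>2)"
    unfolding norm_matrix_power2 by (rule sum.swap)
  also have "\<dots> = (\<Sum>j\<in>UNIV. (norm (A *v axis j 1))\<^sup>2)"
    by (simp add: norm_vec_def[of "A *v _"] L2_set_def sum_nonneg matrix_vector_mult_axis_nth)
  finally show ?thesis .
qed

lemma norm_mult_contraction: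
  fixes B :: "complex^'n^'m" and C :: "complex^'l^'n"
  assumes "\<And>v. norm (B *v v) \<le> norm v"
  shows "norm (B ** C) \<le> norm C"
proof -
  have "(norm (B ** C))\<^sup>2 \<le> (norm C)\<^sup>2"
    unfolding norm_matrix_columns
    by (intro sum_mono power_mono) (simp_all add: assms flip: matrix_vector_mul_assoc)
  then show ?thesis by (rule power2_le_imp_le) simp
qed

lemma norm_one_minus_F: "(norm (mat 1 - F_op))\<^sup>2 \<le> real CARD(sl2) * trace_bound"
proof -
  have "(norm ((mat 1 - F_op) *v v))\<^sup>2 \<le> inner v (R_op *v v)" for v
  proof -
    let ?f = "F_op *v v"
    let ?u = "R_op *v ?f"
    have "(mat 1 - F_op) *v v = ?u"
      using F_vec_add[of v] by (simp add: matrix_vector_mult_diff_rdistrib_complex) (metis add_diff_cancel_left')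
    \<comment> \<open>On eigenvalues r of R this reads r^2 / (1 + r)^2 \<le> r. Summed over the
      standard basis it bounds the squared Hilbert-Schmidt norm of 1 - F by the trace of R.\<close>
    moreover have "inner ?u ?u \<le> inner (?f + ?u) (R_op *v (?f + ?u))"
    proof -
      have "inner (?f + ?u) (R_op *v (?f + ?u))
          = inner ?f ?u + inner ?f (R_op *v ?u) + inner ?u ?u + inner ?u (R_op *v ?u)"
        by (simp only: matrix_vector_right_distrib inner_add_left inner_add_right add.assoc)
      also have "inner ?f (R_op *v ?u) = inner ?u ?u" by (rule inner_matrix_hermitian[OF hermitian_R_op])
      finally show ?thesis using R_op_nonneg[of ?f] R_op_nonneg[of ?u] inner_ge_zero[of ?u] by linarith
    qed
    ultimately show ?thesis by (simp only: F_vec_add power2_norm_eq_inner)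
  qed
  then have "(norm (mat 1 - F_op))\<^sup>2 \<le> (\<Sum>g\<in>UNIV. inner (axis g 1) (R_op *v axis g 1))"
    unfolding norm_matrix_columns by (intro sum_mono)
  also have "\<dots> = Re (trace R_op)"
    by (simp add: inner_Re_cinner cinner_axis matrix_vector_mult_axis_nth trace_def)
  also note trace_R_le
  finally show ?thesis .
qed

abbreviation W_op :: "idx \<Rightarrow> idx \<Rightarrow> complex^sl2^sl2" where
  "W_op i j \<equiv> cadj (U i) ** U j"

lemma norm_W_vec: "norm (W_op i j *v v) = norm v" "norm (cadj (W_op i j) *v v) = norm v"
  using unitary_norm[OF unitary_U] by (simp_all add: cadj_mult flip: matrix_vector_mul_assoc)

lemma norm_damped_W_diff: "norm (F_op ** W_op i j ** F_op - W_op i j) \<le> 2 * norm (mat 1 - F_op)"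
proof -
  let ?W = "W_op i j" and ?D = "mat 1 - F_op"
  have sub: "A ** (B - C) = A ** B - A ** C" "(B - C) ** A = B ** A - C ** A"
    for A B C :: "complex^sl2^sl2"
    by (simp_all add: vec_eq_iff matrix_matrix_mult_def sum_subtractf algebra_simps)
  have "F_op ** ?W ** F_op - ?W = - (F_op ** (?W ** ?D)) - ?D ** ?W"
    by (simp add: sub matrix_mul_assoc)
  then have "norm (F_op ** ?W ** F_op - ?W) \<le> norm (F_op ** (?W ** ?D)) + norm (?D ** ?W)"
    by (metis norm_minus_cancel norm_triangle_ineq4)
  also have "norm (F_op ** (?W ** ?D)) \<le> norm (?W ** ?D)"
    by (rule norm_mult_contraction) (rule norm_F_le)
  also have "norm (?W ** ?D) \<le> norm ?D"
    by (rule norm_mult_contraction) (simp add: norm_W_vec)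
  also have "norm (?D ** ?W) = norm (cadj ?W ** ?D)"
    using norm_cadj[of "?D ** ?W"] by (simp add: cadj_mult[of ?D] cadj_diff)
  also have "norm (cadj ?W ** ?D) \<le> norm ?D"
    by (rule norm_mult_contraction) (simp only: norm_W_vec order_refl)
  finally show ?thesis by simp
qed

text \<open>The tensor square involves plain squares of entries, not squared moduli. They agree for
  the real unperturbed entries w; the error e may be complex, but Re (e^2) is at least minus its
  squared modulus.\<close>

lemma Re_square_perturb:
  assumes "Im w = 0"
  shows "(norm w)\<^sup>2 + 2 * inner w e - (norm e)\<^sup>2 \<le> Re ((w + e)\<^sup>2)"
proof -
  have "Re ((w + e)\<^sup>2) - ((norm w)\<^sup>2 + 2 * inner w e - (norm e)\<^sup>2) = 2 * (Re e)\<^sup>2"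
    unfolding cmod_power2 inner_complex_def by (simp add: assms power2_eq_square algebra_simps)
  then show ?thesis using zero_le_power2[of "Re e"] by linarith
qed

text \<open>Allowance for the damping: the relative error 1 / 2048 in norm costs 2 / 2048 + 1 /
  2048^2, just below 1 / 1000.\<close>

definition loss :: real where "loss = 1 / 1000"

lemma damped_W_squares:
  "real CARD(sl2) * (1 - loss) \<le> Re (\<Sum>g\<in>UNIV. \<Sum>h\<in>UNIV. ((F_op ** W_op i j ** F_op) $ h $ g)\<^sup>2)"
proof -
  let ?d = "real CARD(sl2)" and ?W = "W_op i j"
  define E where "E = F_op ** ?W ** F_op - ?W"
  have real: "Im (?W $ h $ g) = 0" for h g
    by (simp add: cadj_U_mult_nth) (simp add: U_def)
  have "complex_of_real ((norm ?W)\<^sup>2) = trace (?W ** cadj ?W)" by (rule trace_cadj_mult[symmetric])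
  also have "?W ** cadj ?W = cadj (U i) ** (U j ** cadj (U j)) ** U i"
    by (simp only: cadj_mult cadj_cadj matrix_mul_assoc)
  also have "\<dots> = mat 1" using unitary_U[of i] unitary_U[of j] by (simp add: unitary_def)
  also have "trace (mat 1 :: complex^sl2^sl2) = complex_of_real ?d" by (simp add: trace_def mat_def)
  finally have nW: "(norm ?W)\<^sup>2 = ?d" by (simp only: of_real_eq_iff)
  have d0: "0 < ?d" by simp
  have "(norm E)\<^sup>2 \<le> (2 * norm (mat 1 - F_op))\<^sup>2"
    unfolding E_def by (intro power_mono norm_damped_W_diff) auto
  also have "\<dots> \<le> 4 * (?d * trace_bound)" using norm_one_minus_F by (simp add: power_mult_distrib)
  also have "\<dots> \<le> 4 * (?d * (1 / 4096)\<^sup>2)" using trace_bound_small(2) by (intro mult_left_mono) auto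
  also have "\<dots> = (sqrt ?d / 2048)\<^sup>2" by (simp add: power_divide)
  finally have nE2: "(norm E)\<^sup>2 \<le> (sqrt ?d / 2048)\<^sup>2" .
  then have nE: "norm E \<le> sqrt ?d / 2048" by (rule power2_le_imp_le) simp
  have nW': "norm ?W = sqrt ?d" using nW by (metis norm_ge_zero real_sqrt_unique)
  have entry: "Re (((F_op ** ?W ** F_op) $ h $ g)\<^sup>2) \<ge>
      (norm (?W $ h $ g))\<^sup>2 + 2 * inner (?W $ h $ g) (E $ h $ g) - (norm (E $ h $ g))\<^sup>2" for g h
  proof -
    have "(F_op ** ?W ** F_op) $ h $ g = ?W $ h $ g + E $ h $ g" by (simp add: E_def)
    then show ?thesis using Re_square_perturb[OF real[of h g], of "E $ h $ g"] by simp
  qed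
  have "\<bar>inner ?W E\<bar> \<le> norm ?W * norm E" by (rule Cauchy_Schwarz_ineq2)
  also have "\<dots> \<le> sqrt ?d * (sqrt ?d / 2048)" unfolding nW' by (intro mult_left_mono nE) simp
  also have "\<dots> = ?d / 2048" by simp
  finally have ip: "- (?d / 2048) \<le> inner ?W E" by linarith
  have "(norm E)\<^sup>2 \<le> ?d / 4194304" using nE2 by (simp add: power_divide)
  moreover have "?d * (1 - loss) = ?d - ?d / 1000" by (simp add: loss_def algebra_simps)
  ultimately have "?d * (1 - loss) \<le> (norm ?W)\<^sup>2 + 2 * inner ?W E - (norm E)\<^sup>2"
    using ip d0 unfolding nW by linarith
  also have "\<dots> = (\<Sum>h\<in>UNIV. \<Sum>g\<in>UNIV.
      (norm (?W $ h $ g))\<^sup>2 + 2 * inner (?W $ h $ g) (E $ h $ g) - (norm (E $ h $ g))\<^sup>2)"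
    by (simp only: norm_matrix_power2 inner_vec_def sum.distrib sum_subtractf sum_distrib_left)
  also have "\<dots> \<le> (\<Sum>h\<in>UNIV. \<Sum>g\<in>UNIV. Re (((F_op ** ?W ** F_op) $ h $ g)\<^sup>2))"
    by (intro sum_mono entry)
  also have "\<dots> = (\<Sum>g\<in>UNIV. \<Sum>h\<in>UNIV. Re (((F_op ** ?W ** F_op) $ h $ g)\<^sup>2))" by (rule sum.swap)
  finally show ?thesis by (simp only: Re_sum)
qed

lemma trace_mult_ketbra: "trace (M ** ketbra g h) = M $ h $ g" for M :: "complex^'n^'n"
proof -
  have "(M ** ketbra g h) $ i $ i = (if i = h then M $ i $ g else 0)" for i
    by (simp add: matrix_matrix_mult_def ketbra_def if_distrib[of "\<lambda>x. _ * x"] cong: if_cong)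
  then show ?thesis by (simp add: trace_def)
qed

lemma Phi_ketbra_squares:
  "real CARD(sl2) * (1 - loss) / (real par_k)\<^sup>2 \<le> Re (\<Sum>g\<in>UNIV. \<Sum>h\<in>UNIV. (Phi (ketbra g h) $ j $ i)\<^sup>2)"
proof (cases "i = j")
  case True
  have "(\<Sum>g\<in>UNIV. \<Sum>h\<in>UNIV. (Phi (ketbra g h) $ j $ i)\<^sup>2) = (\<Sum>g\<in>(UNIV :: sl2 set). (1 / of_nat par_k)\<^sup>2)"
  proof (rule sum.cong[OF refl])
    fix g
    have "(\<Sum>h\<in>UNIV. (Phi (ketbra g h) $ j $ i)\<^sup>2) = (\<Sum>h\<in>UNIV. if h = g then (1 / of_nat par_k)\<^sup>2 else 0)"
      unfolding True by (intro sum.cong refl) (simp add: Phi_diag trace_ketbra)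
    then show "(\<Sum>h\<in>UNIV. (Phi (ketbra g h) $ j $ i)\<^sup>2) = (1 / of_nat par_k)\<^sup>2" by simp
  qed
  also have "\<dots> = complex_of_real (real CARD(sl2) * (1 / real par_k)\<^sup>2)" by simp
  finally have "Re (\<Sum>g\<in>UNIV. \<Sum>h\<in>UNIV. (Phi (ketbra g h) $ j $ i)\<^sup>2) = real CARD(sl2) * (1 / real par_k)\<^sup>2"
    by (simp only: Re_complex_of_real)
  moreover have "real CARD(sl2) * (1 - loss) / (real par_k)\<^sup>2 \<le> real CARD(sl2) * 1 / (real par_k)\<^sup>2"
    by (intro divide_right_mono mult_left_mono) (auto simp: loss_def)
  ultimately show ?thesis by (simp add: power_divide)
next
  case False
  have "Phi (ketbra g h) $ j $ i = (F_op ** W_op i j ** F_op) $ h $ g / of_nat par_k" for g h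
  proof -
    have "trace (W_op i j ** (F_op ** ketbra g h ** F_op)) = trace ((F_op ** W_op i j ** F_op) ** ketbra g h)"
      using trace_mul_sym[of "W_op i j ** F_op ** ketbra g h" F_op] by (simp only: matrix_mul_assoc)
    then show ?thesis by (simp only: Phi_offdiag[OF False] trace_mult_ketbra)
  qed
  then have "(\<Sum>g\<in>UNIV. \<Sum>h\<in>UNIV. (Phi (ketbra g h) $ j $ i)\<^sup>2)
      = (\<Sum>g\<in>UNIV. \<Sum>h\<in>UNIV. ((F_op ** W_op i j ** F_op) $ h $ g)\<^sup>2) / complex_of_real ((real par_k)\<^sup>2)"
    by (simp add: power_divide sum_divide_distrib)
  then have "Re (\<Sum>g\<in>UNIV. \<Sum>h\<in>UNIV. (Phi (ketbra g h) $ j $ i)\<^sup>2)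
      = Re (\<Sum>g\<in>UNIV. \<Sum>h\<in>UNIV. ((F_op ** W_op i j ** F_op) $ h $ g)\<^sup>2) / (real par_k)\<^sup>2"
    by (simp only: Re_divide_of_real)
  then show ?thesis using damped_W_squares[of i j] by (simp only: divide_right_mono zero_le_power2)
qed

subsection \<open>The maximally entangled input\<close>

definition pure :: "complex^'n \<Rightarrow> complex^'n^'n" where
  "pure \<psi> = (\<chi> i j. \<psi> $ i * cnj (\<psi> $ j))"

lemma density_pure:
  assumes "norm \<psi> = 1"
  shows "density (pure \<psi>)"
proof -
  have "psd (pure \<psi>)" unfolding psd_def psd_on_def
  proof
    fix v :: "'a \<Rightarrow> complex"
    define s where "s = (\<Sum>i\<in>UNIV. cnj (v i) * \<psi> $ i)"
    have "(\<Sum>i\<in>UNIV. \<Sum>j\<in>UNIV. cnj (v i) * pure \<psi> $ i $ j * v j) = s * cnj s"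
      unfolding s_def cnj_sum sum_product by (simp add: pure_def mult_ac)
    also have "\<dots> = complex_of_real ((norm s)\<^sup>2)" by (rule complex_norm_square[symmetric])
    finally show "(\<Sum>i\<in>UNIV. \<Sum>j\<in>UNIV. cnj (v i) * pure \<psi> $ i $ j * v j) \<in> \<real>\<^sub>\<ge>\<^sub>0" by simp
  qed
  moreover have "trace (pure \<psi>) = cinner \<psi> \<psi>" by (simp add: trace_def pure_def cinner_def mult.commute)
  ultimately show ?thesis using assms by (simp add: density_def cinner_self)
qed

definition max_ent :: "complex^('n::finite \<times> 'n)" where
  "max_ent = (\<chi> p. if fst p = snd p then complex_of_real (1 / sqrt (real CARD('n))) else 0)"

lemma sum_diagonal: "(\<Sum>p\<in>UNIV. if fst p = snd p then G p else 0) = (\<Sum>g\<in>(UNIV :: 'n::finite set). G (g, g))"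
  for G :: "'n::finite \<times> 'n \<Rightarrow> 'a::comm_monoid_add"
  by (simp add: UNIV_Times_UNIV[symmetric] sum.cartesian_product' sum.delta' del: UNIV_Times_UNIV)

lemma norm_max_ent: "norm (max_ent :: complex^('n::finite \<times> 'n)) = 1"
proof -
  let ?v = "max_ent :: complex^('n \<times> 'n)"
  have "(norm ?v)\<^sup>2 = (\<Sum>p\<in>UNIV. (norm (?v $ p))\<^sup>2)" by (simp add: norm_vec_def L2_set_def sum_nonneg)
  also have "\<dots> = (\<Sum>p\<in>(UNIV :: ('n \<times> 'n) set). if fst p = snd p then 1 / real CARD('n) else 0)"
    by (intro sum.cong refl) (simp add: max_ent_def power_divide norm_divide)
  also have "\<dots> = 1" unfolding sum_diagonal by simp
  finally show ?thesis using norm_ge_zero[of ?v] by (auto simp: power2_eq_1_iff)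
qed

text \<open>The overlap is 1 / k times a sum of k^2 output entries, each at least (1 - loss) / k^2,
  since the maximally entangled input averages the squares of all entries of
  \<open>Phi (ketbra g h)\<close>.\<close>

lemma fidelity_ge:
  "(1 - loss) / real par_k \<le> inner max_ent (tensor_map Phi Phi (pure max_ent) *v max_ent)"
proof -
  let ?Z = "tensor_map Phi Phi (pure max_ent)"
  let ?d = "real CARD(sl2)" and ?k = "real par_k"
  let ?c = "complex_of_real (1 / sqrt ?k)" and ?e = "complex_of_real (1 / sqrt ?d)"
  have cc: "?c * ?c = complex_of_real (1 / ?k)" and ee: "?e * ?e = complex_of_real (1 / ?d)"
    unfolding of_real_mult[symmetric] by simp_all
  have Z: "?Z $ (j, j) $ (i, i) = complex_of_real (1 / ?d) * (\<Sum>g\<in>UNIV. \<Sum>h\<in>UNIV. (Phi (ketbra g h) $ j $ i)\<^sup>2)" for i j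
  proof -
    let ?G = "\<lambda>p q. Phi (ketbra (fst p) (fst q)) $ j $ i * Phi (ketbra (snd p) (snd q)) $ j $ i"
    have "?Z $ (j, j) $ (i, i) = (\<Sum>p\<in>UNIV. \<Sum>q\<in>UNIV. pure max_ent $ p $ q * ?G p q)"
      by (simp add: tensor_map_def cscale_def kron_def)
    also have "\<dots> = (\<Sum>p\<in>UNIV. if fst p = snd p then (\<Sum>q\<in>UNIV. if fst q = snd q then ?e * ?e * ?G p q else 0) else 0)"
      by (rule sum.cong[OF refl]) (auto simp: pure_def max_ent_def intro!: sum.cong)
    also have "\<dots> = (\<Sum>g\<in>UNIV. \<Sum>h\<in>UNIV. ?e * ?e * (Phi (ketbra g h) $ j $ i)\<^sup>2)"
      unfolding sum_diagonal by (simp only: fst_conv snd_conv power2_eq_square)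
    finally show ?thesis unfolding ee by (simp only: sum_distrib_left)
  qed
  have "inner max_ent (?Z *v max_ent) = Re (\<Sum>s\<in>UNIV. \<Sum>t\<in>UNIV. cnj (max_ent $ s) * (?Z $ s $ t * max_ent $ t))"
    by (simp add: inner_eq_Re matrix_vector_mult_def sum_distrib_left)
  also have "(\<Sum>s\<in>UNIV. \<Sum>t\<in>UNIV. cnj (max_ent $ s) * (?Z $ s $ t * max_ent $ t))
      = (\<Sum>s\<in>UNIV. if fst s = snd s then (\<Sum>t\<in>UNIV. if fst t = snd t then ?c * ?c * ?Z $ s $ t else 0) else 0)"
    by (rule sum.cong[OF refl]) (auto simp: max_ent_def CARD_idx intro!: sum.cong)
  also have "\<dots> = (\<Sum>j\<in>UNIV. \<Sum>i\<in>UNIV. complex_of_real (1 / ?k) * ?Z $ (j, j) $ (i, i))"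
    unfolding sum_diagonal cc ..
  also have "Re \<dots> = (\<Sum>j\<in>UNIV. \<Sum>i\<in>UNIV. 1 / ?k * (1 / ?d * Re (\<Sum>g\<in>UNIV. \<Sum>h\<in>UNIV. (Phi (ketbra g h) $ j $ i)\<^sup>2)))"
    unfolding Z Re_sum by (intro sum.cong refl) (simp add: Re_sum)
  also have "\<dots> \<ge> (\<Sum>j\<in>(UNIV :: idx set). \<Sum>i\<in>(UNIV :: idx set). 1 / ?k * (1 / ?d * (?d * (1 - loss) / ?k\<^sup>2)))"
    by (intro sum_mono mult_left_mono Phi_ketbra_squares) auto
  also have "(\<Sum>j\<in>(UNIV :: idx set). \<Sum>i\<in>(UNIV :: idx set). 1 / ?k * (1 / ?d * (?d * (1 - loss) / ?k\<^sup>2)))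
      = ?k * (?k * (1 / ?k * ((1 - loss) / ?k\<^sup>2)))"
    by (simp add: CARD_idx)
  also have "\<dots> = (1 - loss) / ?k" using par_k_ge_1 by (simp add: power2_eq_square)
  finally show ?thesis .
qed

subsection \<open>Minimal output entropies\<close>

lemma density_exists: "{\<rho> :: complex^'n^'n. density \<rho>} \<noteq> {}"
proof -
  have "density (pure (axis (undefined :: 'n) 1 :: complex^'n))"
    by (rule density_pure) (simp add: norm_axis_1)
  then show ?thesis by blast
qed

lemma H_min_Phi_ge: "ln (real par_k) - (129 / 127 * par_L)\<^sup>2 / real par_k \<le> H_min Phi"
  unfolding H_min_def by (intro cINF_greatest density_exists) (use entropy_Phi_ge in auto)

lemma H_min_tensor_le:
  "H_min (tensor_map Phi Phi)
    \<le> 2 * ln (real par_k) + 1 / real par_k - (1 - loss) * ln (real par_k) / real par_k"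
proof -
  let ?k = "real par_k"
  let ?\<rho> = "pure max_ent :: complex^(sl2 \<times> sl2)^(sl2 \<times> sl2)"
  let ?Z = "tensor_map Phi Phi ?\<rho>"
  have k: "1 \<le> ?k" using par_k_ge_1 by simp
  have dens: "density ?\<rho>" by (rule density_pure[OF norm_max_ent])
  have Z: "density ?Z" by (rule tensor_Phi_density[OF dens])
  define p where "p = inner max_ent (?Z *v max_ent)"
  have p: "(1 - loss) / ?k \<le> p" unfolding p_def by (rule fidelity_ge)
  \<comment> \<open>An infimum of reals lies below a member only once the set is known to be bounded
    below.\<close>
  have "bdd_below ((\<lambda>\<rho>. entropy (tensor_map Phi Phi \<rho>)) ` {\<rho>. density \<rho>})"
    by (rule bdd_belowI2[of _ 0]) (use tensor_Phi_density entropy_nonneg in auto)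
  then have "H_min (tensor_map Phi Phi) \<le> entropy ?Z"
    unfolding H_min_def by (rule cINF_lower) (simp add: dens)
  \<comment> \<open>The comparison state has weight 1 / k, the undamped overlap, on the entangled
    vector and spreads the rest evenly over k^2 - 1 dimensions: (1 - 1 / k) / (k^2 - 1) = 1 / (k (k
    + 1)).\<close>
  also have "\<dots> \<le> - p * ln (1 / ?k) - (1 - p) * ln (1 / (?k * (?k + 1)))"
    unfolding p_def
  proof (rule entropy_le_fidelity[OF Z norm_max_ent])
    have "real CARD(idx \<times> idx) = ?k * ?k" by (simp add: CARD_idx)
    then show "1 / ?k + (real CARD(idx \<times> idx) - 1) * (1 / (?k * (?k + 1))) = 1"
    proof -
      have "?k * ?k - 1 = (?k - 1) * (?k + 1)" by (simp add: algebra_simps)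
      moreover have "(?k - 1) * (?k + 1) * (1 / (?k * (?k + 1))) = (?k - 1) / ?k" using k by simp
      ultimately show ?thesis unfolding \<open>real CARD(idx \<times> idx) = ?k * ?k\<close> using k
        by (simp add: diff_divide_distrib)
    qed
  qed (use k in auto)
  also have "\<dots> = ln ?k + (1 - p) * ln (?k + 1)"
  proof -
    have ln: "ln (1 / ?k) = - ln ?k" "ln (1 / (?k * (?k + 1))) = - (ln ?k + ln (?k + 1))"
      using k by (simp_all add: ln_div ln_mult)
    have "- p * - u - (1 - p) * - (u + v) = u + (1 - p) * v" for u v by (simp add: algebra_simps)
    then show ?thesis unfolding ln .
  qed
  also have "\<dots> \<le> ln ?k + (1 - (1 - loss) / ?k) * ln (?k + 1)"
    using p k by (intro add_left_mono mult_right_mono) auto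
  also have "\<dots> \<le> 2 * ln ?k + 1 / ?k - (1 - loss) * ln ?k / ?k"
  proof -
    have "?k + 1 = ?k * (1 + 1 / ?k)" using k by (simp add: distrib_left)
    moreover have "ln (?k * (1 + 1 / ?k)) = ln ?k + ln (1 + 1 / ?k)"
      using k by (intro ln_mult_pos add_pos_nonneg) auto
    ultimately have "ln (?k + 1) = ln ?k + ln (1 + 1 / ?k)" by simp
    moreover have "ln (1 + 1 / ?k) \<le> 1 / ?k" using k by (intro ln_add_one_self_le_self) auto
    moreover have "ln ?k \<le> ln (?k + 1)" using k by simp
    moreover have "(1 - loss) / ?k * ln ?k \<le> (1 - loss) / ?k * ln (?k + 1)"
      using k by (intro mult_left_mono) (auto simp: loss_def)
    ultimately show ?thesis by (simp add: algebra_simps)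
  qed
  finally show ?thesis .
qed

lemma ln_2_ge: "69 / 100 \<le> ln (2 :: real)"
  using ln_approx_bounds[of 2 3] by (simp add: eval_nat_numeral)

theorem theorem1p1:
  "CARD(idx) = 2 ^ 32 \<and>
   CARD(sl2) = 3 * 2 ^ 5268390106224805281791998 \<and>
   quantum_channel Phi \<and>
   2 * H_min Phi - H_min (tensor_map Phi Phi) > 3 / 17179869184"
proof (intro conjI card_idx card_sl2 Phi_quantum_channel)
  let ?k = "real par_k"
  define c where "c = (129 / 127 * par_L)\<^sup>2"
  have k: "?k = 2 ^ 32" by (simp add: par_k_def)
  have "ln ?k = real 32 * ln 2" unfolding k by (rule ln_realpow)
  then have lnk: "2208 / 100 \<le> ln ?k" using ln_2_ge by linarith
  \<comment> \<open>Here 2 c is about 20.15 and 22.08 = 32 * 0.69 bounds ln k from below, leaving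
    about 0.9. Division by k = 2^32 turns 3 / 4 into the stated 3 / 2^34.\<close>
  have "3 / 4 < (1 - loss) * (2208 / 100) - 1 - 2 * c"
    by (simp add: c_def loss_def par_L_def power2_eq_square)
  also have "\<dots> \<le> (1 - loss) * ln ?k - 1 - 2 * c"
    using lnk by (intro diff_right_mono mult_left_mono) (auto simp: loss_def)
  finally have "3 / 4 / ?k < ((1 - loss) * ln ?k - 1 - 2 * c) / ?k"
    unfolding k by (rule divide_strict_right_mono) simp
  also have "\<dots> = 2 * (ln ?k - c / ?k) - (2 * ln ?k + 1 / ?k - (1 - loss) * ln ?k / ?k)"
    by (simp add: diff_divide_distrib)
  also have "\<dots> \<le> 2 * H_min Phi - H_min (tensor_map Phi Phi)"
    unfolding c_def by (intro diff_mono mult_left_mono H_min_Phi_ge H_min_tensor_le) simp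
  also have "3 / 4 / ?k = 3 / 17179869184" by (simp add: k)
  finally show "3 / 17179869184 < 2 * H_min Phi - H_min (tensor_map Phi Phi)" .
qed

end
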